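(* (i) For $b\ge 3.062$, $$\min_{z\in\mathbb{H}}\big(\zeta(6,z)-b\zeta(3,z)\big)=\min_{z\in\overline{\mathcal{D}_{\mathcal{G}}}}\big(\zeta(6,z)-b\zeta(3,z)\big)=\min_{z\in\Gamma}\big(\zeta(6,z)-b\zeta(3,z)\big).$$ (ii) For $b\ge 3$, $$\min_{z\in\overline{\mathcal{D}_{\mathcal{G}}}\cap\{\Im z\ge1\}}\big(\zeta(6,z)-b\zeta(3,z)\big)=\min_{z\in\Gamma_a}\big(\zeta(6,z)-b\zeta(3,z)\big).$$
   Context: $\mathbb{H}=\{z=x+iy: y>0\}$. For $s>1$, $\zeta(s,z)=\sum_{(m,n)\in\mathbb{Z}^2\setminus\{0\}}\frac{(\Im z)^s}{|mz+n|^{2s}}$. $\mathcal{D}_{\mathcal{G}}=\{z\in\mathbb{H}: |z|>1,\ 0<\Re z<\frac12\}$. $\Gamma_a=\{z\in\mathbb{H}:\Re z=0,\ \Im z\ge1\}$, $\Gamma_b=\{z\in\mathbb{H}: |z|=1,\ \Im z\in[\frac{\sqrt3}{2},1]\}$, $\Gamma=\Gamma_a\cup\Gamma_b$. *)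

theory Defs
  imports "HOL-Analysis.Analysis"
begin

definition upper_half_plane :: "complex set" where
  "upper_half_plane = {z. Im z > 0}"

definition epstein_zeta :: "real \<Rightarrow> complex \<Rightarrow> real" where
  "epstein_zeta s z =
     (\<Sum>\<^sub>\<infinity>(m,n)\<in>(UNIV - {(0,0)} :: (int \<times> int) set).
        (Im z) powr s / (cmod (of_int m * z + of_int n)) powr (2 * s))"

definition D_G :: "complex set" where
  "D_G = {z. Im z > 0 \<and> cmod z > 1 \<and> 0 < Re z \<and> Re z < 1/2}"

definition Gamma_a :: "complex set" where
  "Gamma_a = {z. Im z > 0 \<and> Re z = 0 \<and> Im z \<ge> 1}"

definition Gamma_b :: "complex set" where
  "Gamma_b = {z. Im z > 0 \<and> cmod z = 1 \<and> sqrt 3 / 2 \<le> Im z \<and> Im z \<le> 1}"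

definition Gamma_path :: "complex set" where
  "Gamma_path = Gamma_a \<union> Gamma_b"

definition is_min_on :: "('a \<Rightarrow> real) \<Rightarrow> 'a set \<Rightarrow> real \<Rightarrow> bool" where
  "is_min_on f S m \<longleftrightarrow> (\<exists>z\<in>S. f z = m) \<and> (\<forall>z\<in>S. m \<le> f z)"

end

theory Submission
  imports Defs
begin

text \<open>
  Write \<open>W\<^sub>b = \<zeta>(6, \<cdot>) - b \<zeta>(3, \<cdot>)\<close> and \<open>z = x + i y\<close>. For every \<open>b \<ge> 3.062\<close> the minimum over the
  half plane is already attained on the half line \<open>x = 0, y \<ge> 1\<close>.

  Summing over one row of the lattice and expanding in a Fourier series in \<open>x\<close> gives
  \<open>\<zeta>(s, i y) - \<zeta>(s, z) = 2 \<Sum>\<^sub>m m\<^sup>-\<^sup>s D\<^sub>s(m x, m y)\<close> with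
  \<open>D\<^sub>s(x, y) = \<Sum>\<^sub>k a\<^sub>s\<^sub>,\<^sub>k(y) (1 - cos 2\<pi>k x)\<close> and coefficients that are elementary (Bessel
  functions of half-integral order) and of size \<open>e\<^sup>-\<^sup>2\<^sup>\<pi>\<^sup>k\<^sup>y\<close>. For \<open>y \<ge> 1\<close> this yields \<open>D\<^sub>6 \<le> 3 D\<^sub>3\<close>,
  so moving horizontally to \<open>x = 0\<close> does not increase \<open>W\<^sub>b\<close> when \<open>b \<ge> 3\<close>.

  In the rest of the fundamental domain, \<open>\<surd>3/2 \<le> y < 1\<close>, every point is compared with \<open>i\<close>. For
  \<open>b = 3.062\<close> the possible loss of a horizontal move to \<open>i y\<close> is a quadratic in \<open>1 - cos 2\<pi>x\<close> with a
  small maximum, and it is outweighed by \<open>W\<^sub>b(i y) - W\<^sub>b(i)\<close>, which Jensen's inequality applied to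
  the pairs of terms \<open>(m, n), (n, m)\<close> bounds from below. The passage to larger \<open>b\<close> uses
  \<open>\<zeta>(3, z) \<le> \<zeta>(3, i)\<close>.
\<close>

section \<open>Fourier expansion of a lattice row\<close>

text \<open>Only the row with s = 1 is summed directly, through the reflection formula of the
  digamma function. Differentiation in y turns 1/((x+n)^2+y^2)^s into a multiple of the same term
  with s + 1, so the rows up to s = 6 follow by differentiating the expansion.

  Both D_3 and D_6 are nonnegative and they enter W_b with opposite signs, so s = 6 needs upper and
  s = 3 lower bounds. For b = 3 the comparison leaves little room at y = 1. Shortly below height 1
  the coefficient of first order in 1 - cos 2 pi x turns positive, and a horizontal move to the axis
  can then increase W_b. What has to pay for this is itself small: y -> 1/y is a symmetry of the
  axis, so W_b(i y) - W_b(i) is only of order (1 - y)^2. Loss and gain are therefore compared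
  through one polynomial (1 - y)^2 f(1 - y), with constants chosen to work on the whole range 1 - y
  \<le> 0.134, which covers 1 - sqrt 3 / 2.\<close>

lemma Digamma_reflection_complex:
  fixes z :: complex
  assumes "z \<notin> \<int>"
  shows "Digamma (1 - z) - Digamma z = of_real pi * cot (of_real pi * z)"
proof -
  have z: "z \<notin> \<int>\<^sub>\<le>\<^sub>0" "1 - z \<notin> \<int>\<^sub>\<le>\<^sub>0"
    using assms nonpos_Ints_Int[of z] nonpos_Ints_Int[of "1 - z"] Ints_diff[of 1 "1 - z"] by auto
  have sn: "sin (of_real pi * z) \<noteq> 0"
    using assms by (auto simp: sin_eq_0)
  \<comment> \<open>Both sides of Gamma(w) Gamma(1 - w) = pi / sin(pi w) are differentiated;
    dividing the result by the formula itself leaves the digamma difference.\<close>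
  have "((\<lambda>w. Gamma w * Gamma (1 - w)) has_field_derivative
          Gamma z * Digamma z * Gamma (1 - z) - Gamma z * (Gamma (1 - z) * Digamma (1 - z))) (at z)"
    using z by (auto intro!: derivative_eq_intros simp: algebra_simps)
  moreover have "((\<lambda>w. of_real pi / sin (of_real pi * w)) has_field_derivative
          - (of_real pi * (cos (of_real pi * z) * of_real pi)) / (sin (of_real pi * z))\<^sup>2) (at z)"
    using sn by (auto intro!: derivative_eq_intros simp: power2_eq_square)
  ultimately have "Gamma z * Digamma z * Gamma (1 - z) - Gamma z * (Gamma (1 - z) * Digamma (1 - z))
        = - (of_real pi * (cos (of_real pi * z) * of_real pi)) / (sin (of_real pi * z))\<^sup>2"
    unfolding Gamma_reflection_complex by (rule DERIV_unique)
  hence "(Gamma z * Gamma (1 - z)) * (Digamma (1 - z) - Digamma z)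
        = (of_real pi / sin (of_real pi * z)) * (of_real pi * cot (of_real pi * z))"
    using sn by (simp add: cot_def power2_eq_square algebra_simps)
  thus ?thesis
    using sn by (simp add: Gamma_reflection_complex)
qed

text \<open>The source of the Fourier series in x: cot is a Moebius function of q = exp(2 pi i z),
  and |q| < 1 in the upper half plane. The series starts at k = 0, so the constant term is counted
  twice and the -1 corrects it.\<close>

lemma pi_cot_eq_geometric:
  fixes z :: complex
  assumes "Im z > 0"
  shows "of_real pi * cot (of_real pi * z)
           = - \<i> * of_real pi * (2 * (\<Sum>k. exp (2 * of_real pi * \<i> * z) ^ k) - 1)"
proof -
  define q where "q = exp (2 * of_real pi * \<i> * z)"
  define e where "e = exp (\<i> * (of_real pi * z))"
  have q: "q = e ^ 2" and e0: "e \<noteq> 0"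
    by (simp_all add: q_def e_def exp_double[symmetric] mult_ac)
  have nq: "norm q < 1"
    using assms by (simp add: q_def)
  hence q1: "q \<noteq> 1" by auto
  have s: "sin (of_real pi * z) = (e - inverse e) / (2 * \<i>)"
    by (simp add: sin_exp_eq e_def exp_minus)
  have c: "cos (of_real pi * z) = (e + inverse e) / 2"
    by (simp add: cos_exp_eq e_def exp_minus)
  have "cot (of_real pi * z) = - \<i> * (2 / (1 - q) - 1)"
    unfolding cot_def s c using e0 q1 by (simp add: q field_simps power2_eq_square)
  thus ?thesis
    using suminf_geometric[OF nq] by (simp add: q_def[symmetric] divide_inverse)
qed

text \<open>The part n \<ge> 0 of a row. The part n \<le> -1 is the same function at 1 - x, which
  matches the two digamma values in the reflection formula.\<close>

definition half_sum :: "nat \<Rightarrow> real \<Rightarrow> real \<Rightarrow> real" where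
  "half_sum s x y = (\<Sum>n::nat. 1 / ((x + n)\<^sup>2 + y\<^sup>2) ^ s)"

text \<open>The real part of the sum of k^j q^k with q = exp(2 pi i z). Since 0^0 = 1, the term k =
  0 contributes 1 for j = 0 and nothing for j > 0; hence the -1/2 that accompanies
  \<open>trig_sum 0\<close> below.\<close>

definition trig_sum :: "nat \<Rightarrow> real \<Rightarrow> real \<Rightarrow> real" where
  "trig_sum j x y = (\<Sum>k::nat. cos (2 * pi * k * x) * real k ^ j * exp (- 2 * pi * y) ^ k)"

section \<open>Convergence and termwise differentiation in y\<close>

lemma shifted_square_lower_bound:
  fixes x y0 :: real
  assumes "y0 > 0"
  obtains C where "C > 0" "\<And>n y. y \<ge> y0 \<Longrightarrow> 1 / ((x + real n)\<^sup>2 + y\<^sup>2) \<le> C / (real (Suc n))\<^sup>2"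
proof -
  \<comment> \<open>C depends on y0 but not on y, so the same bound serves as a majorant for a whole
    neighbourhood of heights.\<close>
  define C where "C = 4 + (4 * x\<^sup>2 + 2) / y0\<^sup>2"
  have C: "C > 0" using assms by (auto simp: C_def intro!: add_pos_nonneg)
  have "1 / ((x + real n)\<^sup>2 + y\<^sup>2) \<le> C / (real (Suc n))\<^sup>2" if "y \<ge> y0" for n y
  proof -
    have yy: "y0\<^sup>2 \<le> y\<^sup>2" using that assms by (intro power_mono) auto
    have p: "y\<^sup>2 > 0" using that assms by auto
    have "(real (Suc n))\<^sup>2 \<le> 4 * (x + n)\<^sup>2 + (4 * x\<^sup>2 + 2)"
    proof -
      \<comment> \<open>This sum of squares is exactly the difference of the two sides.\<close>
      have "0 \<le> (real n + 2 * x)\<^sup>2 + (real n - 1)\<^sup>2 + (real n + 2 * x)\<^sup>2" by simp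
      thus ?thesis by (simp add: power2_eq_square algebra_simps) 
    qed
    also have "(4 * x\<^sup>2 + 2) \<le> (4 * x\<^sup>2 + 2) / y0\<^sup>2 * y\<^sup>2"
    proof -
      have "(4 * x\<^sup>2 + 2) * y0\<^sup>2 \<le> (4 * x\<^sup>2 + 2) * y\<^sup>2"
        using yy by (intro mult_left_mono) auto
      thus ?thesis using assms by (simp add: pos_le_divide_eq)
    qed
    also have "4 * (x + n)\<^sup>2 + \<dots> \<le> C * ((x + n)\<^sup>2 + y\<^sup>2)"
    proof -
      have "C * ((x + n)\<^sup>2 + y\<^sup>2) - (4 * (x + n)\<^sup>2 + (4 * x\<^sup>2 + 2) / y0\<^sup>2 * y\<^sup>2)
              = 4 * y\<^sup>2 + (4 * x\<^sup>2 + 2) / y0\<^sup>2 * (x + n)\<^sup>2"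
        by (simp add: C_def ring_distribs)
      moreover have "\<dots> \<ge> 0" by (intro add_nonneg_nonneg mult_nonneg_nonneg divide_nonneg_nonneg) auto
      ultimately show ?thesis by linarith
    qed
    finally have "(real (Suc n))\<^sup>2 \<le> C * ((x + n)\<^sup>2 + y\<^sup>2)" by simp
    thus ?thesis using p by (simp add: divide_simps add_nonneg_pos mult.commute)
  qed
  thus thesis using that C by blast
qed

lemma summable_inverse_Suc_power:
  assumes "s \<ge> 1"
  shows "summable (\<lambda>n. (C / (real (Suc n))\<^sup>2) ^ s)"
proof -
  have "summable (\<lambda>n. inverse (real (Suc n) ^ (2 * s)))"
    using assms by (subst summable_Suc_iff) (intro inverse_power_summable, simp)
  hence "summable (\<lambda>n. C ^ s * inverse (real (Suc n) ^ (2 * s)))"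
    by (rule summable_mult)
  moreover have "C ^ s * inverse (real (Suc n) ^ (2 * s)) = (C / (real (Suc n))\<^sup>2) ^ s" for n
    by (simp only: power_divide power_mult) (simp only: divide_inverse)
  ultimately show ?thesis by (simp only:)
qed

lemma summable_half_sum:
  fixes x y :: real
  assumes "y > 0" "s \<ge> 1"
  shows "summable (\<lambda>n::nat. 1 / ((x + n)\<^sup>2 + y\<^sup>2) ^ s)"
proof -
  obtain C where C: "C > 0" "\<And>n. 1 / ((x + real n)\<^sup>2 + y\<^sup>2) \<le> C / (real (Suc n))\<^sup>2"
    using shifted_square_lower_bound[OF assms(1), of x] by (metis order.refl)
  show ?thesis
  proof (rule summable_comparison_test'[OF summable_inverse_Suc_power[OF assms(2), of C]])
    fix n :: nat
    have "(1 / ((x + n)\<^sup>2 + y\<^sup>2)) ^ s \<le> (C / (real (Suc n))\<^sup>2) ^ s"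
      using C(2)[of n] by (intro power_mono) auto
    thus "norm (1 / ((x + n)\<^sup>2 + y\<^sup>2) ^ s) \<le> (C / (real (Suc n))\<^sup>2) ^ s"
      by (simp add: power_divide)
  qed
qed

lemma has_field_derivative_half_sum:
  fixes x y :: real
  assumes "y > 0" "s \<ge> 1"
  shows "(half_sum s x has_field_derivative (- 2 * s * y * half_sum (Suc s) x y)) (at y)"
proof -
  \<comment> \<open>A neighbourhood bounded away from 0 and infinity: the left end feeds the uniform
    bound for the terms, the right end bounds the factor u in the derivative.\<close>
  define S where "S = {y/2<..<2*y}"
  define f where "f n u = 1 / ((x + real n)\<^sup>2 + u\<^sup>2) ^ s" for n :: nat and u :: real
  define f' where "f' n u = - 2 * s * u * (1 / ((x + real n)\<^sup>2 + u\<^sup>2) ^ Suc s)" for n :: nat and u :: real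
  obtain C where C: "C > 0" "\<And>n u. u \<ge> y/2 \<Longrightarrow> 1 / ((x + real n)\<^sup>2 + u\<^sup>2) \<le> C / (real (Suc n))\<^sup>2"
    using shifted_square_lower_bound[of "y/2" x] assms by auto
  have der: "(f n has_field_derivative f' n u) (at u within S)" if "u \<in> S" for n :: nat and u :: real
  proof -
    have p: "(x + n)\<^sup>2 + u\<^sup>2 > 0" using that assms by (auto simp: S_def intro!: add_nonneg_pos)
    obtain k where k: "s = Suc k" using assms by (cases s) auto
    have "((\<lambda>u. (x + real n)\<^sup>2 + u\<^sup>2) has_field_derivative 2 * u) (at u within S)"
      by (auto intro!: derivative_eq_intros)
    from DERIV_divide[OF DERIV_const[of 1] DERIV_power[OF this, of s]]
    have "((\<lambda>u. 1 / ((x + real n)\<^sup>2 + u\<^sup>2) ^ s) has_field_derivative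
        (0 * ((x + real n)\<^sup>2 + u\<^sup>2) ^ s - 1 * (real s * (2 * u * ((x + real n)\<^sup>2 + u\<^sup>2) ^ (s - Suc 0)))) /
        (((x + real n)\<^sup>2 + u\<^sup>2) ^ s * ((x + real n)\<^sup>2 + u\<^sup>2) ^ s)) (at u within S)"
      using p by (metis less_irrefl zero_less_power)
    moreover have "(0 * Q ^ s - 1 * (real s * (2 * u * Q ^ (s - Suc 0)))) / (Q ^ s * Q ^ s)
                     = - 2 * s * u * (1 / Q ^ Suc s)" if "Q > 0" for Q :: real
      using that by (simp add: k field_simps)
    ultimately show ?thesis
      unfolding f_def f'_def using p by simp
  qed
  have uc: "uniformly_convergent_on S (\<lambda>n u. \<Sum>i<n. f' i u)"
  proof (rule Weierstrass_m_test')
    fix n u assume u: "u \<in> S"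
    have "(1 / ((x + n)\<^sup>2 + u\<^sup>2)) ^ Suc s \<le> (C / (real (Suc n))\<^sup>2) ^ Suc s"
      using C(2)[of u n] u by (intro power_mono) (auto simp: S_def)
    hence "(2 * s * u) * (1 / ((x + n)\<^sup>2 + u\<^sup>2)) ^ Suc s \<le> (2 * s * (2 * y)) * (C / (real (Suc n))\<^sup>2) ^ Suc s"
      using u assms C(1) by (intro mult_mono) (auto simp: S_def)
    thus "norm (f' n u) \<le> (2 * s * (2 * y)) * (C / (real (Suc n))\<^sup>2) ^ Suc s"
      using u assms by (simp add: f'_def abs_mult power_divide S_def)
  qed (intro summable_mult summable_inverse_Suc_power, simp)
  have "((\<lambda>u. \<Sum>n. f n u) has_field_derivative (\<Sum>n. f' n y)) (at y)"
  proof (rule has_field_derivative_series'(2)[OF _ der uc, of y])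
    show "y \<in> interior S" using assms by (simp add: S_def)
    show "summable (\<lambda>n. f n y)" unfolding f_def by (rule summable_half_sum[OF assms])
  qed (use assms in \<open>auto simp: S_def\<close>)
  moreover have "(\<Sum>n. f' n y) = - 2 * s * y * half_sum (Suc s) x y"
    unfolding f'_def half_sum_def by (rule suminf_mult, rule summable_half_sum) (use assms in auto)
  ultimately show ?thesis by (simp add: f_def half_sum_def[abs_def])
qed

lemma summable_power_geometric:
  fixes q :: real
  assumes "\<bar>q\<bar> < 1"
  shows "summable (\<lambda>k. real k ^ j * q ^ k)"
  using assms
proof (induction j arbitrary: q)
  case 0
  thus ?case by (simp add: summable_geometric)
next
  case (Suc j)
  have "summable (\<lambda>k. diffs (\<lambda>k. real k ^ j) k * q ^ k)"
    by (rule termdiff_converges[where K = 1]) (use Suc in auto)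
  hence "summable (\<lambda>k. q * (diffs (\<lambda>k. real k ^ j) k * q ^ k))"
    by (rule summable_mult)
  also have "(\<lambda>k. q * (diffs (\<lambda>k. real k ^ j) k * q ^ k)) = (\<lambda>k. real (Suc k) ^ Suc j * q ^ Suc k)"
    by (auto simp: diffs_def algebra_simps)
  finally show ?case by (subst (asm) summable_Suc_iff)
qed

lemma abs_summable_trig_sum:
  assumes "y > 0"
  shows "summable (\<lambda>k::nat. \<bar>cos (2 * pi * k * x) * real k ^ j * exp (- 2 * pi * y) ^ k\<bar>)"
proof (rule summable_comparison_test'[OF summable_power_geometric[of "exp (- 2 * pi * y)" j]])
  fix k :: nat
  have "\<bar>cos (2 * pi * k * x)\<bar> * (real k ^ j * exp (- 2 * pi * y) ^ k) \<le> 1 * (real k ^ j * exp (- 2 * pi * y) ^ k)"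
    by (intro mult_right_mono) auto
  thus "norm \<bar>cos (2 * pi * k * x) * real k ^ j * exp (- 2 * pi * y) ^ k\<bar> \<le> real k ^ j * exp (- 2 * pi * y) ^ k"
    by (simp add: abs_mult)
qed (use assms in auto)

text \<open>As a power series in q = exp(-2 pi y), the operator d/dy is -2 pi q d/dq, which
  multiplies the k-th coefficient by k and so raises j by one.\<close>

lemma has_field_derivative_trig_sum:
  assumes "y > 0"
  shows "(trig_sum j x has_field_derivative (- 2 * pi * trig_sum (Suc j) x y)) (at y)"
proof -
  define c where "c k = cos (2 * pi * real k * x) * real k ^ j" for k
  define q where "q = exp (- 2 * pi * y)"
  have q: "0 < q" "q < 1" using assms by (auto simp: q_def)
  have sm: "summable (\<lambda>k. c k * u ^ k)" if u: "norm u < 1" for u :: real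
  proof (cases "u = 0")
    case True thus ?thesis by (intro summable_finite[of "{0}"]) auto
  next
    case False
    show ?thesis
    proof (rule summable_comparison_test'[OF summable_power_geometric[of "\<bar>u\<bar>" j]])
      fix k :: nat
      have "\<bar>cos (2 * pi * k * x)\<bar> * (real k ^ j * \<bar>u\<bar> ^ k) \<le> 1 * (real k ^ j * \<bar>u\<bar> ^ k)"
        by (intro mult_right_mono) auto
      thus "norm (c k * u ^ k) \<le> real k ^ j * \<bar>u\<bar> ^ k"
        by (simp add: abs_mult c_def power_abs)
    qed (use False u in auto)
  qed
  have D: "((\<lambda>u. \<Sum>k. c k * u ^ k) has_field_derivative (\<Sum>k. diffs c k * q ^ k)) (at q)"
    by (rule termdiffs_strong'[where K = 1]) (use sm q in auto)
  have sd: "summable (\<lambda>k. diffs c k * q ^ k)"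
    by (rule termdiff_converges[where K = 1]) (use sm q in auto)
  have "(\<lambda>k. real k * c k * q ^ (k - Suc 0)) sums (\<Sum>k. diffs c k * q ^ k)"
    using diffs_equiv[OF sd] by simp
  hence "(\<lambda>k. q * (real k * c k * q ^ (k - Suc 0))) sums (q * (\<Sum>k. diffs c k * q ^ k))"
    by (rule sums_mult)
  also have "(\<lambda>k. q * (real k * c k * q ^ (k - Suc 0))) = (\<lambda>k. cos (2 * pi * real k * x) * real k ^ Suc j * q ^ k)"
  proof
    fix k show "q * (real k * c k * q ^ (k - Suc 0)) = cos (2 * pi * real k * x) * real k ^ Suc j * q ^ k"
      by (cases k) (auto simp: c_def)
  qed
  finally have e: "q * (\<Sum>k. diffs c k * q ^ k) = trig_sum (Suc j) x y"
    by (simp add: trig_sum_def q_def sums_iff)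
  have "((\<lambda>u. exp (- 2 * pi * u)) has_field_derivative (- 2 * pi * q)) (at y)"
    unfolding q_def by (auto intro!: derivative_eq_intros)
  from DERIV_chain2[OF D[unfolded q_def] this]
  have "((\<lambda>u. \<Sum>k. c k * exp (- 2 * pi * u) ^ k) has_field_derivative (\<Sum>k. diffs c k * q ^ k) * (- 2 * pi * q)) (at y)"
    by (simp add: q_def)
  moreover have "(\<Sum>k. diffs c k * q ^ k) * (- 2 * pi * q) = - 2 * pi * trig_sum (Suc j) x y"
    by (simp add: e[symmetric])
  moreover have "trig_sum j x = (\<lambda>u. \<Sum>k. c k * exp (- 2 * pi * u) ^ k)"
    by (simp add: fun_eq_iff trig_sum_def c_def)
  ultimately show ?thesis by metis
qed


section \<open>Closed forms of the rows for s = 1, ..., 6\<close>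

definition row_sum :: "nat \<Rightarrow> real \<Rightarrow> real \<Rightarrow> real" where
  "row_sum s x y = half_sum s x y + half_sum s (1 - x) y"

text \<open>The imaginary part of the reflection formula: Im (1/(w+n)) = -Im w / |w+n|^2 produces
  the row, while the harmonic terms of the digamma series and Euler's constant are real and drop
  out.\<close>

lemma row_sum_1:
  assumes "y > 0"
  shows "row_sum 1 x y = 2 * pi ^ 1 * ((trig_sum 0 x y - 1/2) * inverse y ^ 1)"
proof -
  define z where "z = Complex x y"
  have zi: "z \<notin> \<int>" using assms complex_is_Int_iff[of z] by (auto simp: z_def)
  \<comment> \<open>The sign of Im w is left free because 1 - z lies in the lower half
    plane.\<close>
  have H: "Im (Digamma w) = Im w * half_sum 1 (Re w) (Im w)" if "Im w \<noteq> 0" for w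
  proof -
    have "w \<noteq> 0" using that by auto
    from summable_Digamma[OF this]
    have "(\<lambda>n. inverse (of_nat (Suc n)) - inverse (w + of_nat n)) sums
            (\<Sum>n. inverse (of_nat (Suc n)) - inverse (w + of_nat n))" by (rule summable_sums)
    hence "(\<lambda>n. Im (inverse (of_nat (Suc n)) - inverse (w + of_nat n))) sums
            Im (\<Sum>n. inverse (of_nat (Suc n)) - inverse (w + of_nat n))" by (rule sums_Im)
    moreover have "Im (inverse (of_nat (Suc n)) - inverse (w + of_nat n)) = Im w * (1 / ((Re w + n)\<^sup>2 + (Im w)\<^sup>2) ^ 1)" for n
    proof -
      have "Im (inverse (of_nat (Suc n) :: complex)) = 0"
        by (metis Im_complex_of_real of_real_inverse of_real_of_nat_eq)
      thus ?thesis by (simp del: of_nat_Suc)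
    qed
    moreover have "Im (euler_mascheroni :: complex) = 0"
      by (metis Im_complex_of_real of_real_euler_mascheroni)
    ultimately have "(\<lambda>n. Im w * (1 / ((Re w + n)\<^sup>2 + (Im w)\<^sup>2) ^ 1)) sums Im (Digamma w)"
      by (simp add: Digamma_def)
    moreover have "summable (\<lambda>n::nat. 1 / ((Re w + n)\<^sup>2 + \<bar>Im w\<bar>\<^sup>2) ^ 1)"
      using that by (intro summable_half_sum) auto
    hence "(\<Sum>n. Im w * (1 / ((Re w + n)\<^sup>2 + (Im w)\<^sup>2) ^ 1)) = Im w * half_sum 1 (Re w) (Im w)"
      unfolding half_sum_def power2_abs by (rule suminf_mult)
    ultimately show ?thesis by (simp add: sums_iff)
  qed
  have "half_sum 1 (1 - x) (- y) = half_sum 1 (1 - x) y" by (simp add: half_sum_def)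
  hence L: "Im (Digamma (1 - z) - Digamma z) = - y * row_sum 1 x y"
    using H[of z] H[of "1 - z"] assms by (simp add: z_def row_sum_def algebra_simps)
  have iz: "Im z > 0" using assms by (simp add: z_def)
  define q where "q = exp (2 * of_real pi * \<i> * z)"
  have nq: "norm q < 1" using iz by (simp add: q_def)
  have qk: "Re (q ^ k) = cos (2 * pi * real k * x) * real k ^ 0 * exp (- 2 * pi * y) ^ k" for k
  proof -
    have "q ^ k = exp (of_nat k * (2 * of_real pi * \<i> * z))" by (simp add: q_def exp_of_nat_mult)
    thus ?thesis by (simp add: Re_exp z_def exp_of_nat_mult[symmetric] algebra_simps)
  qed
  have "Re (\<Sum>k. q ^ k) = (\<Sum>k. Re (q ^ k))"
    using sums_Re[OF summable_sums[OF summable_geometric[OF nq]]] by (simp add: sums_iff)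
  also have "\<dots> = trig_sum 0 x y" unfolding qk trig_sum_def ..
  finally have R: "Re (\<Sum>k. q ^ k) = trig_sum 0 x y" .
  have "Im (- \<i> * of_real pi * (2 * (\<Sum>k. q ^ k) - 1)) = - pi * (2 * trig_sum 0 x y - 1)"
    using R by simp
  hence "- y * row_sum 1 x y = - pi * (2 * trig_sum 0 x y - 1)"
    using L Digamma_reflection_complex[OF zi] pi_cot_eq_geometric[OF iz] by (simp add: q_def)
  thus ?thesis using assms by (simp add: field_simps)
qed

text \<open>The y-derivative of the row with exponent s is -2 s y times the row with exponent s + 1;
  uniqueness of the derivative then reads the next closed form off the present one.\<close>

lemma row_sum_Suc:
  assumes "y > 0" "s \<ge> 1" "\<And>u. u > 0 \<Longrightarrow> row_sum s x u = R u"
    "(R has_field_derivative R') (at y)"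
  shows "row_sum (Suc s) x y = - R' * inverse y / (2 * s)"
proof -
  have "(row_sum s x has_field_derivative (- 2 * s * y * row_sum (Suc s) x y)) (at y)"
    unfolding row_sum_def[abs_def]
    by (rule derivative_eq_intros has_field_derivative_half_sum assms refl)+ (simp add: algebra_simps)
  moreover have "(row_sum s x has_field_derivative R') (at y)"
    by (rule has_field_derivative_transform_within_open[OF assms(4), of "{0<..}"]) (use assms in auto)
  ultimately have "- 2 * s * y * row_sum (Suc s) x y = R'" by (rule DERIV_unique)
  thus ?thesis using assms(1,2) by (simp add: field_simps)
qed

text \<open>With a = 1/2 for j = 0 and a = 0 for j > 0 every summand of the closed forms has this
  one shape, which is why they contain formal terms such as
  \<open>trig_sum 1 x y - 0\<close>.\<close>

lemma has_field_derivative_trig_sum_inverse_power: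
  assumes "y > 0"
  shows "((\<lambda>u. (trig_sum j x u - a) * inverse u ^ k) has_field_derivative
     (- 2 * pi * trig_sum (Suc j) x y * inverse y ^ k - k * (trig_sum j x y - a) * inverse y ^ Suc k)) (at y)"
proof -
  have "((\<lambda>u. inverse u ^ k) has_field_derivative (- k * inverse y ^ Suc k)) (at y)"
  proof (cases k)
    case (Suc m)
    have "(inverse has_field_derivative - (inverse y ^ 2)) (at y)"
      using DERIV_inverse[of y UNIV] assms by (simp add: numeral_2_eq_2)
    from DERIV_power[OF this, of k] show ?thesis
      by (simp add: Suc power2_eq_square algebra_simps)
  qed simp
  from DERIV_mult[OF DERIV_diff[OF has_field_derivative_trig_sum[OF assms, of j x] DERIV_const[of a]] this]
  show ?thesis by (simp add: algebra_simps)
qed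


lemma row_sum_2:
  assumes "y > 0"
  shows "row_sum 2 x y =
            2 * pi ^ 2 * ((trig_sum 1 x y - 0) * inverse y ^ 2)
          + 1 * pi ^ 1 * ((trig_sum 0 x y - 1/2) * inverse y ^ 3)"
proof -
  have "((\<lambda>u. 2 * pi ^ 1 * ((trig_sum 0 x u - 1/2) * inverse u ^ 1)) has_field_derivative
          (2 * pi ^ 1 * (- 2 * pi * trig_sum (Suc 0) x y * inverse y ^ 1 - real 1 * (trig_sum 0 x y - 1/2) * inverse y ^ Suc 1))) (at y)"
    by (intro DERIV_add DERIV_cmult has_field_derivative_trig_sum_inverse_power assms)
  from row_sum_Suc[OF assms _ row_sum_1 this] show ?thesis
    by (simp add: eval_nat_numeral algebra_simps add_divide_distrib)
qed

lemma row_sum_3: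
  assumes "y > 0"
  shows "row_sum 3 x y =
            1 * pi ^ 3 * ((trig_sum 2 x y - 0) * inverse y ^ 3)
          + 3 / 2 * pi ^ 2 * ((trig_sum 1 x y - 0) * inverse y ^ 4)
          + 3 / 4 * pi ^ 1 * ((trig_sum 0 x y - 1/2) * inverse y ^ 5)"
proof -
  have "((\<lambda>u. 2 * pi ^ 2 * ((trig_sum 1 x u - 0) * inverse u ^ 2)
          + 1 * pi ^ 1 * ((trig_sum 0 x u - 1/2) * inverse u ^ 3)) has_field_derivative
          (2 * pi ^ 2 * (- 2 * pi * trig_sum (Suc 1) x y * inverse y ^ 2 - real 2 * (trig_sum 1 x y - 0) * inverse y ^ Suc 2)
          + 1 * pi ^ 1 * (- 2 * pi * trig_sum (Suc 0) x y * inverse y ^ 3 - real 3 * (trig_sum 0 x y - 1/2) * inverse y ^ Suc 3))) (at y)"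
    by (intro DERIV_add DERIV_cmult has_field_derivative_trig_sum_inverse_power assms)
  from row_sum_Suc[OF assms _ row_sum_2 this] show ?thesis
    by (simp add: eval_nat_numeral algebra_simps add_divide_distrib)
qed

lemma row_sum_4:
  assumes "y > 0"
  shows "row_sum 4 x y =
            1 / 3 * pi ^ 4 * ((trig_sum 3 x y - 0) * inverse y ^ 4)
          + 1 * pi ^ 3 * ((trig_sum 2 x y - 0) * inverse y ^ 5)
          + 5 / 4 * pi ^ 2 * ((trig_sum 1 x y - 0) * inverse y ^ 6)
          + 5 / 8 * pi ^ 1 * ((trig_sum 0 x y - 1/2) * inverse y ^ 7)"
proof -
  have "((\<lambda>u. 1 * pi ^ 3 * ((trig_sum 2 x u - 0) * inverse u ^ 3)
          + 3 / 2 * pi ^ 2 * ((trig_sum 1 x u - 0) * inverse u ^ 4)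
          + 3 / 4 * pi ^ 1 * ((trig_sum 0 x u - 1/2) * inverse u ^ 5)) has_field_derivative
          (1 * pi ^ 3 * (- 2 * pi * trig_sum (Suc 2) x y * inverse y ^ 3 - real 3 * (trig_sum 2 x y - 0) * inverse y ^ Suc 3)
          + 3 / 2 * pi ^ 2 * (- 2 * pi * trig_sum (Suc 1) x y * inverse y ^ 4 - real 4 * (trig_sum 1 x y - 0) * inverse y ^ Suc 4)
          + 3 / 4 * pi ^ 1 * (- 2 * pi * trig_sum (Suc 0) x y * inverse y ^ 5 - real 5 * (trig_sum 0 x y - 1/2) * inverse y ^ Suc 5))) (at y)"
    by (intro DERIV_add DERIV_cmult has_field_derivative_trig_sum_inverse_power assms)
  from row_sum_Suc[OF assms _ row_sum_3 this] show ?thesis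
    by (simp add: eval_nat_numeral algebra_simps add_divide_distrib)
qed

lemma row_sum_5:
  assumes "y > 0"
  shows "row_sum 5 x y =
            1 / 12 * pi ^ 5 * ((trig_sum 4 x y - 0) * inverse y ^ 5)
          + 5 / 12 * pi ^ 4 * ((trig_sum 3 x y - 0) * inverse y ^ 6)
          + 15 / 16 * pi ^ 3 * ((trig_sum 2 x y - 0) * inverse y ^ 7)
          + 35 / 32 * pi ^ 2 * ((trig_sum 1 x y - 0) * inverse y ^ 8)
          + 35 / 64 * pi ^ 1 * ((trig_sum 0 x y - 1/2) * inverse y ^ 9)"
proof -
  have "((\<lambda>u. 1 / 3 * pi ^ 4 * ((trig_sum 3 x u - 0) * inverse u ^ 4)
          + 1 * pi ^ 3 * ((trig_sum 2 x u - 0) * inverse u ^ 5)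
          + 5 / 4 * pi ^ 2 * ((trig_sum 1 x u - 0) * inverse u ^ 6)
          + 5 / 8 * pi ^ 1 * ((trig_sum 0 x u - 1/2) * inverse u ^ 7)) has_field_derivative
          (1 / 3 * pi ^ 4 * (- 2 * pi * trig_sum (Suc 3) x y * inverse y ^ 4 - real 4 * (trig_sum 3 x y - 0) * inverse y ^ Suc 4)
          + 1 * pi ^ 3 * (- 2 * pi * trig_sum (Suc 2) x y * inverse y ^ 5 - real 5 * (trig_sum 2 x y - 0) * inverse y ^ Suc 5)
          + 5 / 4 * pi ^ 2 * (- 2 * pi * trig_sum (Suc 1) x y * inverse y ^ 6 - real 6 * (trig_sum 1 x y - 0) * inverse y ^ Suc 6)
          + 5 / 8 * pi ^ 1 * (- 2 * pi * trig_sum (Suc 0) x y * inverse y ^ 7 - real 7 * (trig_sum 0 x y - 1/2) * inverse y ^ Suc 7))) (at y)"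
    by (intro DERIV_add DERIV_cmult has_field_derivative_trig_sum_inverse_power assms)
  from row_sum_Suc[OF assms _ row_sum_4 this] show ?thesis
    by (simp add: eval_nat_numeral algebra_simps add_divide_distrib)
qed

lemma row_sum_6:
  assumes "y > 0"
  shows "row_sum 6 x y =
            1 / 60 * pi ^ 6 * ((trig_sum 5 x y - 0) * inverse y ^ 6)
          + 1 / 8 * pi ^ 5 * ((trig_sum 4 x y - 0) * inverse y ^ 7)
          + 7 / 16 * pi ^ 4 * ((trig_sum 3 x y - 0) * inverse y ^ 8)
          + 7 / 8 * pi ^ 3 * ((trig_sum 2 x y - 0) * inverse y ^ 9)
          + 63 / 64 * pi ^ 2 * ((trig_sum 1 x y - 0) * inverse y ^ 10)
          + 63 / 128 * pi ^ 1 * ((trig_sum 0 x y - 1/2) * inverse y ^ 11)"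
proof -
  have "((\<lambda>u. 1 / 12 * pi ^ 5 * ((trig_sum 4 x u - 0) * inverse u ^ 5)
          + 5 / 12 * pi ^ 4 * ((trig_sum 3 x u - 0) * inverse u ^ 6)
          + 15 / 16 * pi ^ 3 * ((trig_sum 2 x u - 0) * inverse u ^ 7)
          + 35 / 32 * pi ^ 2 * ((trig_sum 1 x u - 0) * inverse u ^ 8)
          + 35 / 64 * pi ^ 1 * ((trig_sum 0 x u - 1/2) * inverse u ^ 9)) has_field_derivative
          (1 / 12 * pi ^ 5 * (- 2 * pi * trig_sum (Suc 4) x y * inverse y ^ 5 - real 5 * (trig_sum 4 x y - 0) * inverse y ^ Suc 5)
          + 5 / 12 * pi ^ 4 * (- 2 * pi * trig_sum (Suc 3) x y * inverse y ^ 6 - real 6 * (trig_sum 3 x y - 0) * inverse y ^ Suc 6)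
          + 15 / 16 * pi ^ 3 * (- 2 * pi * trig_sum (Suc 2) x y * inverse y ^ 7 - real 7 * (trig_sum 2 x y - 0) * inverse y ^ Suc 7)
          + 35 / 32 * pi ^ 2 * (- 2 * pi * trig_sum (Suc 1) x y * inverse y ^ 8 - real 8 * (trig_sum 1 x y - 0) * inverse y ^ Suc 8)
          + 35 / 64 * pi ^ 1 * (- 2 * pi * trig_sum (Suc 0) x y * inverse y ^ 9 - real 9 * (trig_sum 0 x y - 1/2) * inverse y ^ Suc 9))) (at y)"
    by (intro DERIV_add DERIV_cmult has_field_derivative_trig_sum_inverse_power assms)
  from row_sum_Suc[OF assms _ row_sum_5 this] show ?thesis
    by (simp add: eval_nat_numeral algebra_simps add_divide_distrib)
qed

section \<open>Bounds for the difference of two rows\<close>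

lemma abs_sin_nat_mult_le: "\<bar>sin (real k * t)\<bar> \<le> real k * \<bar>sin t\<bar>"
proof (induction k)
  case (Suc k)
  have "\<bar>sin (real (Suc k) * t)\<bar> = \<bar>sin (real k * t) * cos t + cos (real k * t) * sin t\<bar>"
    by (simp add: ring_distribs sin_add add_ac mult_ac)
  also have "\<dots> \<le> \<bar>sin (real k * t)\<bar> * \<bar>cos t\<bar> + \<bar>cos (real k * t)\<bar> * \<bar>sin t\<bar>"
    by (metis abs_mult abs_triangle_ineq)
  also have "\<dots> \<le> \<bar>sin (real k * t)\<bar> * 1 + 1 * \<bar>sin t\<bar>"
    by (intro add_mono mult_mono) auto
  finally show ?case using Suc by (simp add: ring_distribs)
qed simp

text \<open>Crude but valid for every k; it serves the tail of the cosine series.\<close>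

lemma one_minus_cos_nat_mult_le: "1 - cos (real k * t) \<le> (real k)\<^sup>2 * (1 - cos t)"
proof -
  have h: "1 - cos u = 2 * (sin (u/2))\<^sup>2" for u :: real
    using cos_double_sin[of "u/2"] by simp
  have "\<bar>sin (real k * (t/2))\<bar> ^ 2 \<le> (real k * \<bar>sin (t/2)\<bar>) ^ 2"
    by (intro power_mono abs_sin_nat_mult_le) auto
  thus ?thesis unfolding h by (simp add: power_mult_distrib)
qed

text \<open>For k = 2, 3 the bound k^2 r would lose the negative term in r^2, where r = 1 - cos t.
  That term makes the loss below height 1 a concave quadratic in r.\<close>

lemma one_minus_cos_twice: "1 - cos (2 * t) = (1 - cos t) * (4 - 2 * (1 - cos t))"
  for t :: real
  unfolding cos_double_cos by (simp add: power2_eq_square algebra_simps)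

lemma one_minus_cos_thrice: "1 - cos (3 * t) \<le> (1 - cos t) * (9 - 4 * (1 - cos t))"
  for t :: real
proof -
  define r where "r = 1 - cos t"
  have r: "0 \<le> r" "r \<le> 2" using cos_ge_minus_one[of t] by (auto simp: r_def)
  have "1 - cos (3 * t) = r * (9 - 12 * r + 4 * r\<^sup>2)"
    unfolding cos_treble_cos r_def by (simp add: power2_eq_square power3_eq_cube algebra_simps)
  \<comment> \<open>Only r \<le> 2 enters: 4 r^2 \<le> 8 r makes the second factor linear.\<close>
  also have "\<dots> \<le> r * (9 - 4 * r)"
  proof (intro mult_left_mono)
    have "r * r \<le> 2 * r" using r by (intro mult_right_mono) auto
    thus "9 - 12 * r + 4 * r\<^sup>2 \<le> 9 - 4 * r" by (simp add: power2_eq_square)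
  qed (use r in auto)
  finally show ?thesis by (simp add: r_def)
qed

text \<open>\<open>coeff3 (1 / y) k * exp (- 2 * pi * y) ^ k\<close> is the \<open>k\<close>-th cosine coefficient in \<open>x\<close> of
  \<open>y ^ 3 * row_sum 3 x y\<close>; likewise for \<open>coeff6\<close> and \<open>y ^ 6 * row_sum 6 x y\<close>.\<close>

definition coeff3 :: "real \<Rightarrow> real \<Rightarrow> real" where
  "coeff3 v k = pi ^ 3 * k ^ 2 + 3 / 2 * pi ^ 2 * k * v + 3 / 4 * pi * v ^ 2"

definition coeff6 :: "real \<Rightarrow> real \<Rightarrow> real" where
  "coeff6 v k = 1 / 60 * pi ^ 6 * k ^ 5 + 1 / 8 * pi ^ 5 * k ^ 4 * v + 7 / 16 * pi ^ 4 * k ^ 3 * v ^ 2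
     + 7 / 8 * pi ^ 3 * k ^ 2 * v ^ 3 + 63 / 64 * pi ^ 2 * k * v ^ 4 + 63 / 128 * pi * v ^ 5"

lemma trig_sum_diff_sums:
  assumes "y > 0"
  shows "(\<lambda>k. (1 - cos (2 * pi * real k * x)) * (real k ^ j * exp (- 2 * pi * y) ^ k))
           sums (trig_sum j 0 y - trig_sum j x y)"
proof -
  have "(\<lambda>k. cos (2 * pi * real k * u) * real k ^ j * exp (- 2 * pi * y) ^ k) sums trig_sum j u y" for u
    unfolding trig_sum_def by (rule summable_sums, rule summable_rabs_cancel, rule abs_summable_trig_sum[OF assms])
  from sums_diff[OF this[of 0] this[of x]] show ?thesis by (simp add: algebra_simps)
qed

lemma row_sum_3_diff_sums:
  assumes "y > 0"
  shows "(\<lambda>k. coeff3 (inverse y) k * exp (- 2 * pi * y) ^ k * (1 - cos (2 * pi * real k * x)))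
           sums (y ^ 3 * (row_sum 3 0 y - row_sum 3 x y))"
proof -
  note S = trig_sum_diff_sums[OF assms, of x]
  have "(\<lambda>k. pi ^ 3 * ((1 - cos (2 * pi * real k * x)) * (real k ^ 2 * exp (- 2 * pi * y) ^ k))
      + 3 / 2 * pi ^ 2 * inverse y * ((1 - cos (2 * pi * real k * x)) * (real k ^ 1 * exp (- 2 * pi * y) ^ k))
      + 3 / 4 * pi * inverse y ^ 2 * ((1 - cos (2 * pi * real k * x)) * (real k ^ 0 * exp (- 2 * pi * y) ^ k)))
    sums (pi ^ 3 * (trig_sum 2 0 y - trig_sum 2 x y) + 3 / 2 * pi ^ 2 * inverse y * (trig_sum 1 0 y - trig_sum 1 x y)
      + 3 / 4 * pi * inverse y ^ 2 * (trig_sum 0 0 y - trig_sum 0 x y))"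
    by (intro sums_add sums_mult S)
  moreover have "y ^ 3 * (row_sum 3 0 y - row_sum 3 x y) = pi ^ 3 * (trig_sum 2 0 y - trig_sum 2 x y) + 3 / 2 * pi ^ 2 * inverse y * (trig_sum 1 0 y - trig_sum 1 x y)
      + 3 / 4 * pi * inverse y ^ 2 * (trig_sum 0 0 y - trig_sum 0 x y)"
  proof -
    have "y * inverse y = 1" using assms by simp
    hence e: "y ^ 3 * inverse y ^ 3 = 1" "y ^ 3 * inverse y ^ 4 = inverse y" "y ^ 3 * inverse y ^ 5 = inverse y ^ 2"
      by algebra+
    show ?thesis
      unfolding row_sum_3[OF assms] using e by (algebra)
  qed
  moreover have "coeff3 v k * e * g = pi ^ 3 * (g * (k ^ 2 * e)) + 3 / 2 * pi ^ 2 * v * (g * (k ^ 1 * e))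
      + 3 / 4 * pi * v ^ 2 * (g * (k ^ 0 * e))" for v k e g
    unfolding coeff3_def power_0 power_one_right by algebra
  ultimately show ?thesis by (simp only:)
qed

lemma row_sum_6_diff_sums:
  assumes "y > 0"
  shows "(\<lambda>k. coeff6 (inverse y) k * exp (- 2 * pi * y) ^ k * (1 - cos (2 * pi * real k * x)))
           sums (y ^ 6 * (row_sum 6 0 y - row_sum 6 x y))"
proof -
  note S = trig_sum_diff_sums[OF assms, of x]
  define v where "v = inverse y"
  have "(\<lambda>k. 1 / 60 * pi ^ 6 * ((1 - cos (2 * pi * real k * x)) * (real k ^ 5 * exp (- 2 * pi * y) ^ k))
      + 1 / 8 * pi ^ 5 * v * ((1 - cos (2 * pi * real k * x)) * (real k ^ 4 * exp (- 2 * pi * y) ^ k))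
      + 7 / 16 * pi ^ 4 * v ^ 2 * ((1 - cos (2 * pi * real k * x)) * (real k ^ 3 * exp (- 2 * pi * y) ^ k))
      + 7 / 8 * pi ^ 3 * v ^ 3 * ((1 - cos (2 * pi * real k * x)) * (real k ^ 2 * exp (- 2 * pi * y) ^ k))
      + 63 / 64 * pi ^ 2 * v ^ 4 * ((1 - cos (2 * pi * real k * x)) * (real k ^ 1 * exp (- 2 * pi * y) ^ k))
      + 63 / 128 * pi * v ^ 5 * ((1 - cos (2 * pi * real k * x)) * (real k ^ 0 * exp (- 2 * pi * y) ^ k)))
    sums (1 / 60 * pi ^ 6 * (trig_sum 5 0 y - trig_sum 5 x y)
      + 1 / 8 * pi ^ 5 * v * (trig_sum 4 0 y - trig_sum 4 x y)
      + 7 / 16 * pi ^ 4 * v ^ 2 * (trig_sum 3 0 y - trig_sum 3 x y)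
      + 7 / 8 * pi ^ 3 * v ^ 3 * (trig_sum 2 0 y - trig_sum 2 x y)
      + 63 / 64 * pi ^ 2 * v ^ 4 * (trig_sum 1 0 y - trig_sum 1 x y)
      + 63 / 128 * pi * v ^ 5 * (trig_sum 0 0 y - trig_sum 0 x y))"
    by (intro sums_add sums_mult S)
  moreover have "y ^ 6 * (row_sum 6 0 y - row_sum 6 x y) = 1 / 60 * pi ^ 6 * (trig_sum 5 0 y - trig_sum 5 x y)
      + 1 / 8 * pi ^ 5 * v * (trig_sum 4 0 y - trig_sum 4 x y)
      + 7 / 16 * pi ^ 4 * v ^ 2 * (trig_sum 3 0 y - trig_sum 3 x y)
      + 7 / 8 * pi ^ 3 * v ^ 3 * (trig_sum 2 0 y - trig_sum 2 x y)
      + 63 / 64 * pi ^ 2 * v ^ 4 * (trig_sum 1 0 y - trig_sum 1 x y)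
      + 63 / 128 * pi * v ^ 5 * (trig_sum 0 0 y - trig_sum 0 x y)"
  proof -
    have "y * v = 1" using assms by (simp add: v_def)
    hence e: "y ^ 6 * v ^ 6 = 1" "y ^ 6 * v ^ 7 = v" "y ^ 6 * v ^ 8 = v ^ 2"
      "y ^ 6 * v ^ 9 = v ^ 3" "y ^ 6 * v ^ 10 = v ^ 4" "y ^ 6 * v ^ 11 = v ^ 5"
      by algebra+
    show ?thesis
      unfolding row_sum_6[OF assms] v_def[symmetric] using e by algebra
  qed
  moreover have "coeff6 v k * e * g = 1 / 60 * pi ^ 6 * (g * (k ^ 5 * e)) + 1 / 8 * pi ^ 5 * v * (g * (k ^ 4 * e))
      + 7 / 16 * pi ^ 4 * v ^ 2 * (g * (k ^ 3 * e)) + 7 / 8 * pi ^ 3 * v ^ 3 * (g * (k ^ 2 * e))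
      + 63 / 64 * pi ^ 2 * v ^ 4 * (g * (k ^ 1 * e)) + 63 / 128 * pi * v ^ 5 * (g * (k ^ 0 * e))" for k e g
    unfolding coeff6_def power_0 power_one_right by algebra
  ultimately show ?thesis by (simp only: v_def)
qed

lemma coeff3_nonneg: "0 \<le> v \<Longrightarrow> 0 \<le> k \<Longrightarrow> 0 \<le> coeff3 v k"
  by (simp add: coeff3_def)

lemma coeff6_nonneg: "0 \<le> v \<Longrightarrow> 0 \<le> k \<Longrightarrow> 0 \<le> coeff6 v k"
  by (simp add: coeff6_def)

text \<open>All terms of the series are nonnegative, so cutting it after k = 2 gives a lower bound.
  The frequency k = 2 is kept to offset part of the corresponding term for s = 6.\<close>

lemma row_sum_3_diff_ge:
  fixes x y :: real
  assumes "y > 0"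
  defines "E \<equiv> exp (- 2 * pi * y)" and "r \<equiv> 1 - cos (2 * pi * x)"
  shows "coeff3 (inverse y) 1 * E * r + coeff3 (inverse y) 2 * E ^ 2 * (r * (4 - 2 * r))
           \<le> y ^ 3 * (row_sum 3 0 y - row_sum 3 x y)"
proof -
  define d where "d k = coeff3 (inverse y) k * E ^ k * (1 - cos (2 * pi * real k * x))" for k :: nat
  have d: "d sums (y ^ 3 * (row_sum 3 0 y - row_sum 3 x y))"
    unfolding d_def E_def by (rule row_sum_3_diff_sums[OF assms(1)])
  have "sum d {0,1,2} \<le> (y ^ 3 * (row_sum 3 0 y - row_sum 3 x y))"
    by (rule sum_le_suminf[of d "{0,1,2}", folded sums_unique[OF d]])
       (use d assms(1) in \<open>auto simp: sums_iff d_def E_def intro!: mult_nonneg_nonneg coeff3_nonneg\<close>)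
  moreover have "sum d {0,1,2} = d 1 + d 2" by (simp add: d_def)
  moreover have "d 1 = coeff3 (inverse y) 1 * E * r" by (simp add: d_def r_def)
  moreover have "d 2 = coeff3 (inverse y) 2 * E ^ 2 * (r * (4 - 2 * r))"
    using one_minus_cos_twice[of "2 * pi * x"] by (simp add: d_def r_def mult_ac)
  ultimately show ?thesis by simp
qed

text \<open>The exponent 7 is the degree 5 of \<open>coeff6\<close> in k plus 2 from
  \<open>one_minus_cos_nat_mult_le\<close>. For k \<ge> 4 one step multiplies k^7 by at most (5/4)^7
  < 6, so the tail is dominated by a geometric series of ratio 6 E.\<close>

lemma power7_le: "k \<ge> 4 \<Longrightarrow> real k ^ 7 \<le> 4 ^ 7 * 6 ^ (k - 4)"
proof (induction k rule: dec_induct)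
  case (step k)
  have "real (Suc k) ^ 7 \<le> (5/4 * real k) ^ 7"
    using step by (intro power_mono) auto
  also have "\<dots> = (5/4) ^ 7 * real k ^ 7" by (rule power_mult_distrib)
  also have "\<dots> \<le> 6 * (4 ^ 7 * 6 ^ (k - 4))"
    using step by (intro mult_mono) (auto simp: power_divide)
  also have "\<dots> = 4 ^ 7 * 6 ^ (Suc k - 4)" using step(1) by (simp add: Suc_diff_le flip: power_Suc)
  finally show ?case .
qed simp

text \<open>A polynomial of degree 5 in k with nonnegative coefficients: for k/4 \<ge> 1 each lower
  power of k/4 is at most the fifth.\<close>

lemma coeff6_le:
  assumes "k \<ge> 4" "v \<ge> 0"
  shows "coeff6 v k \<le> (k / 4) ^ 5 * coeff6 v 4"
proof -
  define m where "m = k / 4"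
  have k: "k = 4 * m" and m: "m \<ge> 1" using assms by (auto simp: m_def)
  have p: "m ^ 4 \<le> m ^ 5" "m ^ 3 \<le> m ^ 5" "m ^ 2 \<le> m ^ 5" "m \<le> m ^ 5" "1 \<le> m ^ 5"
    using m power_increasing[of 1 5 m] by (auto intro: power_increasing)
  have "(4 * m) ^ 4 * c \<le> m ^ 5 * 4 ^ 4 * c" "(4 * m) ^ 3 * c \<le> m ^ 5 * 4 ^ 3 * c"
     "(4 * m) ^ 2 * c \<le> m ^ 5 * 4 ^ 2 * c" "(4 * m) * c \<le> m ^ 5 * 4 * c" "c \<le> m ^ 5 * c" if "c \<ge> 0" for c
    using p that mult_right_mono[OF p(5) that] by (auto simp: power_mult_distrib intro!: mult_right_mono)
  note q = this
  have "coeff6 v (4 * m) = 1 / 60 * pi ^ 6 * (4 * m) ^ 5 + (4 * m) ^ 4 * (1 / 8 * pi ^ 5 * v) + (4 * m) ^ 3 * (7 / 16 * pi ^ 4 * v ^ 2)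
     + (4 * m) ^ 2 * (7 / 8 * pi ^ 3 * v ^ 3) + (4 * m) * (63 / 64 * pi ^ 2 * v ^ 4) + 63 / 128 * pi * v ^ 5"
    by (simp add: coeff6_def mult_ac)
  also have "\<dots> \<le> 1 / 60 * pi ^ 6 * (4 * m) ^ 5 + m ^ 5 * 4 ^ 4 * (1 / 8 * pi ^ 5 * v) + m ^ 5 * 4 ^ 3 * (7 / 16 * pi ^ 4 * v ^ 2)
     + m ^ 5 * 4 ^ 2 * (7 / 8 * pi ^ 3 * v ^ 3) + m ^ 5 * 4 * (63 / 64 * pi ^ 2 * v ^ 4) + m ^ 5 * (63 / 128 * pi * v ^ 5)"
    using assms by (intro add_mono order.refl q) auto
  also have "\<dots> = m ^ 5 * coeff6 v 4"
    unfolding coeff6_def by algebra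
  finally show ?thesis by (simp only: k) simp
qed

text \<open>Frequencies up to 3 keep their dependence on r; the tail from k = 4 on is of order E^4
  and only needs a bound linear in r.\<close>

lemma row_sum_6_diff_le:
  fixes x y :: real
  assumes "y > 0"
  defines "E \<equiv> exp (- 2 * pi * y)" and "r \<equiv> 1 - cos (2 * pi * x)"
  assumes E: "E \<le> 1 / 200"
  shows "y ^ 6 * (row_sum 6 0 y - row_sum 6 x y)
     \<le> coeff6 (inverse y) 1 * E * r + coeff6 (inverse y) 2 * E ^ 2 * (r * (4 - 2 * r))
       + coeff6 (inverse y) 3 * E ^ 3 * (r * (9 - 4 * r)) + 17 * coeff6 (inverse y) 4 * E ^ 4 * r"
proof -
  define v where "v = inverse y"
  have v: "v \<ge> 0" using assms by (simp add: v_def)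
  define d where "d k = coeff6 v k * E ^ k * (1 - cos (2 * pi * real k * x))" for k :: nat
  have E0: "E > 0" by (simp add: E_def)
  have r: "r \<ge> 0" by (simp add: r_def)
  have d: "d sums (y ^ 6 * (row_sum 6 0 y - row_sum 6 x y))"
    unfolding d_def E_def v_def by (rule row_sum_6_diff_sums[OF assms(1)])
  have sd: "summable (\<lambda>n. d (n + 4))" using d by (simp add: sums_iff summable_ignore_initial_segment)
  \<comment> \<open>The factor 16 is 4^7 / 4^5, from \<open>power7_le\<close> and
    \<open>coeff6_le\<close>.\<close>
  have g: "(\<lambda>n. 16 * coeff6 v 4 * E ^ 4 * r * (6 * E) ^ n) sums (16 * coeff6 v 4 * E ^ 4 * r * (1 / (1 - 6 * E)))"
    using E E0 by (intro sums_mult geometric_sums) auto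
  have "d (n + 4) \<le> 16 * coeff6 v 4 * E ^ 4 * r * (6 * E) ^ n" for n
  proof -
    have c: "1 - cos (2 * pi * real (n + 4) * x) \<le> real (n + 4) ^ 2 * r"
      using one_minus_cos_nat_mult_le[of "n + 4" "2 * pi * x"] by (simp add: r_def mult_ac)
    have "d (n + 4) \<le> ((real (n + 4) / 4) ^ 5 * coeff6 v 4) * E ^ (n + 4) * (real (n + 4) ^ 2 * r)"
      unfolding d_def using v E0 r by (intro mult_mono coeff6_le c mult_nonneg_nonneg coeff6_nonneg) auto
    also have "\<dots> = real (n + 4) ^ 7 * (coeff6 v 4 * E ^ (n + 4) * r / 1024)"
      by (simp only: power_divide) (simp add: eval_nat_numeral field_simps)
    also have "\<dots> \<le> (4 ^ 7 * 6 ^ (n + 4 - 4)) * (coeff6 v 4 * E ^ (n + 4) * r / 1024)"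
      using v E0 r by (intro mult_right_mono power7_le) (auto intro!: mult_nonneg_nonneg coeff6_nonneg)
    also have "\<dots> = 16 * coeff6 v 4 * E ^ 4 * r * (6 * E) ^ n"
      by (simp add: power_add power_mult_distrib)
    finally show ?thesis .
  qed
  hence "(\<Sum>n. d (n + 4)) \<le> 16 * coeff6 v 4 * E ^ 4 * r * (1 / (1 - 6 * E))"
    using suminf_le[OF _ sd sums_summable[OF g]] sums_unique[OF g] by simp
  \<comment> \<open>E \<le> 1/200 gives 1 - 6 E \<ge> 97/100 > 16/17, which turns the factor 16 into
    17.\<close>
  also have "\<dots> \<le> 16 * coeff6 v 4 * E ^ 4 * r * (17 / 16)"
    using E E0 v r by (intro mult_left_mono mult_nonneg_nonneg coeff6_nonneg) (auto simp: field_simps)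
  finally have tail: "(\<Sum>n. d (n + 4)) \<le> 17 * coeff6 v 4 * E ^ 4 * r" by (simp add: mult_ac)
  have "y ^ 6 * (row_sum 6 0 y - row_sum 6 x y) = (\<Sum>n. d (n + 4)) + sum d {..<4}"
    using d suminf_split_initial_segment[of d 4] by (simp add: sums_iff)
  moreover have "sum d {..<4} = d 1 + d 2 + d 3" by (simp add: eval_nat_numeral d_def)
  moreover have "d 1 = coeff6 v 1 * E * r" by (simp add: d_def r_def)
  moreover have "d 2 = coeff6 v 2 * E ^ 2 * (r * (4 - 2 * r))"
    using one_minus_cos_twice[of "2 * pi * x"] by (simp add: d_def r_def mult_ac)
  moreover have "d 3 \<le> coeff6 v 3 * E ^ 3 * (r * (9 - 4 * r))"
    using one_minus_cos_thrice[of "2 * pi * x"] v E0 unfolding d_def r_def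
    by (intro mult_mono mult_nonneg_nonneg coeff6_nonneg) (auto simp: mult_ac)
  ultimately show ?thesis using tail unfolding v_def by linarith
qed

section \<open>Numerical comparison of the rows\<close>

lemma pi_power_bounds:
  "314159 / 100000 \<le> pi" "pi \<le> 31416 / 10000"
  "98696 / 10000 \<le> pi ^ 2" "pi ^ 2 \<le> 98697 / 10000"
  "310062 / 10000 \<le> pi ^ 3" "pi ^ 3 \<le> 310064 / 10000"
  "97409 / 1000 \<le> pi ^ 4" "pi ^ 4 \<le> 974092 / 10000"
  "306019 / 1000 \<le> pi ^ 5" "pi ^ 5 \<le> 306021 / 1000"
  "961388 / 1000 \<le> pi ^ 6" "pi ^ 6 \<le> 961391 / 1000"
proof -
  have l: "31415926 / 10000000 \<le> pi" and u: "pi \<le> 3141593 / 1000000"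
    using pi_approx by simp_all
  show "314159 / 100000 \<le> pi" "pi \<le> 31416 / 10000" using l u by simp_all
  have L: "(31415926 / 10000000) ^ k \<le> pi ^ k" for k using l by (intro power_mono) auto
  have U: "pi ^ k \<le> (3141593 / 1000000) ^ k" for k using u by (intro power_mono) auto
  show "98696 / 10000 \<le> pi ^ 2" "310062 / 10000 \<le> pi ^ 3" "97409 / 1000 \<le> pi ^ 4"
       "306019 / 1000 \<le> pi ^ 5" "961388 / 1000 \<le> pi ^ 6"
    using L[of 2] L[of 3] L[of 4] L[of 5] L[of 6] by (simp_all add: power_divide)
  show "pi ^ 2 \<le> 98697 / 10000" "pi ^ 3 \<le> 310064 / 10000" "pi ^ 4 \<le> 974092 / 10000"
       "pi ^ 5 \<le> 306021 / 1000" "pi ^ 6 \<le> 961391 / 1000"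
    using U[of 2] U[of 3] U[of 4] U[of 5] U[of 6] by (simp_all add: power_divide)
qed

lemma exp_minus_2pi_le: "exp (- 2 * pi) \<le> 1868 / 1000000"
proof -
  \<comment> \<open>157/100 lies just below pi/2: ten Taylor terms handle exp(157/100), the bound 1
    + u \<le> exp u handles the remaining 0.0008, and a fourth power leads to exp(2 pi).\<close>
  have "(\<Sum>n\<in>{..<10}. (157/100 :: real) ^ n /\<^sub>R fact n) \<le> exp (157/100)"
    unfolding exp_def by (intro sum_le_suminf summable_exp_generic) auto
  hence a: "480661 / 100000 \<le> exp (157/100 :: real)"
    by (simp add: eval_nat_numeral fact_numeral)
  have b: "1 + (pi / 2 - 157/100) \<le> exp (pi / 2 - 157/100)" by (rule exp_ge_add_one_self)
  have "exp (pi / 2) = exp (157/100) * exp (pi / 2 - 157/100)" by (simp flip: exp_add)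
  also have "\<dots> \<ge> (480661 / 100000) * (1 + 794/1000000)"
    using a b pi_approx by (intro mult_mono) auto
  finally have c: "48104 / 10000 \<le> exp (pi / 2)" by simp
  have "(48104 / 10000) ^ 4 \<le> exp (pi / 2) ^ 4" using c by (intro power_mono) auto
  also have "\<dots> = exp (2 * pi)" by (simp flip: exp_of_nat_mult)
  finally have "1000000 / 1868 \<le> exp (2 * pi)" by (simp add: power_divide)
  hence "inverse (exp (2 * pi)) \<le> inverse (1000000 / 1868)" by (intro le_imp_inverse_le) auto
  thus ?thesis by (simp add: exp_minus)
qed

lemma exp_minus_2pi_ge: "18 / 10000 \<le> exp (- 2 * pi)"
proof -
  have "exp (2 * pi - 6) \<le> 1 + (2 * pi - 6) + (2 * pi - 6)\<^sup>2"
    using pi_approx by (intro exp_bound) auto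
  also have "\<dots> \<le> 1 + 28320 / 100000 + (28320 / 100000)\<^sup>2"
    using pi_approx by (intro add_mono power_mono) auto
  finally have a: "exp (2 * pi - 6) \<le> 1365 / 1000" by (simp add: power2_eq_square)
  have "exp 1 ^ 6 \<le> (272 / 100 :: real) ^ 6" using e_less_272 by (intro power_mono) auto
  hence b: "exp 6 \<le> (406 :: real)" by (simp flip: exp_of_nat_mult add: power_divide)
  have "exp (2 * pi) = exp 6 * exp (2 * pi - 6)" by (simp flip: exp_add)
  also have "\<dots> \<le> 406 * (1365 / 1000)" using a b by (intro mult_mono) auto
  finally have "inverse (406 * (1365 / 1000)) \<le> inverse (exp (2 * pi))" by (intro le_imp_inverse_le) auto
  thus ?thesis by (simp add: exp_minus)
qed

text \<open>The bound 134/1000 exceeds 1 - sqrt 3 / 2. The Taylor terms of degree 4 and 5 are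
  absorbed into the cubic one by s \<le> 842/1000, so that the later products are polynomials of low
  degree in d.\<close>

lemma exp_minus_2pi_mult_le:
  fixes d :: real
  assumes "0 \<le> d" "d \<le> 134 / 1000"
  shows "exp (- 2 * pi * (1 - d)) \<le> 1868 / 1000000 * (1 + 62832 / 10000 * d + 1974 / 100 * d ^ 2 + 541 / 10 * d ^ 3)"
proof -
  define s where "s = 62832 / 10000 * d"
  have s: "0 \<le> s" "s \<le> 842 / 1000" using assms by (auto simp: s_def)
  obtain t where t: "\<bar>t\<bar> \<le> \<bar>s\<bar>" "exp s = (\<Sum>m<5. s ^ m / fact m) + exp t / fact 5 * s ^ 5"
    using Maclaurin_exp_le by blast
  have "exp t \<le> exp 1" using t s by simp
  also have "\<dots> \<le> 272 / 100" using e_less_272 by simp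
  finally have et: "exp t \<le> 272 / 100" .
  have "exp s \<le> (\<Sum>m<5. s ^ m / fact m) + (272 / 100) / fact 5 * s ^ 5"
    unfolding t(2) using et s by (intro add_left_mono mult_right_mono divide_right_mono) auto
  also have "\<dots> = 1 + s + s ^ 2 / 2 + s ^ 3 * (1 / 6 + s / 24 + 272 / 12000 * s ^ 2)"
    by (simp add: eval_nat_numeral field_simps)
  also have "\<dots> \<le> 1 + s + s ^ 2 / 2 + s ^ 3 * (1 / 6 + (842 / 1000) / 24 + 272 / 12000 * (842 / 1000) ^ 2)"
    using s by (intro add_mono mult_left_mono power_mono order.refl) auto
  also have "\<dots> \<le> 1 + s + s ^ 2 / 2 + s ^ 3 * (218 / 1000)"
    using s by (intro add_mono mult_left_mono order.refl) (auto simp: power2_eq_square)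
  also have "\<dots> \<le> 1 + 62832 / 10000 * d + 1974 / 100 * d ^ 2 + 541 / 10 * d ^ 3"
  proof -
    have "(62832 / 10000 * d) ^ 2 / 2 \<le> 1974 / 100 * d ^ 2" "(62832 / 10000 * d) ^ 3 * (218 / 1000) \<le> 541 / 10 * d ^ 3"
      using assms by (auto simp: power_mult_distrib power_divide)
    thus ?thesis by (simp add: s_def)
  qed
  finally have e: "exp s \<le> 1 + 62832 / 10000 * d + 1974 / 100 * d ^ 2 + 541 / 10 * d ^ 3" .
  have "2 * pi * d \<le> s" unfolding s_def using pi_approx assms by (intro mult_right_mono) auto
  hence e2: "exp (2 * pi * d) \<le> 1 + 62832 / 10000 * d + 1974 / 100 * d ^ 2 + 541 / 10 * d ^ 3"
    using e by (meson exp_le_cancel_iff order_trans)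
  have "exp (- 2 * pi * (1 - d)) = exp (- 2 * pi) * exp (2 * pi * d)"
    by (simp flip: exp_add add: algebra_simps)
  also have "\<dots> \<le> 1868 / 1000000 * (1 + 62832 / 10000 * d + 1974 / 100 * d ^ 2 + 541 / 10 * d ^ 3)"
    using exp_minus_2pi_le e2 by (intro mult_mono) auto
  finally show ?thesis .
qed

lemma exp_minus_2pi_mult_ge:
  fixes d :: real
  assumes "0 \<le> d"
  shows "18 / 10000 * (1 + 628 / 100 * d) \<le> exp (- 2 * pi * (1 - d))"
proof -
  have "1 + 628 / 100 * d \<le> 1 + 2 * pi * d"
    using pi_approx assms by (intro add_mono mult_right_mono) auto
  also have "\<dots> \<le> exp (2 * pi * d)" by (rule exp_ge_add_one_self)
  finally have "18 / 10000 * (1 + 628 / 100 * d) \<le> exp (- 2 * pi) * exp (2 * pi * d)"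
    using exp_minus_2pi_ge assms by (intro mult_mono) auto
  also have "\<dots> = exp (- 2 * pi * (1 - d))" by (simp flip: exp_add add: algebra_simps)
  finally show ?thesis .
qed

text \<open>The binomial series of (1 - d)^(-k) cut after d^2, with the exact remainder written as a
  polynomial in v = 1/(1 - d).\<close>

lemma inverse_power_expansions:
  fixes d v :: real
  assumes "v * (1 - d) = 1"
  shows "v = 1 + d + d ^ 2 + d ^ 3 * v"
    "v ^ 2 = 1 + 2 * d + 3 * d ^ 2 + d ^ 3 * (3 * v + v ^ 2)"
    "v ^ 3 = 1 + 3 * d + 6 * d ^ 2 + d ^ 3 * (6 * v + 3 * v ^ 2 + v ^ 3)"
    "v ^ 4 = 1 + 4 * d + 10 * d ^ 2 + d ^ 3 * (10 * v + 6 * v ^ 2 + 3 * v ^ 3 + v ^ 4)"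
    "v ^ 5 = 1 + 5 * d + 15 * d ^ 2 + d ^ 3 * (15 * v + 10 * v ^ 2 + 6 * v ^ 3 + 3 * v ^ 4 + v ^ 5)"
  using assms by algebra+

text \<open>The lower bounds drop the remainders of \<open>inverse_power_expansions\<close>. The
  cubic coefficients of the upper bounds are those remainders at v = 11548/10000, just above
  1/0.866, rounded up.\<close>

lemma inverse_power_bounds:
  fixes d v :: real
  assumes v: "v * (1 - d) = 1" and d: "0 \<le> d" "d \<le> 134 / 1000"
  shows "1 + d + d ^ 2 \<le> v"
    "1 + 2 * d + 3 * d ^ 2 \<le> v ^ 2" "v ^ 2 \<le> 1 + 2 * d + 3 * d ^ 2 + 48 / 10 * d ^ 3"
    "1 + 3 * d + 6 * d ^ 2 \<le> v ^ 3" "v ^ 3 \<le> 1 + 3 * d + 6 * d ^ 2 + 1248 / 100 * d ^ 3"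
    "1 + 4 * d + 10 * d ^ 2 \<le> v ^ 4" "v ^ 4 \<le> 1 + 4 * d + 10 * d ^ 2 + 2597 / 100 * d ^ 3"
    "1 + 5 * d + 15 * d ^ 2 \<le> v ^ 5" "v ^ 5 \<le> 1 + 5 * d + 15 * d ^ 2 + 4732 / 100 * d ^ 3"
    "v \<le> 1 + d + d ^ 2 + 1155 / 1000 * d ^ 3" "1 \<le> v"
proof -
  have e: "v = 1 / (1 - d)" using v d by (simp add: field_simps)
  have v1: "1 \<le> v" "v \<le> 11548 / 10000" using d by (auto simp: e field_simps)
  have vp: "v ^ k \<ge> 0" "v ^ k \<le> (11548 / 10000) ^ k" for k using v1 by (auto intro: power_mono)
  have c: "v ^ 2 \<le> 13336 / 10000" "v ^ 3 \<le> 15401 / 10000" "v ^ 4 \<le> 17785 / 10000" "v ^ 5 \<le> 20538 / 10000"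
    using vp(2)[of 2] vp(2)[of 3] vp(2)[of 4] vp(2)[of 5] by (auto simp: power_divide)
  note ex = inverse_power_expansions[OF v]
  have m: "d ^ 3 * a \<ge> 0" if "a \<ge> 0" for a using that d by simp
  have u: "d ^ 3 * a \<le> c * d ^ 3" if "a \<le> c" for a c
    using mult_left_mono[OF that, of "d ^ 3"] d by (simp add: mult.commute)
  show "1 \<le> v" by fact
  show "1 + d + d ^ 2 \<le> v" by (subst ex(1)) (use m v1 in auto)
  show "v \<le> 1 + d + d ^ 2 + 1155 / 1000 * d ^ 3" by (subst ex(1), intro add_left_mono u) (use v1 in auto)
  show "1 + 2 * d + 3 * d ^ 2 \<le> v ^ 2" by (subst ex(2)) (use m v1 vp in auto)
  show "v ^ 2 \<le> 1 + 2 * d + 3 * d ^ 2 + 48 / 10 * d ^ 3"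
    by (subst ex(2), intro add_left_mono u) (use v1 c in auto)
  show "1 + 3 * d + 6 * d ^ 2 \<le> v ^ 3" by (subst ex(3)) (use m v1 vp in auto)
  show "v ^ 3 \<le> 1 + 3 * d + 6 * d ^ 2 + 1248 / 100 * d ^ 3"
    by (subst ex(3), intro add_left_mono u) (use v1 c in auto)
  show "1 + 4 * d + 10 * d ^ 2 \<le> v ^ 4" by (subst ex(4)) (use m v1 vp in auto)
  show "v ^ 4 \<le> 1 + 4 * d + 10 * d ^ 2 + 2597 / 100 * d ^ 3"
    by (subst ex(4), intro add_left_mono u) (use v1 c in auto)
  show "1 + 5 * d + 15 * d ^ 2 \<le> v ^ 5" by (subst ex(5)) (use m v1 vp in auto)
  show "v ^ 5 \<le> 1 + 5 * d + 15 * d ^ 2 + 4732 / 100 * d ^ 3"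
    by (subst ex(5), intro add_left_mono u) (use v1 c in auto)
qed


text \<open>This sign makes the r^2 part of the comparison above height 1 nonpositive, so that it
  can be discarded.\<close>

lemma coeff6_2_ge_coeff3_2: "coeff6 v 2 - 3 * coeff3 v 2 \<ge> 0" if "v \<ge> 0"
proof -
  have "coeff6 v 2 - 3 * coeff3 v 2 = (32 / 60 * pi ^ 6 - 12 * pi ^ 3) + (2 * pi ^ 5 - 9 * pi ^ 2) * v
     + (7 / 2 * pi ^ 4 - 9 / 4 * pi) * v ^ 2 + 7 / 2 * pi ^ 3 * v ^ 3 + 63 / 32 * pi ^ 2 * v ^ 4 + 63 / 128 * pi * v ^ 5"
    by (simp add: coeff6_def coeff3_def algebra_simps)
  also have "\<dots> \<ge> 0"
    using pi_power_bounds that by (intro add_nonneg_nonneg mult_nonneg_nonneg) auto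
  finally show ?thesis .
qed

text \<open>After taking out r E the frequency k = 1 contributes at most -9.1, and everything else
  less than 8.73, since each further frequency carries another factor E \<le> exp(-2 pi).\<close>

lemma row_sum_diff_compare_ge_1:
  fixes x y :: real
  assumes "y \<ge> 1"
  shows "y ^ 6 * (row_sum 6 0 y - row_sum 6 x y) \<le> 3 * (y ^ 3 * (row_sum 3 0 y - row_sum 3 x y))"
proof -
  define v where "v = inverse y"
  define E where "E = exp (- 2 * pi * y)"
  define r where "r = 1 - cos (2 * pi * x)"
  have v: "0 \<le> v" "v \<le> 1" using assms by (auto simp: v_def field_simps)
  have r: "0 \<le> r" by (simp add: r_def)
  have "E \<le> exp (- 2 * pi)" unfolding E_def using assms by simp
  hence E: "0 < E" "E \<le> 1868 / 1000000"
    using order_trans[OF _ exp_minus_2pi_le] by (auto simp: E_def)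
  note P = pi_power_bounds
  have vp: "v ^ k \<le> v" if "k \<ge> 1" for k
    using power_decreasing[OF that v] by simp
  have vk: "v ^ k \<le> 1" for k using v by (simp add: power_le_one)
  have main: "coeff6 v 1 - 3 * coeff3 v 1 \<le> - 91 / 10"
  proof -
    have "coeff6 v 1 - 3 * coeff3 v 1 = (1 / 60 * pi ^ 6 - 3 * pi ^ 3) + (1 / 8 * pi ^ 5 - 9 / 2 * pi ^ 2) * v
     + (7 / 16 * pi ^ 4 - 9 / 4 * pi) * v ^ 2 + 7 / 8 * pi ^ 3 * v ^ 3 + 63 / 64 * pi ^ 2 * v ^ 4 + 63 / 128 * pi * v ^ 5"
      by (simp add: coeff6_def coeff3_def algebra_simps)
    \<comment> \<open>The coefficient of v alone is negative, so higher powers are first reduced to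
      v and not to 1. The total slope is then positive, and v = 1, that is y = 1, is the extreme
      case.\<close>
    also have "\<dots> \<le> (1 / 60 * pi ^ 6 - 3 * pi ^ 3) + (1 / 8 * pi ^ 5 - 9 / 2 * pi ^ 2) * v
     + (7 / 16 * pi ^ 4 - 9 / 4 * pi) * v + 7 / 8 * pi ^ 3 * v + 63 / 64 * pi ^ 2 * v + 63 / 128 * pi * v"
      using P by (intro add_mono mult_left_mono vp order.refl) auto
    also have "\<dots> = (1 / 60 * pi ^ 6 - 3 * pi ^ 3) + ((1 / 8 * pi ^ 5 - 9 / 2 * pi ^ 2)
     + (7 / 16 * pi ^ 4 - 9 / 4 * pi) + 7 / 8 * pi ^ 3 + 63 / 64 * pi ^ 2 + 63 / 128 * pi) * v"
      by (simp add: algebra_simps)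
    also have "\<dots> \<le> (1 / 60 * pi ^ 6 - 3 * pi ^ 3) + ((1 / 8 * pi ^ 5 - 9 / 2 * pi ^ 2)
     + (7 / 16 * pi ^ 4 - 9 / 4 * pi) + 7 / 8 * pi ^ 3 + 63 / 64 * pi ^ 2 + 63 / 128 * pi) * 1"
      using P v by (intro add_mono mult_left_mono order.refl) auto
    also have "\<dots> \<le> - 91 / 10" using P by simp
    finally show ?thesis .
  qed
  have c2: "coeff6 v 2 - 3 * coeff3 v 2 \<le> 1129"
  proof -
    have "coeff6 v 2 - 3 * coeff3 v 2 = (32 / 60 * pi ^ 6 - 12 * pi ^ 3) + (2 * pi ^ 5 - 9 * pi ^ 2) * v
     + (7 / 2 * pi ^ 4 - 9 / 4 * pi) * v ^ 2 + 7 / 2 * pi ^ 3 * v ^ 3 + 63 / 32 * pi ^ 2 * v ^ 4 + 63 / 128 * pi * v ^ 5"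
      by (simp add: coeff6_def coeff3_def algebra_simps)
    also have "\<dots> \<le> (32 / 60 * pi ^ 6 - 12 * pi ^ 3) + (2 * pi ^ 5 - 9 * pi ^ 2) * 1
     + (7 / 2 * pi ^ 4 - 9 / 4 * pi) * 1 + 7 / 2 * pi ^ 3 * 1 + 63 / 32 * pi ^ 2 * 1 + 63 / 128 * pi * 1"
      using P v by (intro add_mono mult_left_mono vk order.refl) auto
    also have "\<dots> \<le> 1129" using P by simp
    finally show ?thesis .
  qed
  have c34: "coeff6 v 3 \<le> 8420" "coeff6 v 4 \<le> 30000"
  proof -
    have "coeff6 v k \<le> 1 / 60 * pi ^ 6 * k ^ 5 + 1 / 8 * pi ^ 5 * k ^ 4 * 1 + 7 / 16 * pi ^ 4 * k ^ 3 * 1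
     + 7 / 8 * pi ^ 3 * k ^ 2 * 1 + 63 / 64 * pi ^ 2 * k * 1 + 63 / 128 * pi * 1" if "k \<ge> 0" for k
      unfolding coeff6_def using v that by (intro add_mono mult_left_mono vk order.refl) auto
    from this[of 3] this[of 4] show "coeff6 v 3 \<le> 8420" "coeff6 v 4 \<le> 30000" using P by simp_all
  qed
  have e: "E ^ 2 \<le> (1868 / 1000000) ^ 2" "E ^ 3 \<le> (1868 / 1000000) ^ 3" using E by (auto intro!: power_mono)
  have t1: "4 * E * (coeff6 v 2 - 3 * coeff3 v 2) \<le> 4 * (1868 / 1000000) * 1129"
    using E c2 coeff6_2_ge_coeff3_2[OF v(1)] by (intro mult_mono) auto
  have t2: "9 * E ^ 2 * coeff6 v 3 \<le> 9 * (1868 / 1000000) ^ 2 * 8420"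
    using E c34 e v by (intro mult_mono coeff6_nonneg) auto
  have t3: "17 * E ^ 3 * coeff6 v 4 \<le> 17 * (1868 / 1000000) ^ 3 * 30000"
    using E c34 e v by (intro mult_mono coeff6_nonneg) auto
  have neg: "coeff6 v 1 - 3 * coeff3 v 1 + 4 * E * (coeff6 v 2 - 3 * coeff3 v 2)
       + 9 * E ^ 2 * coeff6 v 3 + 17 * E ^ 3 * coeff6 v 4 \<le> 0"
  proof -
    \<comment> \<open>8.44 + 0.27 + 0.01 stays below 9.1.\<close>
    have "4 * (1868 / 1000000) * 1129 \<le> (844 / 100 :: real)" "9 * (1868 / 1000000) ^ 2 * 8420 \<le> (27 / 100 :: real)"
      "17 * (1868 / 1000000) ^ 3 * 30000 \<le> (1 / 100 :: real)" by (simp_all add: power_divide)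
    thus ?thesis using main t1 t2 t3 by linarith
  qed
  have "y ^ 6 * (row_sum 6 0 y - row_sum 6 x y) - 3 * (y ^ 3 * (row_sum 3 0 y - row_sum 3 x y))
     \<le> (coeff6 v 1 * E * r + coeff6 v 2 * E ^ 2 * (r * (4 - 2 * r))
       + coeff6 v 3 * E ^ 3 * (r * (9 - 4 * r)) + 17 * coeff6 v 4 * E ^ 4 * r)
       - 3 * (coeff3 v 1 * E * r + coeff3 v 2 * E ^ 2 * (r * (4 - 2 * r)))"
    using row_sum_6_diff_le[of y x] row_sum_3_diff_ge[of y x] assms E
    unfolding v_def E_def r_def by simp
  also have "\<dots> = r * E * (coeff6 v 1 - 3 * coeff3 v 1 + 4 * E * (coeff6 v 2 - 3 * coeff3 v 2)
       + 9 * E ^ 2 * coeff6 v 3 + 17 * E ^ 3 * coeff6 v 4)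
       - r ^ 2 * (2 * E ^ 2 * (coeff6 v 2 - 3 * coeff3 v 2) + 4 * E ^ 3 * coeff6 v 3)"
    by algebra
  also have "\<dots> \<le> 0 - 0"
    using r E v neg coeff6_2_ge_coeff3_2[OF v(1)] coeff6_nonneg[OF v(1), of 3]
    by (intro diff_mono mult_nonneg_nonpos mult_nonneg_nonneg add_nonneg_nonneg) auto
  finally show ?thesis by simp
qed

text \<open>The right-hand side will bound W_b(i y) - W_b(i) from below at b = 3.062: 85/1000
  dominates \<open>lattice_sum 6 0 1 - 4\<close>, and 418/100 = 468/100 - 1/2 dominates
  \<open>lattice_sum 3 0 1 - 1 / 2\<close>. The polynomial on the left will bound the loss of the
  horizontal move.\<close>

lemma axis_gain_lower_bound:
  fixes y :: real
  assumes y: "866 / 1000 \<le> y" "y \<le> 1"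
  defines "d \<equiv> 1 - y" and "p \<equiv> y ^ 3 + inverse y ^ 3" and "q \<equiv> inverse ((y + inverse y) / 2)"
  shows "d ^ 2 * (1639 / 100 + 1639 / 100 * d + 187 * d ^ 2 + 357 * d ^ 3 + 700 * d ^ 4)
     \<le> 2 * (p ^ 2 - 4) - (1 - q ^ 6) * (85 / 1000) - 3062 / 1000 * ((p / 2 - 1) * (418 / 100) - 1 / 2 * (1 - q ^ 3))"
proof -
  define v where "v = inverse y"
  have d: "0 \<le> d" "d \<le> 134 / 1000" using y by (auto simp: d_def)
  have yd: "y = 1 - d" by (simp add: d_def)
  have vy: "v * (1 - d) = 1" using y by (simp add: v_def d_def)
  note V = inverse_power_bounds[OF vy d]
  define g where "g = (3 - 3 * d + d ^ 2) ^ 2 * v ^ 3"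
  have pv: "p = (1 - d) ^ 3 + v ^ 3" by (simp add: p_def v_def yd)
  \<comment> \<open>p - 2 = (1 - y^3)^2 / y^3 and 1 - y^3 = d (3 - 3 d + d^2): the double zero at y
    = 1.\<close>
  have pg: "p - 2 = d ^ 2 * g"
    unfolding g_def pv using vy by algebra
  have g: "9 + 9 * d + 15 * d ^ 2 + 21 * d ^ 3 \<le> g"
  proof -
    have "g - (9 + 9 * d + 15 * d ^ 2 + 21 * d ^ 3) = v ^ 3 * (d ^ 4 * (28 - 48 * d + 21 * d ^ 2))"
      unfolding g_def using vy by algebra
    also have "\<dots> \<ge> 0" using V(11) d by (intro mult_nonneg_nonneg) auto
    finally show ?thesis by simp
  qed
  have gg: "81 + 162 * d + 351 * d ^ 2 \<le> g ^ 2"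
  proof -
    have "81 + 162 * d + 351 * d ^ 2 \<le> (9 + 9 * d + 15 * d ^ 2) ^ 2"
    proof -
      have "(9 + 9 * d + 15 * d ^ 2) ^ 2 = 81 + 162 * d + 351 * d ^ 2 + (270 * d ^ 3 + 225 * d ^ 4)"
        by algebra
      thus ?thesis using d by simp
    qed
    also have "\<dots> \<le> g ^ 2"
    proof (intro power_mono)
      show "9 + 9 * d + 15 * d\<^sup>2 \<le> g" using g d by (smt (verit) zero_le_power)
    qed (use d in auto)
    finally show ?thesis .
  qed
  \<comment> \<open>x = (y - 1)^2 / (2 y) is the excess of the mean of y and 1/y over 1, so q = 1/(1
    + x).\<close>
  define x where "x = d ^ 2 * v / 2"
  have d2: "d ^ 2 \<le> 18 / 1000" using power_mono[OF d(2) d(1), of 2] by (simp add: power_divide)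
  have v2: "v \<le> 12 / 10" using y by (simp add: v_def field_simps)
  have "d ^ 2 * v \<le> 18 / 1000 * (12 / 10)" using d2 v2 V(11) by (intro mult_mono) auto
  hence x: "0 \<le> x" "x \<le> 11 / 1000"
    using V(11) unfolding x_def by (simp, linarith)
  have "(1 - d + v) / 2 = 1 + x" unfolding x_def using vy by algebra
  hence C: "(y + inverse y) / 2 = 1 + x" by (simp add: v_def d_def)
  hence qx: "q * (1 + x) = 1" using x by (simp add: q_def)
  have q0: "0 \<le> q" "q \<le> 1" using x unfolding q_def C by (auto intro: inverse_le_1_iff[THEN iffD2])
  have "1 - 3 * x + 6 * x ^ 2 - q ^ 3 = q ^ 3 * (10 * x ^ 3 + 15 * x ^ 4 + 6 * x ^ 5)"
    using qx by algebra
  also have "\<dots> \<ge> 0" using q0 x by (intro mult_nonneg_nonneg) auto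
  finally have q3: "3 * x - 6 * x ^ 2 \<le> 1 - q ^ 3" by simp
  have "x * x \<le> 11 / 1000 * x" using x by (intro mult_right_mono) auto
  hence q3': "293 / 100 * x \<le> 1 - q ^ 3" using q3 x by (simp add: power2_eq_square)
  \<comment> \<open>1361/1000 = 3.062/2 - 2 * 0.085, from 1 - q^6 = (1 - q^3)(1 + q^3) and q \<le>
    1.\<close>
  have "398 / 100 * x \<le> (1 - q ^ 3) * (1361 / 1000)"
  proof -
    have "1361 / 1000 * (293 / 100 * x) \<le> 1361 / 1000 * (1 - q ^ 3)" by (rule mult_left_mono[OF q3']) simp
    moreover have "398 / 100 * x \<le> 1361 / 1000 * (293 / 100 * x)" using x(1) by simp
    ultimately show ?thesis by (simp only: mult.commute)
  qed
  also have "\<dots> \<le> (1 - q ^ 3) * (1531 / 1000 - 85 / 1000 * (1 + q ^ 3))"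
    using q0 power_le_one[of q 3] by (intro mult_left_mono) auto
  also have "\<dots> = - (1 - q ^ 6) * (85 / 1000) + 3062 / 1000 * (1 / 2 * (1 - q ^ 3))"
    by algebra
  finally have Q: "398 / 100 * x \<le> - (1 - q ^ 6) * (85 / 1000) + 3062 / 1000 * (1 / 2 * (1 - q ^ 3))" .
  have X: "199 / 100 * (d ^ 2 * (1 + d + d ^ 2)) \<le> 398 / 100 * x"
    using mult_left_mono[OF V(1), of "d ^ 2"] by (simp add: x_def)
  \<comment> \<open>160042/100000 = 8 - 3.062 * 2.09; its positivity makes the quadratic gain in d
    positive.\<close>
  have "2 * (p ^ 2 - 4) - 3062 / 1000 * ((p / 2 - 1) * (418 / 100))
       = (p - 2) * (160042 / 100000 + 2 * (p - 2))"
    by algebra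
  also have "\<dots> = d ^ 2 * (160042 / 100000 * g + 2 * d ^ 2 * g ^ 2)"
    unfolding pg by algebra
  also have "\<dots> \<ge> d ^ 2 * (160042 / 100000 * (9 + 9 * d + 15 * d ^ 2 + 21 * d ^ 3) + 2 * d ^ 2 * (81 + 162 * d + 351 * d ^ 2))"
    using g gg d by (intro mult_left_mono add_mono) auto
  finally have A: "d ^ 2 * (160042 / 100000 * (9 + 9 * d + 15 * d ^ 2 + 21 * d ^ 3) + 2 * d ^ 2 * (81 + 162 * d + 351 * d ^ 2))
     \<le> 2 * (p ^ 2 - 4) - 3062 / 1000 * ((p / 2 - 1) * (418 / 100))" .
  \<comment> \<open>The stated coefficients are those of the exact expansion, rounded down.\<close>
  have "d ^ 2 * (1639 / 100 + 1639 / 100 * d + 187 * d ^ 2 + 357 * d ^ 3 + 700 * d ^ 4)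
     \<le> d ^ 2 * ((160042 / 100000 * (9 + 9 * d + 15 * d ^ 2 + 21 * d ^ 3) + 2 * d ^ 2 * (81 + 162 * d + 351 * d ^ 2))
            + 199 / 100 * (1 + d + d ^ 2))"
  proof (rule mult_left_mono)
    have e: "160042 / 100000 * (9 + 9 * d + 15 * d ^ 2 + 21 * d ^ 3) + 2 * d ^ 2 * (81 + 162 * d + 351 * d ^ 2)
            + 199 / 100 * (1 + d + d ^ 2)
       = (160042 / 100000 * 9 + 199 / 100) * (1 + d) + (160042 / 100000 * 15 + 162 + 199 / 100) * d ^ 2
         + (160042 / 100000 * 21 + 324) * d ^ 3 + 702 * d ^ 4"
      by algebra
    have "d ^ k \<ge> 0" for k using d by simp
    note dk = this[of 2] this[of 3] this[of 4]
    show "1639 / 100 + 1639 / 100 * d + 187 * d ^ 2 + 357 * d ^ 3 + 700 * d ^ 4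
      \<le> 160042 / 100000 * (9 + 9 * d + 15 * d ^ 2 + 21 * d ^ 3) + 2 * d ^ 2 * (81 + 162 * d + 351 * d ^ 2)
            + 199 / 100 * (1 + d + d ^ 2)"
      unfolding e using d by (simp add: ring_distribs, use dk in linarith)
  qed simp
  also have "\<dots> = d ^ 2 * (160042 / 100000 * (9 + 9 * d + 15 * d ^ 2 + 21 * d ^ 3) + 2 * d ^ 2 * (81 + 162 * d + 351 * d ^ 2))
            + 199 / 100 * (d ^ 2 * (1 + d + d ^ 2))"
    by algebra
  also have "\<dots> \<le> (2 * (p ^ 2 - 4) - 3062 / 1000 * ((p / 2 - 1) * (418 / 100)))
      + (- (1 - q ^ 6) * (85 / 1000) + 3062 / 1000 * (1 / 2 * (1 - q ^ 3)))"
    by (rule add_mono[OF A order_trans[OF X Q]])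
  also have "\<dots> = 2 * (p ^ 2 - 4) - (1 - q ^ 6) * (85 / 1000)
      - 3062 / 1000 * ((p / 2 - 1) * (418 / 100) - 1 / 2 * (1 - q ^ 3))"
    by algebra
  finally show ?thesis .
qed

text \<open>The factor 2 anticipates the two rows m = 1 and m = -1. In \<rho> = r E the bound is 2
  \<rho> X - 2 \<rho>^2 H with H > 0; for X > 0 its maximum is X^2 / (2 H), which has to stay below
  d^2 f.\<close>

lemma row_sum_diff_compare_le_1:
  fixes x y :: real
  assumes y: "866 / 1000 \<le> y" "y \<le> 1"
  defines "d \<equiv> 1 - y"
  shows "2 * (y ^ 6 * (row_sum 6 0 y - row_sum 6 x y)) - 2 * (3062 / 1000) * (y ^ 3 * (row_sum 3 0 y - row_sum 3 x y))
     \<le> d ^ 2 * (1639 / 100 + 1639 / 100 * d + 187 * d ^ 2 + 357 * d ^ 3 + 700 * d ^ 4)"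
proof -
  define b :: real where "b = 3062 / 1000"
  define v where "v = inverse y"
  define E where "E = exp (- 2 * pi * y)"
  define r where "r = 1 - cos (2 * pi * x)"
  have d: "0 \<le> d" "d \<le> 134 / 1000" using y by (auto simp: d_def)
  have yd: "y = 1 - d" by (simp add: d_def)
  have vy: "v * (1 - d) = 1" using y by (simp add: v_def d_def)
  note V = inverse_power_bounds[OF vy d]
  note P = pi_power_bounds
  have v0: "0 \<le> v" using V(11) by simp
  have dk: "0 \<le> d ^ k" for k using d by simp
  have dm: "d ^ Suc k \<le> 134 / 1000 * d ^ k" for k using d mult_right_mono[OF d(2) dk[of k]] by simp
  have d2: "d ^ 2 \<le> (134 / 1000) ^ 2" and d3: "d ^ 3 \<le> (134 / 1000) ^ 3"
    using d by (auto intro!: power_mono)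
  have r: "0 \<le> r" by (simp add: r_def)
  have E0: "0 < E" by (simp add: E_def)
  have Eu: "E \<le> 1868 / 1000000 * (1 + 62832 / 10000 * d + 1974 / 100 * d ^ 2 + 541 / 10 * d ^ 3)"
    unfolding E_def yd by (rule exp_minus_2pi_mult_le[OF d])
  also have "\<dots> \<le> 435 / 100000" using d d2 d3 by (simp add: power_divide)
  finally have Em: "E \<le> 435 / 100000" .
  have El: "18 / 10000 * (1 + 628 / 100 * d) \<le> E"
    unfolding E_def yd by (rule exp_minus_2pi_mult_ge[OF d(1)])

  \<comment> \<open>X collects what is linear in r and H what is quadratic, after the factors E and
    E^2 are taken out.\<close>
  define X where "X = coeff6 v 1 - b * coeff3 v 1 + 4 * E * (coeff6 v 2 - b * coeff3 v 2)
      + 9 * E ^ 2 * coeff6 v 3 + 17 * E ^ 3 * coeff6 v 4"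
  define H where "H = 2 * (coeff6 v 2 - b * coeff3 v 2) + 4 * E * coeff6 v 3"

  have c2: "coeff6 v 2 - b * coeff3 v 2 = (32 / 60 * pi ^ 6 - b * 4 * pi ^ 3) + (2 * pi ^ 5 - b * 3 * pi ^ 2) * v
     + (7 / 2 * pi ^ 4 - b * (3 / 4) * pi) * v ^ 2 + 7 / 2 * pi ^ 3 * v ^ 3 + 63 / 32 * pi ^ 2 * v ^ 4 + 63 / 128 * pi * v ^ 5"
    by (simp add: coeff6_def coeff3_def algebra_simps)

  \<comment> \<open>The bounds for pi give a polynomial in v, and
    \<open>inverse_power_bounds\<close> then a cubic in d. The one negative coefficient, that of v,
    uses the lower bound for v.\<close>
  have p1: "coeff6 v 1 - b * coeff3 v 1 \<le> - 12199 / 1000 + 191718 / 1000 * d + 38228 / 100 * d ^ 2 + 83406 / 100 * d ^ 3"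
  proof -
    have "coeff6 v 1 - b * coeff3 v 1 = (1 / 60 * pi ^ 6 - b * pi ^ 3) + (1 / 8 * pi ^ 5 - b * (3 / 2) * pi ^ 2) * v
     + (7 / 16 * pi ^ 4 - b * (3 / 4) * pi) * v ^ 2 + 7 / 8 * pi ^ 3 * v ^ 3 + 63 / 64 * pi ^ 2 * v ^ 4 + 63 / 128 * pi * v ^ 5"
      by (simp add: coeff6_def coeff3_def algebra_simps)
    also have "\<dots> \<le> - 78917 / 1000 + (- 7078 / 1000) * v + 35402 / 1000 * v ^ 2 + 27131 / 1000 * v ^ 3
        + 9716 / 1000 * v ^ 4 + 1547 / 1000 * v ^ 5"
      using P v0 by (intro add_mono mult_right_mono) (auto simp: b_def)
    also have "\<dots> \<le> - 12199 / 1000 + 191718 / 1000 * d + 38228 / 100 * d ^ 2 + 83406 / 100 * d ^ 3"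
      using V dk[of 3] dk[of 2] d(1) by linarith
    finally show ?thesis .
  qed
  \<comment> \<open>In the higher powers of E all factors but one are replaced by the maximum
    435/100000, so that E B is a product of just two cubics in d.\<close>
  define B where "B = 4 * (coeff6 v 2 - b * coeff3 v 2) + 9 * (435 / 100000) * coeff6 v 3 + 17 * (435 / 100000) ^ 2 * coeff6 v 4"
  have c2pos: "0 \<le> coeff6 v 2 - b * coeff3 v 2"
    unfolding c2 using P v0 by (intro add_nonneg_nonneg mult_nonneg_nonneg) (auto simp: b_def)
  have Bu: "B \<le> 481 * 10 + 66498 / 10 * d + 98978 / 10 * d ^ 2 + 170632 / 10 * d ^ 3"
  proof -
    have "B = (4 * (32 / 60 * pi ^ 6 - b * 4 * pi ^ 3) + 9 * (435 / 100000) * (243 / 60 * pi ^ 6) + 17 * (435 / 100000) ^ 2 * (1024 / 60 * pi ^ 6))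
      + (4 * (2 * pi ^ 5 - b * 3 * pi ^ 2) + 9 * (435 / 100000) * (81 / 8 * pi ^ 5) + 17 * (435 / 100000) ^ 2 * (32 * pi ^ 5)) * v
      + (4 * (7 / 2 * pi ^ 4 - b * (3 / 4) * pi) + 9 * (435 / 100000) * (189 / 16 * pi ^ 4) + 17 * (435 / 100000) ^ 2 * (28 * pi ^ 4)) * v ^ 2
      + (14 * pi ^ 3 + 9 * (435 / 100000) * (63 / 8 * pi ^ 3) + 17 * (435 / 100000) ^ 2 * (14 * pi ^ 3)) * v ^ 3
      + (63 / 8 * pi ^ 2 + 9 * (435 / 100000) * (189 / 64 * pi ^ 2) + 17 * (435 / 100000) ^ 2 * (63 / 16 * pi ^ 2)) * v ^ 4
      + (63 / 32 * pi + 9 * (435 / 100000) * (63 / 128 * pi) + 17 * (435 / 100000) ^ 2 * (63 / 128 * pi)) * v ^ 5"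
      unfolding B_def coeff6_def coeff3_def by algebra
    also have "\<dots> \<le> 68963 / 100 + 220998 / 100 * v + 13808 / 10 * v ^ 2 + 44379 / 100 * v ^ 3 + 7888 / 100 * v ^ 4 + 625 / 100 * v ^ 5"
      using P v0 by (intro add_mono mult_right_mono) (auto simp: b_def power_divide)
    also have "\<dots> \<le> 481 * 10 + 66498 / 10 * d + 98978 / 10 * d ^ 2 + 170632 / 10 * d ^ 3"
      using V dk[of 3] dk[of 2] d(1) by linarith
    finally show ?thesis .
  qed
  have B0: "0 \<le> B"
    unfolding B_def using c2pos v0 by (intro add_nonneg_nonneg mult_nonneg_nonneg coeff6_nonneg) auto
  have XB: "X \<le> (coeff6 v 1 - b * coeff3 v 1) + E * B"
  proof -
    have "E ^ 2 \<le> E * (435 / 100000)" using Em E0 by (simp add: power2_eq_square)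
    hence 1: "9 * E ^ 2 * coeff6 v 3 \<le> 9 * (E * (435 / 100000)) * coeff6 v 3"
      using v0 by (intro mult_right_mono mult_left_mono coeff6_nonneg) auto
    have "E ^ 3 = E * E ^ 2" by algebra
    also have "\<dots> \<le> E * (435 / 100000) ^ 2" using Em E0 by (intro mult_left_mono power_mono) auto
    finally have 2: "17 * E ^ 3 * coeff6 v 4 \<le> 17 * (E * (435 / 100000) ^ 2) * coeff6 v 4"
      using v0 by (intro mult_right_mono mult_left_mono coeff6_nonneg) auto
    show ?thesis unfolding X_def B_def using 1 2 by (simp add: algebra_simps)
  qed
  have "E * B \<le> (1868 / 1000000 * (1 + 62832 / 10000 * d + 1974 / 100 * d ^ 2 + 541 / 10 * d ^ 3))
            * (481 * 10 + 66498 / 10 * d + 98978 / 10 * d ^ 2 + 170632 / 10 * d ^ 3)"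
    using Eu Bu B0 d by (intro mult_mono) auto
  also have "\<dots> = 1868 / 1000000 * (4810 + (66498 / 10 + 481 * 62832 / 1000) * d
      + (98978 / 10 + 66498 * 62832 / 100000 + 4810 * 1974 / 100) * d ^ 2
      + (170632 / 10 + 98978 * 62832 / 100000 + 66498 * 1974 / 1000 + 481 * 541) * d ^ 3
      + (170632 * 62832 / 100000 + 98978 * 1974 / 1000 + 66498 * 541 / 100) * d ^ 4
      + (170632 * 1974 / 1000 + 98978 * 541 / 100) * d ^ 5 + 170632 * 541 / 100 * d ^ 6)"
    by algebra
  \<comment> \<open>Degrees 4 to 6 are folded into the cubic term by d \<le> 134/1000.\<close>
  also have "\<dots> \<le> 8986 / 1000 + 689 / 10 * d + 2740 / 10 * d ^ 2 + 1079 * d ^ 3"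
  proof -
    have "d ^ 4 \<le> 134 / 1000 * d ^ 3" "d ^ 5 \<le> 134 / 1000 * d ^ 4" "d ^ 6 \<le> 134 / 1000 * d ^ 5"
      using dm[of 3] dm[of 4] dm[of 5] by simp_all
    thus ?thesis using d(1) by (simp, use dk[of 2] dk[of 3] in linarith)
  qed
  finally have EB: "E * B \<le> 8986 / 1000 + 689 / 10 * d + 2740 / 10 * d ^ 2 + 1079 * d ^ 3" .
  \<comment> \<open>\<open>\<kappa>\<close> is a line separating \<open>X / 2d\<close> from \<open>sqrt (H f / 2)\<close> on \<open>[0, 0.134]\<close>, found numerically.\<close>
  define \<kappa> where "\<kappa> = 118 + 470 * d"
  have Xu: "X \<le> 2 * d * \<kappa>"
  proof -
    have "X \<le> - 3213 / 1000 + (191718 / 1000 + 689 / 10) * d + (38228 / 100 + 274) * d ^ 2 + (83406 / 100 + 1079) * d ^ 3"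
      using XB p1 EB by (simp add: ring_distribs)
    also have "\<dots> \<le> 236 * d + 940 * d ^ 2"
    proof -
      have "d ^ 3 \<le> 134 / 1000 * d ^ 2" using dm[of 2] by simp
      \<comment> \<open>The tangent of d^2 at the right endpoint makes the remaining inequality
        linear in d.\<close>
      moreover have "0 \<le> (d - 134 / 1000) ^ 2" by simp
      hence "2 * (134 / 1000) * d - (134 / 1000) ^ 2 \<le> d ^ 2" by (simp add: power2_eq_square algebra_simps)
      ultimately show ?thesis using d by (simp add: power_divide)
    qed
    also have "\<dots> = 2 * d * \<kappa>" unfolding \<kappa>_def by algebra
    finally show ?thesis .
  qed
  have Hl: "22957 / 10 + 3625 * d + 5124 * d ^ 2 \<le> H"
  proof -
    have a: "22351 / 10 + 31996 / 10 * d + 47822 / 10 * d ^ 2 \<le> 2 * (coeff6 v 2 - b * coeff3 v 2)"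
    proof -
      have "22351 / 10 + 31996 / 10 * d + 47822 / 10 * d ^ 2 \<le> 
         26594 / 100 + 104274 / 100 * v + 66743 / 100 * v ^ 2 + 21704 / 100 * v ^ 3 + 3886 / 100 * v ^ 4 + 309 / 100 * v ^ 5"
        using V d(1) dk[of 2] by linarith
      also have "\<dots> \<le> 2 * (32 / 60 * pi ^ 6 - b * 4 * pi ^ 3) + (2 * (2 * pi ^ 5 - b * 3 * pi ^ 2)) * v
        + (2 * (7 / 2 * pi ^ 4 - b * (3 / 4) * pi)) * v ^ 2 + (7 * pi ^ 3) * v ^ 3 + (63 / 16 * pi ^ 2) * v ^ 4 + (63 / 64 * pi) * v ^ 5"
        using P v0 by (intro add_mono mult_right_mono) (auto simp: b_def)
      also have "\<dots> = 2 * (coeff6 v 2 - b * coeff3 v 2)" unfolding c2 by algebra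
      finally show ?thesis .
    qed
    have b: "33667 + 25019 * d + 33305 * d ^ 2 \<le> 4 * coeff6 v 3"
    proof -
      have "33667 + 25019 * d + 33305 * d ^ 2 \<le> 15574 + 12393 * v + 4602 * v ^ 2 + 976 * v ^ 3 + 116 * v ^ 4 + 6 * v ^ 5"
        using V d(1) dk[of 2] by linarith
      also have "\<dots> \<le> (4 * 243 / 60 * pi ^ 6) + (4 * 81 / 8 * pi ^ 5) * v + (4 * 189 / 16 * pi ^ 4) * v ^ 2
         + (4 * 63 / 8 * pi ^ 3) * v ^ 3 + (4 * 189 / 64 * pi ^ 2) * v ^ 4 + (4 * 63 / 128 * pi) * v ^ 5"
        using P v0 by (intro add_mono mult_right_mono) auto
      also have "\<dots> = 4 * coeff6 v 3" unfolding coeff6_def by algebra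
      finally show ?thesis .
    qed
    have "606 / 10 + 4256 / 10 * d + 342 * d ^ 2 \<le> 18 / 10000 * (33667 + (25019 + 628 * 33667 / 100) * d
        + (33305 + 628 * 25019 / 100) * d ^ 2 + 628 * 33305 / 100 * d ^ 3)"
      using d(1) by (simp, use dk[of 2] dk[of 3] in linarith)
    also have "\<dots> = 18 / 10000 * (1 + 628 / 100 * d) * (33667 + 25019 * d + 33305 * d ^ 2)" by algebra
    also have "18 / 10000 * (1 + 628 / 100 * d) * (33667 + 25019 * d + 33305 * d ^ 2) \<le> E * (4 * coeff6 v 3)"
      using El b E0 d by (intro mult_mono) auto
    also have "\<dots> = 4 * E * coeff6 v 3" by simp
    finally have "606 / 10 + 4256 / 10 * d + 342 * d ^ 2 \<le> 4 * E * coeff6 v 3" .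
    thus ?thesis unfolding H_def using a d(1) dk[of 2] by linarith
  qed
  have H0: "H > 0" using Hl d(1) dk[of 2] by linarith
  define f where "f = 1639 / 100 + 1639 / 100 * d + 187 * d ^ 2 + 357 * d ^ 3 + 700 * d ^ 4"
  have key: "2 * \<kappa> ^ 2 \<le> H * f"
  proof -
    \<comment> \<open>Tangents of d^2, d^3 and d^4 at 0.115, close to the point where the quartic
      inequality below has least slack; the inequality then becomes linear.\<close>
    have t: "2 * (115 / 1000) * d - (115 / 1000) ^ 2 \<le> d ^ 2"
        "3 * (115 / 1000) ^ 2 * d - 2 * (115 / 1000) ^ 3 \<le> d ^ 3"
        "4 * (115 / 1000) ^ 3 * d - 3 * (115 / 1000) ^ 4 \<le> d ^ 4"
    proof -
      define a :: real where "a = 115 / 1000"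
      have "d ^ 2 - (2 * a * d - a ^ 2) = (d - a) ^ 2" "d ^ 3 - (3 * a ^ 2 * d - 2 * a ^ 3) = (d - a) ^ 2 * (d + 2 * a)"
        "d ^ 4 - (4 * a ^ 3 * d - 3 * a ^ 4) = (d - a) ^ 2 * (d ^ 2 + 2 * a * d + 3 * a ^ 2)"
        by algebra+
      moreover have "(d - a) ^ 2 \<ge> 0" "(d - a) ^ 2 * (d + 2 * a) \<ge> 0" "(d - a) ^ 2 * (d ^ 2 + 2 * a * d + 3 * a ^ 2) \<ge> 0"
        using d by (auto simp: a_def intro!: mult_nonneg_nonneg add_nonneg_nonneg)
      ultimately show "2 * (115 / 1000) * d - (115 / 1000) ^ 2 \<le> d ^ 2"
        "3 * (115 / 1000) ^ 2 * d - 2 * (115 / 1000) ^ 3 \<le> d ^ 3"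
        "4 * (115 / 1000) ^ 3 * d - 3 * (115 / 1000) ^ 4 \<le> d ^ 4"
        unfolding a_def by linarith+
    qed
    have "2 * \<kappa> ^ 2 = 27848 + 221840 * d + 441800 * d ^ 2" unfolding \<kappa>_def by algebra
    also have "\<dots> \<le> 22957 * 1639 / 1000 + (22957 * 1639 / 1000 + 3625 * 1639 / 100) * d
         + (22957 * 187 / 10 + 3625 * 1639 / 100 + 5124 * 1639 / 100) * d ^ 2
         + (22957 * 357 / 10 + 3625 * 187 + 5124 * 1639 / 100) * d ^ 3
         + (22957 * 70 + 3625 * 357 + 5124 * 187) * d ^ 4"
      using t d by (simp add: power_divide)
    also have "\<dots> \<le> \<dots> + ((3625 * 700 + 5124 * 357) * d ^ 5 + 5124 * 700 * d ^ 6)"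
      using dk[of 5] dk[of 6] by simp
    also have "\<dots> = (22957 / 10 + 3625 * d + 5124 * d ^ 2) * f" unfolding f_def by algebra
    also have "\<dots> \<le> H * f" using Hl d(1) dk by (intro mult_right_mono) (auto simp: f_def)
    finally show ?thesis .
  qed
  define \<rho> where "\<rho> = r * E"
  have rho: "0 \<le> \<rho>" using r E0 by (simp add: \<rho>_def)
  have R6: "y ^ 6 * (row_sum 6 0 y - row_sum 6 x y) \<le> coeff6 v 1 * E * r + coeff6 v 2 * E ^ 2 * (r * (4 - 2 * r))
       + coeff6 v 3 * E ^ 3 * (r * (9 - 4 * r)) + 17 * coeff6 v 4 * E ^ 4 * r"
    unfolding v_def E_def r_def by (rule row_sum_6_diff_le) (use y Em in \<open>auto simp: E_def\<close>)
  have R3: "coeff3 v 1 * E * r + coeff3 v 2 * E ^ 2 * (r * (4 - 2 * r)) \<le> y ^ 3 * (row_sum 3 0 y - row_sum 3 x y)"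
    unfolding v_def E_def r_def by (rule row_sum_3_diff_ge) (use y in auto)
  have "2 * (y ^ 6 * (row_sum 6 0 y - row_sum 6 x y)) - 2 * (3062 / 1000) * (y ^ 3 * (row_sum 3 0 y - row_sum 3 x y))
     \<le> 2 * (coeff6 v 1 * E * r + coeff6 v 2 * E ^ 2 * (r * (4 - 2 * r))
       + coeff6 v 3 * E ^ 3 * (r * (9 - 4 * r)) + 17 * coeff6 v 4 * E ^ 4 * r)
       - 2 * b * (coeff3 v 1 * E * r + coeff3 v 2 * E ^ 2 * (r * (4 - 2 * r)))"
    unfolding b_def by (intro diff_mono mult_left_mono R6 R3) auto
  also have "\<dots> = 2 * \<rho> * X - 2 * \<rho> ^ 2 * H"
    unfolding \<rho>_def X_def H_def by algebra
  also have "\<dots> \<le> 2 * \<rho> * (2 * d * \<kappa>) - 2 * \<rho> ^ 2 * H"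
    using Xu rho by (intro diff_mono mult_left_mono) auto
  also have "\<dots> \<le> d ^ 2 * f"
  proof -
    \<comment> \<open>Completing the square in \<rho> after multiplication by H.\<close>
    have "H * (2 * \<rho> * (2 * d * \<kappa>) - 2 * \<rho> ^ 2 * H) = 2 * (d * \<kappa>) ^ 2 - 2 * (\<rho> * H - d * \<kappa>) ^ 2"
      by algebra
    also have "\<dots> \<le> d ^ 2 * (2 * \<kappa> ^ 2)" by (simp add: power_mult_distrib)
    also have "\<dots> \<le> d ^ 2 * (H * f)" using key by (intro mult_left_mono) auto
    finally have "H * (2 * \<rho> * (2 * d * \<kappa>) - 2 * \<rho> ^ 2 * H) \<le> H * (d ^ 2 * f)" by (simp add: mult_ac)
    thus ?thesis using H0 by (simp only: mult_le_cancel_left_pos)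
  qed
  finally show ?thesis unfolding f_def .
qed

section \<open>Lattice sums and their rows\<close>

definition lattice :: "(int \<times> int) set" where
  "lattice = UNIV - {(0, 0)}"

text \<open>Free of s, so that both zeta values are power sums of the same terms and one
  rearrangement of the lattice treats every exponent at once.\<close>

definition lattice_term :: "real \<Rightarrow> real \<Rightarrow> int \<times> int \<Rightarrow> real" where
  "lattice_term x y = (\<lambda>(m, n). y / ((m * x + n)\<^sup>2 + (m * y)\<^sup>2))"

definition lattice_sum :: "nat \<Rightarrow> real \<Rightarrow> real \<Rightarrow> real" where
  "lattice_sum s x y = infsum (\<lambda>p. lattice_term x y p ^ s) lattice"

lemma epstein_zeta_numeral:
  assumes "Im z > 0"
  shows "epstein_zeta (numeral s) z = lattice_sum (numeral s) (Re z) (Im z)"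
  unfolding epstein_zeta_def lattice_sum_def lattice_def[symmetric]
proof (intro infsum_cong)
  fix p assume p: "p \<in> lattice"
  obtain m n where mn: "p = (m, n)" by (cases p)
  define w where "w = of_int m * z + of_int n"
  have w: "(cmod w)\<^sup>2 = (m * Re z + n)\<^sup>2 + (m * Im z)\<^sup>2"
    by (simp add: w_def cmod_power2)
  have w0: "w \<noteq> 0"
  proof
    assume "w = 0"
    hence "Im w = 0" "Re w = 0" by auto
    thus False using p mn assms by (auto simp: w_def lattice_def)
  qed
  have "cmod w powr (2 * numeral s) = (cmod w powr 2) powr numeral s" by (simp add: powr_powr)
  also have "\<dots> = ((cmod w)\<^sup>2) ^ numeral s" using w0 by simp
  finally have "cmod w powr (2 * numeral s) = ((m * Re z + n)\<^sup>2 + (m * Im z)\<^sup>2) ^ numeral s" by (simp add: w)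
  thus "(case p of (m, n) \<Rightarrow> Im z powr numeral s / cmod (of_int m * z + of_int n) powr (2 * numeral s)) =
         lattice_term (Re z) (Im z) p ^ numeral s"
    using assms by (simp add: mn lattice_term_def w_def power_divide)
qed

lemma lattice_term_nonneg: "y > 0 \<Longrightarrow> lattice_term x y p \<ge> 0"
  by (auto simp: lattice_term_def split: prod.split)

lemma lattice_norm_ge_1: "(m, n) \<in> lattice \<Longrightarrow> 1 \<le> (real_of_int m)\<^sup>2 + (real_of_int n)\<^sup>2"
proof -
  assume "(m, n) \<in> lattice"
  hence "m\<^sup>2 + n\<^sup>2 \<noteq> 0" by (simp add: lattice_def sum_power2_eq_zero_iff)
  moreover have "m\<^sup>2 + n\<^sup>2 \<ge> 0" by simp
  ultimately have "1 \<le> m\<^sup>2 + n\<^sup>2" by linarith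
  hence "real_of_int 1 \<le> real_of_int (m\<^sup>2 + n\<^sup>2)" by (simp only: of_int_le_iff)
  thus ?thesis by simp
qed

text \<open>|m z + n|^2 is a positive definite form, hence comparable with m^2 + n^2. This gives
  both summability and the finiteness of the set of large terms.\<close>

lemma lattice_form_lower_bound:
  fixes x y :: real
  assumes "y > 0"
  obtains C where "C > 0" "\<And>m n :: real. m\<^sup>2 + n\<^sup>2 \<le> C * ((m * x + n)\<^sup>2 + (m * y)\<^sup>2)"
proof -
  define C where "C = 2 + (2 * x\<^sup>2 + 1) / y\<^sup>2"
  have "m\<^sup>2 + n\<^sup>2 \<le> C * ((m * x + n)\<^sup>2 + (m * y)\<^sup>2)" for m n :: real
  proof -
    have "C * ((m * x + n)\<^sup>2 + (m * y)\<^sup>2) = (2 + (2 * x\<^sup>2 + 1) / y\<^sup>2) * (m * x + n)\<^sup>2 + 2 * (m * y)\<^sup>2 + (2 * x\<^sup>2 + 1) * m\<^sup>2"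
      using assms by (simp add: C_def field_simps)
    also have "\<dots> \<ge> 2 * (m * x + n)\<^sup>2 + 0 + (2 * x\<^sup>2 + 1) * m\<^sup>2"
      by (intro add_mono mult_right_mono) auto
    also have "2 * (m * x + n)\<^sup>2 + 0 + (2 * x\<^sup>2 + 1) * m\<^sup>2 = m\<^sup>2 + n\<^sup>2 + (2 * m * x + n)\<^sup>2"
      by algebra
    finally show ?thesis by (rule order_trans[rotated]) simp
  qed
  moreover have "C > 0" by (auto simp: C_def intro!: add_pos_nonneg)
  ultimately show thesis using that by blast
qed

lemma has_sum_int:
  fixes f :: "int \<Rightarrow> real"
  assumes "((\<lambda>n. f (int n)) has_sum a) UNIV" "((\<lambda>n. f (- 1 - int n)) has_sum b) UNIV"
  shows "(f has_sum (a + b)) UNIV"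
proof -
  have "(f has_sum a) (int ` UNIV)"
    using assms(1) by (subst has_sum_reindex) (auto simp: o_def)
  moreover have "(f has_sum b) ((\<lambda>n. - 1 - int n) ` UNIV)"
    using assms(2) by (subst has_sum_reindex) (auto simp: o_def inj_on_def)
  moreover have "int ` UNIV \<inter> (\<lambda>n. - 1 - int n) ` UNIV = {}" by auto
  ultimately have "(f has_sum (a + b)) (int ` UNIV \<union> (\<lambda>n. - 1 - int n) ` UNIV)"
    by (rule has_sum_Un_disjoint)
  moreover have "k \<in> int ` UNIV \<union> (\<lambda>n. - 1 - int n) ` UNIV" for k :: int
  proof (cases "k \<ge> 0")
    case True
    hence "k = int (nat k)" by simp
    thus ?thesis by blast
  next
    case False
    hence "k = - 1 - int (nat (- 1 - k))" by simp
    thus ?thesis by blast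
  qed
  hence "int ` UNIV \<union> (\<lambda>n. - 1 - int n) ` UNIV = UNIV" by blast
  ultimately show ?thesis by simp
qed

lemma row_sum_has_sum:
  fixes x y :: real
  assumes "y > 0" "s \<ge> 1"
  shows "((\<lambda>n::int. 1 / ((x + n)\<^sup>2 + y\<^sup>2) ^ s) has_sum row_sum s x y) UNIV"
  unfolding row_sum_def
proof (rule has_sum_int)
  show "((\<lambda>n. 1 / ((x + real_of_int (int n))\<^sup>2 + y\<^sup>2) ^ s) has_sum half_sum s x y) UNIV"
    using summable_sums[OF summable_half_sum[OF assms, of x]]
    by (intro sums_nonneg_imp_has_sum) (auto simp: half_sum_def)
  have "(x + real_of_int (- 1 - int n))\<^sup>2 = (1 - x + real n)\<^sup>2" for n
    by (simp add: power2_eq_square algebra_simps)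
  thus "((\<lambda>n. 1 / ((x + real_of_int (- 1 - int n))\<^sup>2 + y\<^sup>2) ^ s) has_sum half_sum s (1 - x) y) UNIV"
    using summable_sums[OF summable_half_sum[OF assms, of "1 - x"]]
    by (intro sums_nonneg_imp_has_sum) (auto simp: half_sum_def)
qed

text \<open>The majorant is a product of two one-dimensional sums of 1/(1 + n^2), each of which is
  the row with s = 1, x = 0, y = 1; m^2 + n^2 \<ge> 1 makes the comparison work.\<close>

lemma summable_inverse_lattice_norm:
  assumes "s \<ge> 2"
  shows "(\<lambda>(m, n). (1 / ((real_of_int m)\<^sup>2 + (real_of_int n)\<^sup>2)) ^ s) summable_on lattice"
proof -
  have i: "((\<lambda>n::int. 1 / ((real_of_int n)\<^sup>2 + 1)) has_sum row_sum 1 0 1) UNIV"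
    using row_sum_has_sum[of 1 1 0] by simp
  define g where "g = (\<lambda>(m::int, n::int). (1 / (1 + (real_of_int m)\<^sup>2)) * (1 / (1 + (real_of_int n)\<^sup>2)))"
  have "g summable_on (UNIV \<times> UNIV)"
  proof (rule summable_on_SigmaI)
    show "((\<lambda>n. g (m, n)) has_sum (1 / (1 + (real_of_int m)\<^sup>2) * row_sum 1 0 1)) UNIV" for m
      using has_sum_cmult_right[OF i, of "1 / (1 + (real_of_int m)\<^sup>2)"] by (simp add: g_def add_ac)
    show "(\<lambda>m::int. 1 / (1 + (real_of_int m)\<^sup>2) * row_sum 1 0 1) summable_on UNIV"
      using has_sum_cmult_left[OF i, of "row_sum 1 0 1"] by (auto simp: add_ac dest: has_sum_imp_summable)
  qed (auto simp: g_def)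
  hence "g summable_on lattice" by (rule summable_on_subset_banach) auto
  hence "(\<lambda>p. 3 * g p) summable_on lattice" by (rule summable_on_cmult_right)
  thus ?thesis
  proof (rule summable_on_comparison_test)
    fix p assume p: "p \<in> lattice"
    obtain m n where mn: "p = (m, n)" by (cases p)
    define M where "M = (real_of_int m)\<^sup>2"
    define K where "K = (real_of_int n)\<^sup>2"
    have N: "1 \<le> M + K" using lattice_norm_ge_1 p by (simp add: mn M_def K_def)
    have MK: "0 \<le> M" "0 \<le> K" by (auto simp: M_def K_def)
    have "(1 / (M + K)) ^ s \<le> (1 / (M + K)) ^ 2"
      using N assms by (intro power_decreasing) auto
    also have "\<dots> = 1 / (M + K) ^ 2" by (simp add: power_divide)
    also have "\<dots> \<le> 3 / ((1 + M) * (1 + K))"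
    proof -
      have "M + K \<le> (M + K) ^ 2" using N by (simp add: power2_eq_square)
      moreover have "1 \<le> (M + K) ^ 2" using N by (rule one_le_power)
      moreover have "M * K \<le> (M + K) ^ 2"
        using MK by (simp add: power2_eq_square algebra_simps)
      moreover have "(1 + M) * (1 + K) = 1 + (M + K) + M * K" by algebra
      ultimately have "(1 + M) * (1 + K) \<le> 3 * (M + K) ^ 2" by linarith
      thus ?thesis using MK N by (simp add: divide_simps mult.commute)
    qed
    finally show "(case p of (m, n) \<Rightarrow> (1 / ((real_of_int m)\<^sup>2 + (real_of_int n)\<^sup>2)) ^ s) \<le> 3 * g p"
      by (simp add: mn g_def M_def K_def)
  qed auto
qed

lemma summable_lattice_term:
  assumes "y > 0" "s \<ge> 2"
  shows "(\<lambda>p. lattice_term x y p ^ s) summable_on lattice"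
proof -
  obtain C where C: "C > 0" "\<And>m n :: real. m\<^sup>2 + n\<^sup>2 \<le> C * ((m * x + n)\<^sup>2 + (m * y)\<^sup>2)"
    using lattice_form_lower_bound[OF assms(1)] by blast
  have "(\<lambda>p. (C * y) ^ s * (case p of (m, n) \<Rightarrow> (1 / ((real_of_int m)\<^sup>2 + (real_of_int n)\<^sup>2)) ^ s)) summable_on lattice"
    by (intro summable_on_cmult_right summable_inverse_lattice_norm assms)
  thus ?thesis
  proof (rule summable_on_comparison_test)
    fix p assume p: "p \<in> lattice"
    obtain m n where mn: "p = (m, n)" by (cases p)
    have N: "1 \<le> (real_of_int m)\<^sup>2 + (real_of_int n)\<^sup>2" using lattice_norm_ge_1 p by (simp add: mn)
    have c: "(real_of_int m)\<^sup>2 + (real_of_int n)\<^sup>2 \<le> C * ((m * x + n)\<^sup>2 + (m * y)\<^sup>2)" by (rule C)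
    hence "0 < C * ((m * x + n)\<^sup>2 + (m * y)\<^sup>2)" using N by linarith
    hence q: "0 < (m * x + n)\<^sup>2 + (m * y)\<^sup>2" using C(1) by (simp add: zero_less_mult_iff)
    have "y * ((real_of_int m)\<^sup>2 + (real_of_int n)\<^sup>2) \<le> y * (C * ((m * x + n)\<^sup>2 + (m * y)\<^sup>2))"
      using c assms by (intro mult_left_mono) auto
    hence "lattice_term x y p \<le> C * y * (1 / ((real_of_int m)\<^sup>2 + (real_of_int n)\<^sup>2))"
      using q N by (simp add: mn lattice_term_def divide_simps mult_ac)
    hence "lattice_term x y p ^ s \<le> (C * y * (1 / ((real_of_int m)\<^sup>2 + (real_of_int n)\<^sup>2))) ^ s"
      by (intro power_mono lattice_term_nonneg assms)
    thus "lattice_term x y p ^ s \<le> (C * y) ^ s * (case p of (m, n) \<Rightarrow> (1 / ((real_of_int m)\<^sup>2 + (real_of_int n)\<^sup>2)) ^ s)"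
      by (simp only: mn power_mult_distrib prod.case)
  qed (use assms lattice_term_nonneg in auto)
qed

text \<open>The row m = 0 does not involve x and cancels in horizontal differences; any other row is
  \<open>row_sum\<close> at the rescaled point (m x, |m| y).\<close>

definition lattice_row :: "nat \<Rightarrow> real \<Rightarrow> real \<Rightarrow> int \<Rightarrow> real" where
  "lattice_row s x y m = (if m = 0 then infsum (\<lambda>n::int. (y / n\<^sup>2) ^ s) (- {0})
     else y ^ s * row_sum s (m * x) (\<bar>m\<bar> * y))"

lemma lattice_row_has_sum:
  assumes "y > 0" "s \<ge> 2"
  shows "(lattice_row s x y has_sum lattice_sum s x y) UNIV"
proof (rule has_sum_SigmaD)
  let ?B = "\<lambda>m. if m = 0 then - {0} else UNIV :: int set"
  have lat: "lattice = Sigma UNIV ?B" by (auto simp: lattice_def split: if_splits)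
  show "((\<lambda>p. lattice_term x y p ^ s) has_sum lattice_sum s x y) (Sigma UNIV ?B)"
    unfolding lattice_sum_def lat[symmetric] using summable_lattice_term[OF assms] by (rule has_sum_infsum)
  fix m :: int
  show "((\<lambda>n. lattice_term x y (m, n) ^ s) has_sum lattice_row s x y m) (?B m)"
  proof (cases "m = 0")
    case True
    have "(\<lambda>n. lattice_term x y (0, n) ^ s) summable_on (- {0})"
    proof -
      have "(\<lambda>p. lattice_term x y p ^ s) summable_on (Pair 0 ` (- {0}))"
        by (rule summable_on_subset_banach[OF summable_lattice_term[OF assms]]) (auto simp: lattice_def)
      thus ?thesis by (subst (asm) summable_on_reindex) (auto simp: o_def inj_on_def)
    qed
    hence "((\<lambda>n. lattice_term x y (0, n) ^ s) has_sum infsum (\<lambda>n. lattice_term x y (0, n) ^ s) (- {0})) (- {0})"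
      by (rule has_sum_infsum)
    thus ?thesis using True by (simp add: lattice_row_def lattice_term_def)
  next
    case False
    have "((\<lambda>n::int. y ^ s * (1 / ((m * x + n)\<^sup>2 + (\<bar>m\<bar> * y)\<^sup>2) ^ s)) has_sum y ^ s * row_sum s (m * x) (\<bar>m\<bar> * y)) UNIV"
      using False assms by (intro has_sum_cmult_right row_sum_has_sum) auto
    thus ?thesis using False by (simp add: lattice_row_def lattice_term_def power_divide power_mult_distrib)
  qed
qed

lemma lattice_sum_diff_has_sum:
  assumes "y > 0" "s \<ge> 2"
  shows "((\<lambda>m. lattice_row s 0 y m - lattice_row s x y m) has_sum (lattice_sum s 0 y - lattice_sum s x y)) UNIV"
  using has_sum_add[OF lattice_row_has_sum[OF assms, of 0] has_sum_uminusI[OF lattice_row_has_sum[OF assms, of x]]]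
  by simp

text \<open>Replacing y^s by (|m| y)^s brings the difference into the form in which the row
  estimates are stated, at height |m| y and with weight |m|^(-s).\<close>

lemma lattice_row_diff:
  assumes "y > 0" "m \<noteq> 0"
  shows "lattice_row s 0 y m - lattice_row s x y m =
     (1 / \<bar>m\<bar>) ^ s * ((\<bar>m\<bar> * y) ^ s * (row_sum s 0 (\<bar>m\<bar> * y) - row_sum s (m * x) (\<bar>m\<bar> * y)))"
proof -
  have "(1 / \<bar>m\<bar>) ^ s * (\<bar>m\<bar> * y) ^ s = (1 / \<bar>m\<bar> * (\<bar>m\<bar> * y)) ^ s" by (simp only: power_mult_distrib)
  also have "1 / \<bar>m\<bar> * (\<bar>m\<bar> * y) = y" using assms by simp
  finally have "y ^ s = (1 / \<bar>m\<bar>) ^ s * (\<bar>m\<bar> * y) ^ s" ..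
  thus ?thesis using assms by (simp add: lattice_row_def right_diff_distrib)
qed

section \<open>Row inequalities summed over the lattice\<close>

lemma row_sum_3_diff_nonneg:
  fixes x y :: real
  assumes "y > 0"
  shows "0 \<le> y ^ 3 * (row_sum 3 0 y - row_sum 3 x y)"
proof (rule sums_le[OF _ sums_zero row_sum_3_diff_sums[OF assms, of x]])
  show "0 \<le> coeff3 (inverse y) (real k) * exp (- 2 * pi * y) ^ k * (1 - cos (2 * pi * real k * x))" for k
    using assms by (intro mult_nonneg_nonneg coeff3_nonneg) auto
qed

lemma lattice_row_3_diff_nonneg:
  assumes "y > 0"
  shows "0 \<le> lattice_row 3 0 y m - lattice_row 3 x y m"
proof (cases "m = 0")
  case False
  thus ?thesis
    unfolding lattice_row_diff[OF assms False] using assms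
    by (intro mult_nonneg_nonneg[OF _ row_sum_3_diff_nonneg]) auto
qed (simp add: lattice_row_def)

text \<open>The weights help: |m|^(-6) \<le> |m|^(-3), and the difference for s = 3 is
  nonnegative.\<close>

lemma lattice_row_diff_compare:
  assumes "y > 0" "m = 0 \<or> \<bar>m\<bar> * y \<ge> 1"
  shows "lattice_row 6 0 y m - lattice_row 6 x y m \<le> 3 * (lattice_row 3 0 y m - lattice_row 3 x y m)"
proof (cases "m = 0")
  case False
  define M :: real where "M = \<bar>m\<bar>"
  have M: "M \<ge> 1" using False by (simp add: M_def)
  define D where "D s = (M * y) ^ s * (row_sum s 0 (M * y) - row_sum s (m * x) (M * y))" for s
  have D6: "D 6 \<le> 3 * D 3" unfolding D_def by (rule row_sum_diff_compare_ge_1) (use assms False in \<open>auto simp: M_def\<close>)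
  have D3: "0 \<le> D 3" unfolding D_def by (rule row_sum_3_diff_nonneg) (use assms M in auto)
  have "(1 / M) ^ 6 * D 6 \<le> (1 / M) ^ 6 * (3 * D 3)" using D6 M by (intro mult_left_mono) auto
  also have "\<dots> \<le> (1 / M) ^ 3 * (3 * D 3)" using D3 M by (intro mult_right_mono power_decreasing) auto
  finally show ?thesis
    unfolding lattice_row_diff[OF assms(1) False] by (simp add: D_def M_def)
qed (simp add: lattice_row_def)

lemma lattice_sum_diff_nonneg:
  assumes "y > 0"
  shows "0 \<le> lattice_sum 3 0 y - lattice_sum 3 x y"
  using has_sum_nonneg[OF lattice_sum_diff_has_sum[OF assms, of 3 x]] lattice_row_3_diff_nonneg[OF assms] by simp

lemma lattice_sum_diff_compare:
  assumes "y \<ge> 1"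
  shows "lattice_sum 6 0 y - lattice_sum 6 x y \<le> 3 * (lattice_sum 3 0 y - lattice_sum 3 x y)"
proof (rule has_sum_mono)
  show "((\<lambda>m. lattice_row 6 0 y m - lattice_row 6 x y m) has_sum (lattice_sum 6 0 y - lattice_sum 6 x y)) UNIV"
    using assms by (intro lattice_sum_diff_has_sum) auto
  show "((\<lambda>m. 3 * (lattice_row 3 0 y m - lattice_row 3 x y m)) has_sum 3 * (lattice_sum 3 0 y - lattice_sum 3 x y)) UNIV"
    using assms by (intro has_sum_cmult_right lattice_sum_diff_has_sum) auto
  fix m :: int
  have "m = 0 \<or> 1 * 1 \<le> \<bar>real_of_int m\<bar> * y"
    using assms by (cases "m = 0") (simp, intro disjI2 mult_mono, auto)
  thus "lattice_row 6 0 y m - lattice_row 6 x y m \<le> 3 * (lattice_row 3 0 y m - lattice_row 3 x y m)"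
    using assms by (intro lattice_row_diff_compare) auto
qed

lemma lattice_sum_diff_rows_pm1:
  assumes "y > 0"
  shows "y ^ 3 * (row_sum 3 0 y - row_sum 3 x y) + y ^ 3 * (row_sum 3 0 y - row_sum 3 (- x) y)
     \<le> lattice_sum 3 0 y - lattice_sum 3 x y"
proof -
  have "sum (\<lambda>m. lattice_row 3 0 y m - lattice_row 3 x y m) {1, - 1} \<le> lattice_sum 3 0 y - lattice_sum 3 x y"
    by (rule finite_sum_le_has_sum[OF lattice_sum_diff_has_sum])
       (use assms lattice_row_3_diff_nonneg in auto)
  thus ?thesis using lattice_row_diff[OF assms, of 1 3 x] lattice_row_diff[OF assms, of "-1" 3 x] by simp
qed

text \<open>Rows with |m| \<ge> 2 have height |m| y \<ge> 1, where the comparison with factor 3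
  \<le> 3.062 makes their contribution nonpositive. Only m = 1 and m = -1 can cause a loss.\<close>

lemma lattice_sum_diff_le_1:
  fixes x y :: real
  assumes y: "866 / 1000 \<le> y" "y \<le> 1"
  defines "d \<equiv> 1 - y"
  shows "(lattice_sum 6 0 y - lattice_sum 6 x y) - 3062 / 1000 * (lattice_sum 3 0 y - lattice_sum 3 x y)
     \<le> d ^ 2 * (1639 / 100 + 1639 / 100 * d + 187 * d ^ 2 + 357 * d ^ 3 + 700 * d ^ 4)"
proof -
  have y0: "y > 0" using y by simp
  define e where "e m = (lattice_row 6 0 y m - lattice_row 6 x y m) + (- (3062 / 1000)) * (lattice_row 3 0 y m - lattice_row 3 x y m)" for m
  have e: "(e has_sum ((lattice_sum 6 0 y - lattice_sum 6 x y) + (- (3062 / 1000)) * (lattice_sum 3 0 y - lattice_sum 3 x y))) UNIV"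
    unfolding e_def using y0 by (intro has_sum_add has_sum_cmult_right lattice_sum_diff_has_sum) auto
  have en: "e m \<le> 0" if "m \<notin> {1, - 1}" for m
  proof -
    have "m = 0 \<or> 2 * (1 / 2) \<le> \<bar>real_of_int m\<bar> * y"
    proof (cases "m = 0")
      case False
      hence "2 \<le> \<bar>real_of_int m\<bar>" using that by auto
      thus ?thesis using y by (intro disjI2 mult_mono) auto
    qed auto
    hence "lattice_row 6 0 y m - lattice_row 6 x y m \<le> 3 * (lattice_row 3 0 y m - lattice_row 3 x y m)"
      using y0 by (intro lattice_row_diff_compare) auto
    thus ?thesis using lattice_row_3_diff_nonneg[OF y0, of m x] by (simp add: e_def)
  qed
  have "(lattice_sum 6 0 y - lattice_sum 6 x y) + (- (3062 / 1000)) * (lattice_sum 3 0 y - lattice_sum 3 x y) \<le> sum e {1, - 1}"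
    by (rule has_sum_mono_neutral[OF e has_sum_finite]) (use en in auto)
  also have "\<dots> = e 1 + e (- 1)" by simp
  also have "\<dots> \<le> d ^ 2 * (1639 / 100 + 1639 / 100 * d + 187 * d ^ 2 + 357 * d ^ 3 + 700 * d ^ 4)"
    using row_sum_diff_compare_le_1[OF y, of x] row_sum_diff_compare_le_1[OF y, of "- x"]
      lattice_row_diff[OF y0, of 1 3 x] lattice_row_diff[OF y0, of "-1" 3 x]
      lattice_row_diff[OF y0, of 1 6 x] lattice_row_diff[OF y0, of "-1" 6 x]
    unfolding e_def d_def[symmetric] by simp
  finally show ?thesis by simp
qed

section \<open>The imaginary axis\<close>

text \<open>The convex function t^(-n) lies above its tangent at x; this is Bernoulli's inequality
  for x/t with exponent n + 1, multiplied by t/x. Averaging tangents gives Jensen's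
  inequality.\<close>

lemma inverse_power_tangent:
  fixes t x :: real
  assumes "t > 0" "x > 0"
  shows "(1 / x) ^ n * (1 + real n - real n * (t / x)) \<le> (1 / t) ^ n"
proof -
  have "1 + real (Suc n) * (x / t - 1) \<le> (1 + (x / t - 1)) ^ Suc n"
    using assms by (intro Bernoulli_inequality) auto
  hence "(1 + real n) * (x / t) - real n \<le> (x / t) ^ Suc n" by (simp add: algebra_simps)
  hence "(t / x) * ((1 + real n) * (x / t) - real n) \<le> (t / x) * (x / t) ^ Suc n"
    using assms by (intro mult_left_mono) auto
  moreover have "(t / x) * ((1 + real n) * (x / t) - real n) = 1 + real n - real n * (t / x)"
    using assms by (simp add: field_simps)
  moreover have "(t / x) * (x / t) ^ Suc n = (x / t) ^ n" using assms by simp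
  ultimately have "1 + real n - real n * (t / x) \<le> (x / t) ^ n" by simp
  hence "(1 / x) ^ n * (1 + real n - real n * (t / x)) \<le> (1 / x) ^ n * (x / t) ^ n"
    using assms by (intro mult_left_mono) auto
  also have "\<dots> = (1 / t) ^ n" using assms by (simp flip: power_mult_distrib)
  finally show ?thesis .
qed

text \<open>With l = M/(M+K) both arguments are M + K times a convex combination of y and 1/y, with
  weights l, 1 - l and 1 - l, l. The chord bounds of t^(-n) then add up to something free of
  l.\<close>

lemma swapped_pair_upper:
  fixes M K y :: real
  assumes "M \<ge> 0" "K \<ge> 0" "M + K > 0" "y > 0"
  shows "(1 / (M * y + K * (1 / y))) ^ n + (1 / (K * y + M * (1 / y))) ^ n \<le> (y ^ n + (1 / y) ^ n) * (1 / (M + K)) ^ n"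
proof -
  have J: "(1 / (l * y + (1 - l) * (1 / y))) ^ n \<le> l * (1 / y) ^ n + (1 - l) * y ^ n" if "0 \<le> l" "l \<le> 1" for l
  proof -
    define x where "x = l * y + (1 - l) * (1 / y)"
    have x: "x > 0"
    proof (cases "l = 0")
      case False
      thus ?thesis using that assms by (auto simp: x_def intro!: add_pos_nonneg)
    qed (use assms in \<open>auto simp: x_def\<close>)
    have "l * ((1 / x) ^ n * (1 + real n - real n * (y / x))) + (1 - l) * ((1 / x) ^ n * (1 + real n - real n * ((1 / y) / x)))
        \<le> l * (1 / y) ^ n + (1 - l) * (1 / (1 / y)) ^ n"
      using that assms x by (intro add_mono mult_left_mono inverse_power_tangent) auto
    also have "l * ((1 / x) ^ n * (1 + real n - real n * (y / x))) + (1 - l) * ((1 / x) ^ n * (1 + real n - real n * ((1 / y) / x)))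
       = (1 / x) ^ n * (1 + real n - real n * ((l * y + (1 - l) * (1 / y)) / x))"
      by (simp add: algebra_simps add_divide_distrib diff_divide_distrib)
    also have "\<dots> = (1 / x) ^ n" using x unfolding x_def[symmetric] by simp
    finally show ?thesis by (simp add: x_def)
  qed
  define N where "N = M + K"
  define l where "l = M / N"
  have N: "N > 0" using assms by (simp add: N_def)
  have l: "0 \<le> l" "l \<le> 1" using assms N by (auto simp: l_def N_def field_simps)
  have M: "M = N * l" "K = N * (1 - l)" using N by (auto simp: l_def N_def field_simps)
  have e: "(1 / (M * y + K * (1 / y))) ^ n = (1 / N) ^ n * (1 / (l * y + (1 - l) * (1 / y))) ^ n"
    "(1 / (K * y + M * (1 / y))) ^ n = (1 / N) ^ n * (1 / ((1 - l) * y + (1 - (1 - l)) * (1 / y))) ^ n"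
  proof -
    define v where "v = 1 / y"
    have "M * y + K * v = N * (l * y + (1 - l) * v)" "K * y + M * v = N * ((1 - l) * y + (1 - (1 - l)) * v)"
      unfolding M by algebra+
    thus "(1 / (M * y + K * (1 / y))) ^ n = (1 / N) ^ n * (1 / (l * y + (1 - l) * (1 / y))) ^ n"
      "(1 / (K * y + M * (1 / y))) ^ n = (1 / N) ^ n * (1 / ((1 - l) * y + (1 - (1 - l)) * (1 / y))) ^ n"
      unfolding v_def power_mult_distrib[symmetric] by simp_all
  qed
  have "(1 / (M * y + K * (1 / y))) ^ n + (1 / (K * y + M * (1 / y))) ^ n
      \<le> (1 / N) ^ n * (l * (1 / y) ^ n + (1 - l) * y ^ n) + (1 / N) ^ n * ((1 - l) * (1 / y) ^ n + (1 - (1 - l)) * y ^ n)"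
    unfolding e using l N by (intro add_mono mult_left_mono J) auto
  also have "\<dots> = (y ^ n + (1 / y) ^ n) * (1 / N) ^ n" by (simp add: algebra_simps)
  finally show ?thesis by (simp add: N_def)
qed

text \<open>The two arguments have mean (M + K)(y + 1/y)/2, independent of how M + K is split; the
  tangent at the mean bounds both terms.\<close>

lemma swapped_pair_lower:
  fixes M K y :: real
  assumes "M \<ge> 0" "K \<ge> 0" "M + K > 0" "y > 0"
  shows "2 * ((1 / ((y + 1 / y) / 2)) ^ n * (1 / (M + K)) ^ n)
     \<le> (1 / (M * y + K * (1 / y))) ^ n + (1 / (K * y + M * (1 / y))) ^ n"
proof -
  define a where "a = M * y + K * (1 / y)"
  define b where "b = K * y + M * (1 / y)"
  have ab: "a > 0" "b > 0"
    using assms by (auto simp: a_def b_def) (cases "M = 0"; cases "K = 0"; force intro: add_pos_nonneg add_nonneg_pos)+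
  define x where "x = (a + b) / 2"
  have x: "x > 0" using ab by (simp add: x_def)
  have "(1 / x) ^ n * (1 + real n - real n * (a / x)) + (1 / x) ^ n * (1 + real n - real n * (b / x)) \<le> (1 / a) ^ n + (1 / b) ^ n"
    using ab x by (intro add_mono inverse_power_tangent) auto
  moreover have "(1 / x) ^ n * (1 + real n - real n * (a / x)) + (1 / x) ^ n * (1 + real n - real n * (b / x))
     = (1 / x) ^ n * (2 + 2 * real n - real n * ((a + b) / x))" by (simp add: algebra_simps add_divide_distrib)
  moreover have "(a + b) / x = 2" using ab by (simp add: x_def field_simps)
  ultimately have "2 * (1 / x) ^ n \<le> (1 / a) ^ n + (1 / b) ^ n" by simp
  moreover have "x = ((y + 1 / y) / 2) * (M + K)" by (simp add: x_def a_def b_def algebra_simps add_divide_distrib)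
  hence "1 / x = 1 / ((y + 1 / y) / 2) * (1 / (M + K))" by (simp only:) simp
  hence "(1 / x) ^ n = (1 / ((y + 1 / y) / 2)) ^ n * (1 / (M + K)) ^ n"
    by (simp only: power_mult_distrib)
  ultimately show ?thesis by (simp only: a_def b_def)
qed

section \<open>The axis sums, symmetrised under (m, n) -> (n, m)\<close>

lemma lattice_swap_bij: "bij_betw prod.swap lattice lattice"
  by (rule bij_betw_byWitness[where f' = prod.swap]) (auto simp: lattice_def)

lemma lattice_term_axis:
  assumes "y > 0"
  shows "lattice_term 0 y (m, n) = 1 / ((real_of_int m)\<^sup>2 * y + (real_of_int n)\<^sup>2 * (1 / y))"
  using assms by (simp add: lattice_term_def field_simps power2_eq_square)

lemma lattice_sum_axis_swap_has_sum:
  assumes "y > 0" "s \<ge> 2"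
  shows "((\<lambda>p. lattice_term 0 y p ^ s + lattice_term 0 y (prod.swap p) ^ s) has_sum (2 * lattice_sum s 0 y)) lattice"
proof -
  have a: "((\<lambda>p. lattice_term 0 y p ^ s) has_sum lattice_sum s 0 y) lattice"
    unfolding lattice_sum_def by (rule has_sum_infsum[OF summable_lattice_term[OF assms]])
  hence "((\<lambda>p. lattice_term 0 y (prod.swap p) ^ s) has_sum lattice_sum s 0 y) lattice"
    using has_sum_reindex_bij_betw[OF lattice_swap_bij, of "\<lambda>p. lattice_term 0 y p ^ s"] by simp
  from has_sum_add[OF a this] show ?thesis by simp
qed

text \<open>Allows the generic bound for a pair of terms to be replaced by the exact value on the
  few vectors where the generic bound loses most.\<close>

lemma has_sum_finite_correction:
  fixes f g :: "'a \<Rightarrow> real"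
  assumes "(f has_sum a) A" "finite B" "B \<subseteq> A"
  shows "((\<lambda>x. if x \<in> B then g x else f x) has_sum (a + (\<Sum>x\<in>B. g x - f x))) A"
proof -
  have "((\<lambda>x. g x - f x) has_sum (\<Sum>x\<in>B. g x - f x)) B" using assms by (intro has_sum_finite) auto
  hence "((\<lambda>x. if x \<in> B then g x - f x else 0) has_sum (\<Sum>x\<in>B. g x - f x)) A"
    by (rule has_sum_cong_neutral[THEN iffD1, rotated -1]) (use assms in auto)
  from has_sum_add[OF assms(1) this] show ?thesis
    by (rule has_sum_cong[THEN iffD1, rotated]) auto
qed

text \<open>The chord bound is an equality on vectors (m, 0) and (0, n) and weakest when |m| = |n|.
  The sharper version therefore evaluates the four vectors (\<plusminus>1, \<plusminus>1) exactly;
  at y = 1 they contribute 4 * (1/2)^3 = 1/2.\<close>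

lemma lattice_sum_3_axis_le:
  fixes y :: real
  assumes "y > 0"
  defines "p \<equiv> y ^ 3 + (1 / y) ^ 3"
  shows "lattice_sum 3 0 y \<le> p / 2 * (lattice_sum 3 0 1 - 1 / 2) + 1 / 2 * (1 / ((y + 1 / y) / 2)) ^ 3"
    "lattice_sum 3 0 y \<le> p / 2 * lattice_sum 3 0 1"
proof -
  let ?D = "{(1, 1), (1, - 1), (- 1, 1), (- 1, - 1)} :: (int \<times> int) set"
  define q where "q = 1 / ((y + 1 / y) / 2)"
  have h1: "((\<lambda>r. lattice_term 0 1 r ^ 3) has_sum lattice_sum 3 0 1) lattice"
    unfolding lattice_sum_def by (rule has_sum_infsum[OF summable_lattice_term]) auto
  have P: "lattice_term 0 y r ^ 3 + lattice_term 0 y (prod.swap r) ^ 3 \<le> p * lattice_term 0 1 r ^ 3"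
    if r: "r \<in> lattice" for r
  proof -
    obtain m n where mn: "r = (m, n)" by (cases r)
    have "1 \<le> (real_of_int m)\<^sup>2 + (real_of_int n)\<^sup>2" using lattice_norm_ge_1 r mn by simp
    thus ?thesis
      using swapped_pair_upper[of "(real_of_int m)\<^sup>2" "(real_of_int n)\<^sup>2" y 3] assms(1)
      by (simp add: mn lattice_term_axis p_def)
  qed
  have "2 * lattice_sum 3 0 y \<le> p * lattice_sum 3 0 1"
    by (rule has_sum_mono[OF lattice_sum_axis_swap_has_sum has_sum_cmult_right[OF h1]]) (use assms P in auto)
  thus "lattice_sum 3 0 y \<le> p / 2 * lattice_sum 3 0 1" by simp
  have D: "?D \<subseteq> lattice" by (auto simp: lattice_def)
  from has_sum_finite_correction[OF has_sum_cmult_right[OF h1, of p] _ D, of "\<lambda>_. 2 * (q ^ 3 / 8)"]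
  have h2: "((\<lambda>r. if r \<in> ?D then 2 * (q ^ 3 / 8) else p * lattice_term 0 1 r ^ 3) has_sum
        (p * lattice_sum 3 0 1 + (\<Sum>r\<in>?D. 2 * (q ^ 3 / 8) - p * lattice_term 0 1 r ^ 3))) lattice" by simp
  have "(\<Sum>r\<in>?D. 2 * (q ^ 3 / 8) - p * lattice_term 0 1 r ^ 3) = q ^ 3 - p / 2"
    by (simp add: lattice_term_axis power_divide)
  moreover have "2 * lattice_sum 3 0 y \<le> p * lattice_sum 3 0 1 + (\<Sum>r\<in>?D. 2 * (q ^ 3 / 8) - p * lattice_term 0 1 r ^ 3)"
  proof (rule has_sum_mono[OF lattice_sum_axis_swap_has_sum h2])
    fix r assume r: "r \<in> lattice"
    have "lattice_term 0 y r ^ 3 = q ^ 3 / 8" if "r \<in> ?D" for r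
    proof -
      have "lattice_term 0 y r = q / 2" using that assms(1) by (auto simp: lattice_term_axis q_def divide_simps)
      thus ?thesis by (simp only: power_divide) simp
    qed
    from this[of r] this[of "prod.swap r"] P[OF r]
    show "lattice_term 0 y r ^ 3 + lattice_term 0 y (prod.swap r) ^ 3
       \<le> (if r \<in> ?D then 2 * (q ^ 3 / 8) else p * lattice_term 0 1 r ^ 3)" by auto
  qed (use assms in auto)
  ultimately show "lattice_sum 3 0 y \<le> p / 2 * (lattice_sum 3 0 1 - 1 / 2) + 1 / 2 * (1 / ((y + 1 / y) / 2)) ^ 3"
    unfolding q_def[symmetric] by (simp add: algebra_simps)
qed

text \<open>The midpoint bound is an equality when |m| = |n| and poor on the four unit vectors,
  which dominate for s = 6. These are evaluated exactly, and the 4 subtracted is their value at y =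
  1.\<close>

lemma lattice_sum_6_axis_ge:
  fixes y :: real
  assumes "y > 0"
  shows "2 * (y ^ 6 + (1 / y) ^ 6) + (1 / ((y + 1 / y) / 2)) ^ 6 * (lattice_sum 6 0 1 - 4) \<le> lattice_sum 6 0 y"
proof -
  let ?D = "{(1, 0), (- 1, 0), (0, 1), (0, - 1)} :: (int \<times> int) set"
  define q where "q = 1 / ((y + 1 / y) / 2)"
  have h1: "((\<lambda>r. lattice_term 0 1 r ^ 6) has_sum lattice_sum 6 0 1) lattice"
    unfolding lattice_sum_def by (rule has_sum_infsum[OF summable_lattice_term]) auto
  have P: "2 * q ^ 6 * lattice_term 0 1 r ^ 6 \<le> lattice_term 0 y r ^ 6 + lattice_term 0 y (prod.swap r) ^ 6"
    if r: "r \<in> lattice" for r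
  proof -
    obtain m n where mn: "r = (m, n)" by (cases r)
    have "1 \<le> (real_of_int m)\<^sup>2 + (real_of_int n)\<^sup>2" using lattice_norm_ge_1 r mn by simp
    thus ?thesis
      using swapped_pair_lower[of "(real_of_int m)\<^sup>2" "(real_of_int n)\<^sup>2" y 6] assms(1)
      by (simp add: mn lattice_term_axis q_def)
  qed
  have D: "?D \<subseteq> lattice" by (auto simp: lattice_def)
  from has_sum_finite_correction[OF has_sum_cmult_right[OF h1, of "2 * q ^ 6"] _ D, of "\<lambda>_. y ^ 6 + (1 / y) ^ 6"]
  have h2: "((\<lambda>r. if r \<in> ?D then y ^ 6 + (1 / y) ^ 6 else 2 * q ^ 6 * lattice_term 0 1 r ^ 6) has_sum
        (2 * q ^ 6 * lattice_sum 6 0 1 + (\<Sum>r\<in>?D. y ^ 6 + (1 / y) ^ 6 - 2 * q ^ 6 * lattice_term 0 1 r ^ 6))) lattice" by simp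
  have "(\<Sum>r\<in>?D. y ^ 6 + (1 / y) ^ 6 - 2 * q ^ 6 * lattice_term 0 1 r ^ 6) = 4 * (y ^ 6 + (1 / y) ^ 6) - 8 * q ^ 6"
    by (simp add: lattice_term_axis)
  moreover have "2 * q ^ 6 * lattice_sum 6 0 1 + (\<Sum>r\<in>?D. y ^ 6 + (1 / y) ^ 6 - 2 * q ^ 6 * lattice_term 0 1 r ^ 6) \<le> 2 * lattice_sum 6 0 y"
  proof (rule has_sum_mono[OF h2 lattice_sum_axis_swap_has_sum])
    fix r assume r: "r \<in> lattice"
    have "lattice_term 0 y r ^ 6 + lattice_term 0 y (prod.swap r) ^ 6 = y ^ 6 + (1 / y) ^ 6" if "r \<in> ?D"
      using that assms(1) by (auto simp: lattice_term_axis power_divide)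
    thus "(if r \<in> ?D then y ^ 6 + (1 / y) ^ 6 else 2 * q ^ 6 * lattice_term 0 1 r ^ 6)
       \<le> lattice_term 0 y r ^ 6 + lattice_term 0 y (prod.swap r) ^ 6" using P[OF r] by auto
  qed (use assms in auto)
  ultimately show ?thesis
    unfolding q_def[symmetric] by (simp add: algebra_simps)
qed

text \<open>Beyond the four unit vectors m^2 + n^2 \<ge> 2, so each term t is at most 1/2 and t^6
  \<le> t^3 / 8.\<close>

lemma lattice_sum_6_le_3: "lattice_sum 6 0 1 - 4 \<le> (lattice_sum 3 0 1 - 4) / 8"
proof -
  let ?D = "{(1, 0), (- 1, 0), (0, 1), (0, - 1)} :: (int \<times> int) set"
  have h: "((\<lambda>r. lattice_term 0 1 r ^ s) has_sum lattice_sum s 0 1) lattice" if "s \<ge> 2" for s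
    unfolding lattice_sum_def by (rule has_sum_infsum[OF summable_lattice_term]) (use that in auto)
  have D: "?D \<subseteq> lattice" by (auto simp: lattice_def)
  from has_sum_finite_correction[OF has_sum_cmult_right[OF h[of 3], of "1 / 8"] _ D, of "\<lambda>_. 1"]
  have h2: "((\<lambda>r. if r \<in> ?D then 1 else 1 / 8 * lattice_term 0 1 r ^ 3) has_sum
        (1 / 8 * lattice_sum 3 0 1 + (\<Sum>r\<in>?D. 1 - 1 / 8 * lattice_term 0 1 r ^ 3))) lattice" by simp
  have "(\<Sum>r\<in>?D. 1 - 1 / 8 * lattice_term 0 1 r ^ 3) = 7 / 2"
    by (simp add: lattice_term_axis)
  moreover have "lattice_sum 6 0 1 \<le> 1 / 8 * lattice_sum 3 0 1 + (\<Sum>r\<in>?D. 1 - 1 / 8 * lattice_term 0 1 r ^ 3)"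
  proof (rule has_sum_mono[OF h h2])
    fix r assume r: "r \<in> lattice"
    obtain m n where mn: "r = (m, n)" by (cases r)
    show "lattice_term 0 1 r ^ 6 \<le> (if r \<in> ?D then 1 else 1 / 8 * lattice_term 0 1 r ^ 3)"
    proof (cases "r \<in> ?D")
      case True
      thus ?thesis by (auto simp: lattice_term_axis)
    next
      case False
      have "2 \<le> m\<^sup>2 + n\<^sup>2"
      proof (rule ccontr)
        assume "\<not> 2 \<le> m\<^sup>2 + n\<^sup>2"
        hence a: "m\<^sup>2 + n\<^sup>2 \<le> 1" by simp
        have "m\<^sup>2 \<le> 1" "n\<^sup>2 \<le> 1" using a zero_le_power2[of m] zero_le_power2[of n] by linarith+
        hence "\<bar>m\<bar> \<le> 1" "\<bar>n\<bar> \<le> 1" by (simp_all add: abs_square_le_1)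
        hence "m \<in> {-1, 0, 1}" "n \<in> {-1, 0, 1}" by auto
        thus False using a r False by (auto simp: mn lattice_def)
      qed
      hence "real_of_int 2 \<le> real_of_int (m\<^sup>2 + n\<^sup>2)" by (simp only: of_int_le_iff)
      hence N: "2 \<le> (real_of_int m)\<^sup>2 + (real_of_int n)\<^sup>2" by simp
      define t where "t = lattice_term 0 1 r"
      have t: "0 \<le> t" "t \<le> 1 / 2" using N by (auto simp: t_def mn lattice_term_axis field_simps)
      have "t ^ 6 = t ^ 3 * t ^ 3" by algebra
      also have "\<dots> \<le> (1 / 2) ^ 3 * t ^ 3" using t by (intro mult_right_mono power_mono) auto
      finally show ?thesis using False by (simp add: t_def[symmetric] power_divide)
    qed
  qed auto
  ultimately show ?thesis by simp
qed

text \<open>An explicit sum over the box of radius 3 plus a shell estimate: the shell of radius R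
  has 8 R points of squared norm at least R^2 and contributes at most 8 / R^5.\<close>

lemma lattice_sum_3_square_le: "lattice_sum 3 0 1 \<le> 468 / 100"
proof -
  define w where "w p = lattice_term 0 1 p ^ 3" for p
  \<comment> \<open>The boxes contain the origin, where \<open>w\<close> is 0 by the convention 1/0
    = 0.\<close>
  define box where "box R = {- int R..int R} \<times> {- int R..int R}" for R
  have w: "w (m, n) = (1 / ((real_of_int m)\<^sup>2 + (real_of_int n)\<^sup>2)) ^ 3" for m n
    by (simp add: w_def lattice_term_axis)
  have w0: "w p \<ge> 0" for p by (simp add: w_def lattice_term_nonneg)
  have fin: "finite (box R)" for R by (simp add: box_def)
  have mono: "box R \<subseteq> box (Suc R)" for R by (auto simp: box_def)
  have step: "sum w (box (Suc R)) \<le> sum w (box R) + 8 / (real (Suc R)) ^ 5" for R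
  proof -
    have "sum w (box (Suc R)) = sum w (box R) + sum w (box (Suc R) - box R)"
      using sum.subset_diff[OF mono fin, of w R] by simp
    also have "sum w (box (Suc R) - box R) \<le> of_nat (card (box (Suc R) - box R)) * (1 / (real (Suc R))\<^sup>2) ^ 3"
    proof (rule sum_bounded_above)
      fix p assume p: "p \<in> box (Suc R) - box R"
      obtain m n where mn: "p = (m, n)" by (cases p)
      have "int (Suc R) \<le> \<bar>m\<bar> \<or> int (Suc R) \<le> \<bar>n\<bar>" using p by (auto simp: box_def mn)
      hence "(int (Suc R))\<^sup>2 \<le> m\<^sup>2 + n\<^sup>2"
      proof
        assume "int (Suc R) \<le> \<bar>m\<bar>"
        hence "(int (Suc R))\<^sup>2 \<le> \<bar>m\<bar>\<^sup>2" by (intro power_mono) auto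
        thus ?thesis by (simp add: add_increasing2)
      next
        assume "int (Suc R) \<le> \<bar>n\<bar>"
        hence "(int (Suc R))\<^sup>2 \<le> \<bar>n\<bar>\<^sup>2" by (intro power_mono) auto
        thus ?thesis by (simp add: add_increasing)
      qed
      hence "real_of_int ((int (Suc R))\<^sup>2) \<le> real_of_int (m\<^sup>2 + n\<^sup>2)" by (simp only: of_int_le_iff)
      hence "(real (Suc R))\<^sup>2 \<le> (real_of_int m)\<^sup>2 + (real_of_int n)\<^sup>2" by simp
      thus "w p \<le> (1 / (real (Suc R))\<^sup>2) ^ 3"
        unfolding mn w by (intro power_mono frac_le) auto
    qed
    also have "card (box (Suc R) - box R) = 8 * Suc R"
    proof -
      have "card (box (Suc R) - box R) = card (box (Suc R)) - card (box R)"
        by (rule card_Diff_subset[OF fin mono])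
      thus ?thesis by (simp add: box_def card_cartesian_product nat_add_distrib algebra_simps)
    qed
    also have "of_nat (8 * Suc R) * (1 / (real (Suc R))\<^sup>2) ^ 3 = 8 / (real (Suc R)) ^ 5"
    proof -
      have "8 * t * (1 / t\<^sup>2) ^ 3 = 8 / t ^ 5" if "t > 0" for t :: real
        using that by (simp add: power_divide field_simps eval_nat_numeral)
      from this[of "real (Suc R)"] show ?thesis by simp
    qed
    finally show ?thesis by simp
  qed
  \<comment> \<open>The reserve 2 / R^4 decreases by at least the bound for the next shell. At the
    start 4.653 + 2/81 \<le> 4.68.\<close>
  have S: "sum w (box R) \<le> 468 / 100 - 2 / (real R) ^ 4" if "R \<ge> 3" for R
    using that
  proof (induction R rule: dec_induct)
    case base
    have i: "{- 3..3} = {- 3, - 2, - 1, 0, 1, 2, 3 :: int}" by auto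
    have "sum w (box 3) = (\<Sum>m\<in>{- 3..3}. \<Sum>n\<in>{- 3..3}. w (m, n))"
      by (simp add: box_def sum.cartesian_product)
    also have "\<dots> \<le> 4653 / 1000" unfolding i w by (simp add: power_divide)
    finally show ?case by simp
  next
    case (step R)
    define t where "t = real R"
    have t: "t \<ge> 3" using step by (simp add: t_def)
    have "8 / (t + 1) ^ 5 \<le> 2 / t ^ 4 - 2 / (t + 1) ^ 4"
    proof -
      have "4 * t ^ 4 + t ^ 4 * (t + 1) \<le> (t + 1) ^ 5"
      proof -
        have "(t + 1) ^ 5 = 4 * t ^ 4 + t ^ 4 * (t + 1) + (10 * t ^ 3 + 10 * t ^ 2 + 5 * t + 1)" by algebra
        thus ?thesis using t by simp
      qed
      thus ?thesis using t by (simp add: divide_simps) (simp add: algebra_simps eval_nat_numeral)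
    qed
    moreover have "sum w (box (Suc R)) \<le> sum w (box R) + 8 / (t + 1) ^ 5"
      using \<open>\<And>R. sum w (box (Suc R)) \<le> _\<close>[of R] by (simp add: t_def add.commute)
    ultimately show ?case using step.IH by (simp add: t_def add.commute)
  qed
  show ?thesis unfolding lattice_sum_def
  proof (rule infsum_le_finite_sums)
    show "(\<lambda>p. lattice_term 0 1 p ^ 3) summable_on lattice" by (rule summable_lattice_term) auto
    fix F assume F: "finite F" "F \<subseteq> lattice"
    define R where "R = 3 + (\<Sum>p\<in>F. nat \<bar>fst p\<bar> + nat \<bar>snd p\<bar>)"
    have "F \<subseteq> box R"
    proof
      fix p assume p: "p \<in> F"
      have "nat \<bar>fst p\<bar> + nat \<bar>snd p\<bar> \<le> (\<Sum>p\<in>F. nat \<bar>fst p\<bar> + nat \<bar>snd p\<bar>)"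
        by (rule member_le_sum[OF p]) (use F in auto)
      hence "\<bar>fst p\<bar> \<le> int R" "\<bar>snd p\<bar> \<le> int R" unfolding R_def by linarith+
      thus "p \<in> box R" by (cases p) (auto simp: box_def)
    qed
    hence "sum w F \<le> sum w (box R)" using w0 fin by (intro sum_mono2) auto
    also have "\<dots> \<le> 468 / 100 - 2 / (real R) ^ 4" by (rule S) (simp add: R_def)
    also have "\<dots> \<le> 468 / 100" by simp
    finally show "(\<Sum>p\<in>F. lattice_term 0 1 p ^ 3) \<le> 468 / 100" by (simp add: w_def)
  qed
qed

section \<open>Reduction to the fundamental domain\<close>

text \<open>This relation leaves every lattice sum invariant, and also the discrete set of values of
  \<open>lattice_term x y\<close>, which contains the height \<open>y\<close>; so an equivalent point of maximal height
  exists, without any reference to the modular group.\<close>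

definition lattice_equiv :: "real \<Rightarrow> real \<Rightarrow> real \<Rightarrow> real \<Rightarrow> bool" where
  "lattice_equiv x y x' y' \<longleftrightarrow>
     (\<exists>h. bij_betw h lattice lattice \<and> (\<forall>p\<in>lattice. lattice_term x' y' p = lattice_term x y (h p)))"

lemma lattice_equiv_refl: "lattice_equiv x y x y"
  unfolding lattice_equiv_def by (intro exI[of _ id]) auto

lemma lattice_equiv_trans:
  assumes "lattice_equiv x y x' y'" "lattice_equiv x' y' x'' y''"
  shows "lattice_equiv x y x'' y''"
proof -
  obtain h where h: "bij_betw h lattice lattice" "\<And>p. p \<in> lattice \<Longrightarrow> lattice_term x' y' p = lattice_term x y (h p)"
    using assms(1) by (auto simp: lattice_equiv_def)
  obtain k where k: "bij_betw k lattice lattice" "\<And>p. p \<in> lattice \<Longrightarrow> lattice_term x'' y'' p = lattice_term x' y' (k p)"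
    using assms(2) by (auto simp: lattice_equiv_def)
  have "lattice_term x'' y'' p = lattice_term x y ((h \<circ> k) p)" if "p \<in> lattice" for p
    using h(2) k(2)[OF that] bij_betwE[OF k(1)] that by simp
  thus ?thesis unfolding lattice_equiv_def using bij_betw_trans[OF k(1) h(1)] by blast
qed

lemma lattice_equiv_translate: "lattice_equiv x y (x + of_int k) y"
proof -
  have "bij_betw (\<lambda>(m, n). (m, n + k * m)) lattice lattice"
    by (rule bij_betw_byWitness[where f' = "\<lambda>(m, n). (m, n - k * m)"]) (auto simp: lattice_def)
  moreover have "lattice_term (x + of_int k) y p = lattice_term x y ((\<lambda>(m, n). (m, n + k * m)) p)" for p
    by (cases p) (simp add: lattice_term_def algebra_simps)
  ultimately show ?thesis unfolding lattice_equiv_def by blast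
qed

lemma lattice_equiv_reflect: "lattice_equiv x y (- x) y"
proof -
  have "bij_betw (\<lambda>(m, n). (- m, n)) lattice lattice"
    by (rule bij_betw_byWitness[where f' = "\<lambda>(m, n). (- m, n)"]) (auto simp: lattice_def)
  moreover have "lattice_term (- x) y p = lattice_term x y ((\<lambda>(m, n). (- m, n)) p)" for p
    by (cases p) (simp add: lattice_term_def)
  ultimately show ?thesis unfolding lattice_equiv_def by blast
qed

text \<open>This is z -> -1/z: m (-1/z) + n = (n z - m) / z, and the factor |z|^2 is absorbed by the
  new height.\<close>

lemma lattice_equiv_invert:
  assumes "y > 0"
  shows "lattice_equiv x y (- x / (x\<^sup>2 + y\<^sup>2)) (y / (x\<^sup>2 + y\<^sup>2))"
proof -
  define D where "D = x\<^sup>2 + y\<^sup>2"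
  have D: "D > 0" using assms by (simp add: D_def add_nonneg_pos)
  have "bij_betw (\<lambda>(m, n). (n, - m)) lattice lattice"
    by (rule bij_betw_byWitness[where f' = "\<lambda>(m, n). (- n, m)"]) (auto simp: lattice_def)
  moreover have "lattice_term (- x / D) (y / D) p = lattice_term x y ((\<lambda>(m, n). (n, - m)) p)" for p
  proof -
    obtain m n where mn: "p = (m, n)" by (cases p)
    have "D * ((m * (- x / D) + n)\<^sup>2 + (m * (y / D))\<^sup>2) = ((n * x + - m)\<^sup>2 + (n * y)\<^sup>2)"
    proof -
      have "D * ((m * (- x / D) + n)\<^sup>2 + (m * (y / D))\<^sup>2) = ((n * D - m * x)\<^sup>2 + (m * y)\<^sup>2) / D"
        using D by (simp add: field_simps power2_eq_square)
      also have "(n * D - m * x)\<^sup>2 + (m * y)\<^sup>2 = D * ((n * x + - m)\<^sup>2 + (n * y)\<^sup>2)"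
        unfolding D_def of_int_minus by algebra
      finally show ?thesis using D by simp
    qed
    moreover have "y / D / Q = y / (D * Q)" for Q by simp
    ultimately show ?thesis by (simp add: mn lattice_term_def)
  qed
  ultimately show ?thesis unfolding lattice_equiv_def D_def by blast
qed

lemma lattice_equiv_sum:
  assumes "lattice_equiv x y x' y'"
  shows "lattice_sum s x' y' = lattice_sum s x y"
proof -
  obtain h where h: "bij_betw h lattice lattice" "\<And>p. p \<in> lattice \<Longrightarrow> lattice_term x' y' p = lattice_term x y (h p)"
    using assms by (auto simp: lattice_equiv_def)
  have "lattice_sum s x' y' = infsum (\<lambda>p. lattice_term x y (h p) ^ s) lattice"
    unfolding lattice_sum_def by (rule infsum_cong) (simp add: h)
  also have "\<dots> = lattice_sum s x y"
    unfolding lattice_sum_def by (rule infsum_reindex_bij_betw[OF h(1)])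
  finally show ?thesis .
qed

text \<open>A term of size at least y means 0 < |m z + n|^2 \<le> 1, which leaves finitely many
  vectors.\<close>

lemma finite_large_lattice_terms:
  assumes "y > 0"
  shows "finite {p \<in> lattice. y \<le> lattice_term x y p}"
proof -
  obtain C where C: "C > 0" "\<And>m n :: real. m\<^sup>2 + n\<^sup>2 \<le> C * ((m * x + n)\<^sup>2 + (m * y)\<^sup>2)"
    using lattice_form_lower_bound[OF assms] by blast
  define B where "B = \<lceil>C\<rceil>"
  have "{p \<in> lattice. y \<le> lattice_term x y p} \<subseteq> {- B..B} \<times> {- B..B}"
  proof
    fix p assume p: "p \<in> {p \<in> lattice. y \<le> lattice_term x y p}"
    obtain m n where mn: "p = (m, n)" by (cases p)
    define Q where "Q = (m * x + n)\<^sup>2 + (m * y)\<^sup>2"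
    have le: "y \<le> y / Q" using p by (simp add: mn lattice_term_def Q_def)
    have "Q \<ge> 0" by (simp add: Q_def)
    have "Q \<noteq> 0" using le assms by auto
    hence "Q \<le> 1" using le assms \<open>Q \<ge> 0\<close> by (simp add: field_simps)
    hence "(real_of_int m)\<^sup>2 + (real_of_int n)\<^sup>2 \<le> C"
      using C(2)[of m n] C(1) mult_left_mono[of Q 1 C] unfolding Q_def by linarith
    hence "real_of_int (m\<^sup>2 + n\<^sup>2) \<le> C" by simp
    hence "m\<^sup>2 + n\<^sup>2 \<le> B" unfolding B_def by linarith
    moreover have "\<bar>k\<bar> \<le> k\<^sup>2" for k :: int
    proof (cases "k = 0")
      case False
      hence "\<bar>k\<bar> * 1 \<le> \<bar>k\<bar> * \<bar>k\<bar>" by (intro mult_left_mono) auto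
      thus ?thesis by (simp add: power2_eq_square)
    qed simp
    ultimately have "\<bar>m\<bar> \<le> B" "\<bar>n\<bar> \<le> B"
      using zero_le_power2[of m] zero_le_power2[of n] by (smt (verit))+
    thus "p \<in> {- B..B} \<times> {- B..B}" by (auto simp: mn)
  qed
  thus ?thesis by (rule finite_subset) simp
qed

lemma lattice_reduction:
  assumes "y > 0"
  obtains x' y' where "y' > 0" "lattice_equiv x y x' y'" "0 \<le> x'" "x' \<le> 1 / 2" "1 \<le> x'\<^sup>2 + y'\<^sup>2"
proof -
  define A where "A = {y'. y \<le> y' \<and> (\<exists>x'. lattice_equiv x y x' y')}"
  \<comment> \<open>The height y' of a point is its own lattice term at (0, 1), hence a lattice term
    of the original point.\<close>
  have "A \<subseteq> lattice_term x y ` {p \<in> lattice. y \<le> lattice_term x y p}"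
  proof
    fix y' assume y': "y' \<in> A"
    then obtain x' where "lattice_equiv x y x' y'" by (auto simp: A_def)
    then obtain h where h: "bij_betw h lattice lattice" "\<And>p. p \<in> lattice \<Longrightarrow> lattice_term x' y' p = lattice_term x y (h p)"
      by (auto simp: lattice_equiv_def)
    have l: "(0, 1) \<in> lattice" by (simp add: lattice_def)
    have "y' = lattice_term x y (h (0, 1))" using h(2)[OF l] by (simp add: lattice_term_def)
    moreover have "h (0, 1) \<in> lattice" using bij_betwE[OF h(1)] l by blast
    ultimately show "y' \<in> lattice_term x y ` {p \<in> lattice. y \<le> lattice_term x y p}"
      using y' by (auto simp: A_def)
  qed
  hence finA: "finite A" using finite_large_lattice_terms[OF assms] by (meson finite_imageI finite_subset)
  have yA: "y \<in> A" using lattice_equiv_refl by (auto simp: A_def)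
  define Y where "Y = Max A"
  have "Y \<in> A" unfolding Y_def using finA yA by (intro Max_in) auto
  then obtain X where X: "lattice_equiv x y X Y" "y \<le> Y" by (auto simp: A_def)
  have Ymax: "y' \<le> Y" if "lattice_equiv x y x' y'" for x' y'
    using Max_ge[OF finA, of y'] that X(2) by (cases "y \<le> y'") (auto simp: A_def Y_def)
  have Y0: "Y > 0" using X assms by simp
  define X' where "X' = X + of_int (- round X)"
  have X': "\<bar>X'\<bar> \<le> 1 / 2"
    using of_int_round_abs_le[of X] by (simp add: X'_def abs_minus_commute)
  have eX': "lattice_equiv x y X' Y"
    unfolding X'_def by (rule lattice_equiv_trans[OF X(1) lattice_equiv_translate])
  \<comment> \<open>Inside the unit circle the inversion would raise the height above its
    maximum.\<close>
  have n: "1 \<le> X'\<^sup>2 + Y\<^sup>2"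
  proof (rule ccontr)
    assume "\<not> 1 \<le> X'\<^sup>2 + Y\<^sup>2"
    moreover have "0 < X'\<^sup>2 + Y\<^sup>2" using Y0 by (simp add: add_nonneg_pos)
    ultimately have "Y < Y / (X'\<^sup>2 + Y\<^sup>2)"
      using Y0 mult_strict_left_mono[of "X'\<^sup>2 + Y\<^sup>2" 1 Y] by (simp add: pos_less_divide_eq)
    moreover have "Y / (X'\<^sup>2 + Y\<^sup>2) \<le> Y"
      by (rule Ymax[OF lattice_equiv_trans[OF eX' lattice_equiv_invert[OF Y0]]])
    ultimately show False by simp
  qed
  show thesis
  proof (cases "X' \<ge> 0")
    case True
    thus ?thesis using that[OF Y0 eX'] X' n by simp
  next
    case False
    thus ?thesis using that[OF Y0 lattice_equiv_trans[OF eX' lattice_equiv_reflect]] X' n by simp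
  qed
qed

section \<open>Comparison with the imaginary axis\<close>

text \<open>The left factor 2 sin^2(pi x) is bounded by the cubic Taylor polynomial of sin, with 1 -
  (pi/2)^2 / 6 > 0.588 and 2 * (3 * 0.588)^2 > 6.\<close>

lemma one_minus_cos_ge:
  fixes x :: real
  assumes "\<bar>x\<bar> \<le> 1 / 2"
  shows "6 * x\<^sup>2 \<le> 1 - cos (2 * pi * x)"
proof -
  define t where "t = pi * \<bar>x\<bar>"
  have t: "0 \<le> t" "t \<le> 15708 / 10000"
    using assms pi_power_bounds(2) mult_mono[of pi "31416 / 10000" "\<bar>x\<bar>" "1 / 2"] by (auto simp: t_def)
  have s: "t - t ^ 3 / 6 \<le> sin t"
  proof -
    obtain u where u: "sin t = (\<Sum>m<3. sin_coeff m * t ^ m) + sin (u + 1/2 * real 3 * pi) / fact 3 * t ^ 3"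
      using Maclaurin_sin_expansion[of t 3] by auto
    have "sin (u + 1/2 * real 3 * pi) / fact 3 * t ^ 3 \<ge> (- 1) / fact 3 * t ^ 3"
      using t by (intro mult_right_mono divide_right_mono) auto
    thus ?thesis unfolding u by (simp add: eval_nat_numeral sin_coeff_def)
  qed
  have "t ^ 3 \<le> (15708 / 10000)\<^sup>2 * t"
    using t mult_right_mono[OF power_mono[OF t(2) t(1), of 2] t(1)] by (simp add: eval_nat_numeral)
  hence "588 / 1000 * t \<le> sin t" using s t by (simp add: power_divide)
  moreover have "588 / 1000 * t \<ge> 588 / 1000 * (3 * \<bar>x\<bar>)"
    unfolding t_def using pi_power_bounds(1) by (intro mult_left_mono mult_right_mono) auto
  ultimately have "1764 / 1000 * \<bar>x\<bar> \<le> sin t" by linarith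
  hence "(1764 / 1000 * \<bar>x\<bar>)\<^sup>2 \<le> (sin t)\<^sup>2" by (intro power_mono) auto
  moreover have "(sin t)\<^sup>2 = (sin (pi * x))\<^sup>2" by (cases "x \<ge> 0") (auto simp: t_def)
  moreover have "1 - cos (2 * pi * x) = 2 * (sin (pi * x))\<^sup>2"
    using cos_double_sin[of "pi * x"] by (simp add: mult.assoc)
  ultimately show ?thesis by (simp add: power_mult_distrib power_divide, use zero_le_power2[of x] in linarith)
qed

text \<open>Moving from i down to i y raises the sum by O(d^2), while outside the unit circle x^2
  \<ge> 1 - y^2 is at least of order d, so the drop of the horizontal move is linear in d and
  wins.\<close>

lemma lattice_sum_3_le_square:
  fixes x y :: real
  assumes y: "866 / 1000 \<le> y" "y \<le> 1" and x: "\<bar>x\<bar> \<le> 1 / 2" "1 \<le> x\<^sup>2 + y\<^sup>2"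
  shows "lattice_sum 3 x y \<le> lattice_sum 3 0 1"
proof -
  define d where "d = 1 - y"
  define v where "v = inverse y"
  define p where "p = y ^ 3 + (1 / y) ^ 3"
  define E where "E = exp (- 2 * pi * y)"
  have y0: "y > 0" using y by simp
  have d: "0 \<le> d" "d \<le> 134 / 1000" using y by (auto simp: d_def)
  have yd: "y = 1 - d" by (simp add: d_def)
  have vy: "v * (1 - d) = 1" using y by (simp add: v_def d_def)
  have v1: "1 \<le> v" "v \<le> 11548 / 10000" using y by (auto simp: v_def field_simps)
  have pv: "p = (1 - d) ^ 3 + v ^ 3" by (simp add: p_def v_def yd inverse_eq_divide)
  have pe: "p - 2 = d ^ 2 * ((3 + d ^ 2 * v) ^ 2 * v)"
    unfolding pv using vy by algebra
  have "d ^ 2 * v \<le> (134 / 1000) ^ 2 * (11548 / 10000)"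
    using d v1 by (intro mult_mono power_mono) auto
  hence "(3 + d ^ 2 * v) ^ 2 * v \<le> (3 + 21 / 1000) ^ 2 * (11548 / 10000)"
    using v1 by (intro mult_mono power_mono) (auto simp: power_divide)
  also have "\<dots> \<le> 11" by (simp add: power2_eq_square)
  finally have "d ^ 2 * ((3 + d ^ 2 * v) ^ 2 * v) \<le> d ^ 2 * 11" by (intro mult_left_mono) auto
  hence p: "p - 2 \<le> 11 * d ^ 2" using pe by simp
  have p2: "0 \<le> p - 2" unfolding pe using v1 by simp
  have up: "lattice_sum 3 0 y - lattice_sum 3 0 1 \<le> 26 * d ^ 2"
  proof -
    have "lattice_sum 3 0 y - lattice_sum 3 0 1 \<le> (p - 2) / 2 * lattice_sum 3 0 1"
      using lattice_sum_3_axis_le(2)[OF y0, folded p_def] by (simp add: field_simps)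
    also have "\<dots> \<le> (p - 2) / 2 * (468 / 100)"
      using p2 lattice_sum_3_square_le by (intro mult_left_mono) auto
    also have "\<dots> = 234 / 100 * (p - 2)" by simp
    also have "\<dots> \<le> 234 / 100 * (11 * d ^ 2)" using p by (intro mult_left_mono) auto
    also have "\<dots> \<le> 26 * d ^ 2" by simp
    finally show ?thesis .
  qed
  have c: "48 \<le> coeff3 (inverse y) 1"
  proof -
    have "48 \<le> pi ^ 3 + 3 / 2 * pi ^ 2 * 1 + 3 / 4 * pi * 1" using pi_power_bounds by simp
    also have "\<dots> \<le> pi ^ 3 + 3 / 2 * pi ^ 2 * v + 3 / 4 * pi * v ^ 2"
      using v1 one_le_power[of v 2] by (intro add_mono mult_left_mono) auto
    finally show ?thesis by (simp add: coeff3_def v_def)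
  qed
  have E: "18 / 10000 * (1 + 628 / 100 * d) \<le> E"
    unfolding E_def yd by (rule exp_minus_2pi_mult_ge[OF d(1)])
  have low: "48 * (18 / 10000 * (1 + 628 / 100 * d)) * (6 * x\<^sup>2) \<le> y ^ 3 * (row_sum 3 0 y - row_sum 3 u y)"
    if u: "u = x \<or> u = - x" for u
  proof -
    define r where "r = 1 - cos (2 * pi * u)"
    have r: "6 * x\<^sup>2 \<le> r" "0 \<le> r" "r \<le> 2"
      using one_minus_cos_ge[of u] x u cos_ge_minus_one[of "2 * pi * u"] by (auto simp: r_def)
    have "48 * (18 / 10000 * (1 + 628 / 100 * d)) * (6 * x\<^sup>2) \<le> coeff3 (inverse y) 1 * E * r"
      using c E r d by (intro mult_mono) (auto simp: E_def)
    also have "\<dots> \<le> coeff3 (inverse y) 1 * E * r + coeff3 (inverse y) 2 * E ^ 2 * (r * (4 - 2 * r))"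
      using r y0 by (intro add_increasing2 order.refl mult_nonneg_nonneg coeff3_nonneg) auto
    also have "\<dots> \<le> y ^ 3 * (row_sum 3 0 y - row_sum 3 u y)"
      unfolding r_def E_def by (rule row_sum_3_diff_ge[OF y0])
    finally show ?thesis .
  qed
  have "26 * d ^ 2 \<le> 2 * (48 * (18 / 10000 * (1 + 628 / 100 * d)) * (6 * x\<^sup>2))"
  proof -
    have "(1 - y) * (1 + y) \<le> x\<^sup>2" using x by (simp add: power2_eq_square algebra_simps)
    moreover have "d * (1866 / 1000) \<le> (1 - y) * (1 + y)"
      using y d by (intro mult_mono) (auto simp: d_def)
    ultimately have x2: "d * (1866 / 1000) \<le> x\<^sup>2" by simp
    have "26 * d \<le> 2 * (48 * (18 / 10000 * (1 + 628 / 100 * d)) * (6 * (1866 / 1000)))" using d by simp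
    hence "d * (26 * d) \<le> d * (2 * (48 * (18 / 10000 * (1 + 628 / 100 * d)) * (6 * (1866 / 1000))))"
      using d by (intro mult_left_mono) auto
    also have "\<dots> = 2 * (48 * (18 / 10000 * (1 + 628 / 100 * d)) * (6 * (d * (1866 / 1000))))" by simp
    also have "\<dots> \<le> 2 * (48 * (18 / 10000 * (1 + 628 / 100 * d)) * (6 * x\<^sup>2))"
      using x2 d by (intro mult_left_mono) auto
    finally show ?thesis by (simp add: power2_eq_square)
  qed
  also have "\<dots> \<le> lattice_sum 3 0 y - lattice_sum 3 x y"
    using low[of x] low[of "- x"] lattice_sum_diff_rows_pm1[OF y0, of x] by simp
  finally show ?thesis using up by simp
qed

lemma lattice_energy_ge_square:
  fixes x y b :: real
  assumes y: "866 / 1000 \<le> y" "y \<le> 1" and x: "\<bar>x\<bar> \<le> 1 / 2" "1 \<le> x\<^sup>2 + y\<^sup>2" and b: "b \<ge> 3062 / 1000"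
  shows "lattice_sum 6 0 1 - b * lattice_sum 3 0 1 \<le> lattice_sum 6 x y - b * lattice_sum 3 x y"
proof -
  have y0: "y > 0" using y by simp
  define p where "p = y ^ 3 + (1 / y) ^ 3"
  define q where "q = 1 / ((y + 1 / y) / 2)"
  define S where "S = lattice_sum 3 0 1"
  define c :: real where "c = 3062 / 1000"
  have q: "0 \<le> q" "q \<le> 1"
  proof -
    have "0 \<le> (y - 1) ^ 2" by simp
    hence "2 * y \<le> y * y + 1" by (simp add: power2_eq_square algebra_simps)
    thus "0 \<le> q" "q \<le> 1" using y0 by (auto simp: q_def field_simps)
  qed
  have p2: "2 \<le> p"
  proof -
    define u where "u = y ^ 3"
    have u: "u > 0" using y0 by (simp add: u_def)
    have "0 \<le> (u - 1) ^ 2" by simp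
    hence "2 * u \<le> u * u + 1" by (simp add: power2_eq_square algebra_simps)
    hence "2 \<le> u + 1 / u" using u by (simp add: field_simps)
    thus ?thesis by (simp add: p_def u_def power_divide)
  qed
  have pp: "y ^ 6 + (1 / y) ^ 6 = p ^ 2 - 2"
  proof -
    have "y * (1 / y) = 1" using y0 by simp
    thus ?thesis unfolding p_def by algebra
  qed
  have S: "S \<le> 468 / 100" unfolding S_def by (rule lattice_sum_3_square_le)
  have A6: "2 * (p ^ 2 - 4) - (1 - q ^ 6) * (85 / 1000) \<le> lattice_sum 6 0 y - lattice_sum 6 0 1"
  proof -
    \<comment> \<open>85/1000 = (4.68 - 4) / 8.\<close>
    have "lattice_sum 6 0 1 - 4 \<le> 85 / 1000" using lattice_sum_6_le_3 S by (simp add: S_def)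
    hence "(1 - q ^ 6) * (lattice_sum 6 0 1 - 4) \<le> (1 - q ^ 6) * (85 / 1000)"
      using q by (intro mult_left_mono) (auto simp: power_le_one)
    thus ?thesis using lattice_sum_6_axis_ge[OF y0] unfolding q_def[symmetric] pp
      by (simp add: algebra_simps diff_divide_distrib)
  qed
  have A3: "lattice_sum 3 0 y - lattice_sum 3 0 1 \<le> (p / 2 - 1) * (418 / 100) - 1 / 2 * (1 - q ^ 3)"
  proof -
    have "(p / 2 - 1) * (S - 1 / 2) \<le> (p / 2 - 1) * (418 / 100)" using p2 S by (intro mult_left_mono) auto
    moreover have "lattice_sum 3 0 y \<le> p / 2 * (S - 1 / 2) + 1 / 2 * q ^ 3"
      unfolding p_def q_def S_def by (rule lattice_sum_3_axis_le(1)[OF y0])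
    moreover have "p / 2 * (S - 1 / 2) + 1 / 2 * q ^ 3 - S = (p / 2 - 1) * (S - 1 / 2) - 1 / 2 * (1 - q ^ 3)"
      by algebra
    ultimately show ?thesis unfolding S_def by linarith
  qed
  have "(lattice_sum 6 0 y - lattice_sum 6 x y) - c * (lattice_sum 3 0 y - lattice_sum 3 x y)
     \<le> 2 * (p ^ 2 - 4) - (1 - q ^ 6) * (85 / 1000) - c * ((p / 2 - 1) * (418 / 100) - 1 / 2 * (1 - q ^ 3))"
    using order_trans[OF lattice_sum_diff_le_1[OF y, of x] axis_gain_lower_bound[OF y]]
    unfolding p_def q_def c_def by (simp add: inverse_eq_divide)
  moreover have "c * (lattice_sum 3 0 y - lattice_sum 3 0 1) \<le> c * ((p / 2 - 1) * (418 / 100) - 1 / 2 * (1 - q ^ 3))"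
    using A3 by (intro mult_left_mono) (auto simp: c_def)
  ultimately have "lattice_sum 6 0 1 - c * lattice_sum 3 0 1 \<le> lattice_sum 6 x y - c * lattice_sum 3 x y"
    using A6 by (simp add: algebra_simps)
  \<comment> \<open>The energy is affine in b, so the excess b - c only meets the sums with s =
    3.\<close>
  moreover have "(b - c) * lattice_sum 3 x y \<le> (b - c) * lattice_sum 3 0 1"
    using b lattice_sum_3_le_square[OF y x] by (intro mult_left_mono) (auto simp: c_def)
  ultimately show ?thesis by (simp add: algebra_simps)
qed

lemma lattice_energy_ge_axis:
  fixes x y b :: real
  assumes "y \<ge> 1" "b \<ge> 3"
  shows "lattice_sum 6 0 y - b * lattice_sum 3 0 y \<le> lattice_sum 6 x y - b * lattice_sum 3 x y"
proof -
  have "3 * (lattice_sum 3 0 y - lattice_sum 3 x y) \<le> b * (lattice_sum 3 0 y - lattice_sum 3 x y)"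
    using assms lattice_sum_diff_nonneg[of y x] by (intro mult_right_mono) auto
  thus ?thesis using lattice_sum_diff_compare[OF assms(1), of x] by (simp add: algebra_simps)
qed

section \<open>Existence of the minimum on the axis\<close>

lemma continuous_on_lattice_sum_axis:
  assumes "s \<ge> 2"
  shows "continuous_on {1..Y} (lattice_sum s 0)"
proof -
  have "uniform_limit {1..Y} (\<lambda>X y. \<Sum>p\<in>X. lattice_term 0 y p ^ s)
          (\<lambda>y. \<Sum>\<^sub>\<infinity>p\<in>lattice. lattice_term 0 y p ^ s) (finite_subsets_at_top lattice)"
  proof (rule Weierstrass_m_test_general)
    show "(\<lambda>p. Y ^ s * (case p of (m, n) \<Rightarrow> (1 / ((real_of_int m)\<^sup>2 + (real_of_int n)\<^sup>2)) ^ s)) summable_on lattice"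
      by (intro summable_on_cmult_right summable_inverse_lattice_norm assms)
    fix p y assume p: "p \<in> lattice" and y: "y \<in> {1..Y}"
    obtain m n where mn: "p = (m, n)" by (cases p)
    have N: "1 \<le> (real_of_int m)\<^sup>2 + (real_of_int n)\<^sup>2" using lattice_norm_ge_1 p mn by simp
    \<comment> \<open>For 1 \<le> y \<le> Y the denominator is smallest at y = 1 and the numerator
      largest at Y, which gives a majorant uniform in y.\<close>
    have "(real_of_int m)\<^sup>2 * 1 \<le> (real_of_int m)\<^sup>2 * y\<^sup>2"
      using y by (intro mult_left_mono one_le_power) auto
    hence "lattice_term 0 y p \<le> Y * (1 / ((real_of_int m)\<^sup>2 + (real_of_int n)\<^sup>2))"
      using N y unfolding mn lattice_term_def prod.case mult_1_right times_divide_eq_right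
      by (intro frac_le) (auto simp: power_mult_distrib)
    hence "lattice_term 0 y p ^ s \<le> (Y * (1 / ((real_of_int m)\<^sup>2 + (real_of_int n)\<^sup>2))) ^ s"
      using y by (intro power_mono lattice_term_nonneg) auto
    thus "norm (lattice_term 0 y p ^ s) \<le> Y ^ s * (case p of (m, n) \<Rightarrow> (1 / ((real_of_int m)\<^sup>2 + (real_of_int n)\<^sup>2)) ^ s)"
      using y lattice_term_nonneg[of y 0 p] by (simp only: mn power_mult_distrib prod.case) simp
  qed
  moreover have "continuous_on {1..Y} (\<lambda>y. lattice_term 0 y p ^ s)" if "p \<in> lattice" for p
  proof -
    obtain m n where mn: "p = (m, n)" by (cases p)
    have "(n :: real)\<^sup>2 + (m * y)\<^sup>2 \<noteq> 0" if "y \<in> {1..Y}" for y :: real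
      using that \<open>p \<in> lattice\<close> by (auto simp: mn lattice_def sum_power2_eq_zero_iff)
    thus ?thesis unfolding mn lattice_term_def prod.case by (intro continuous_intros) auto
  qed
  hence "eventually (\<lambda>X. continuous_on {1..Y} (\<lambda>y. \<Sum>p\<in>X. lattice_term 0 y p ^ s)) (finite_subsets_at_top lattice)"
    by (intro eventually_finite_subsets_at_top_weakI continuous_on_sum) auto
  ultimately have "continuous_on {1..Y} (\<lambda>y. \<Sum>\<^sub>\<infinity>p\<in>lattice. lattice_term 0 y p ^ s)"
    by (intro uniform_limit_theorem[rotated]) auto
  thus ?thesis by (simp add: lattice_sum_def[abs_def])
qed

text \<open>The vectors (0, 1) and (0, -1) alone give growth 2 y^6 for s = 6, while s = 3 grows at
  most like y^3; so only a compact interval matters.\<close>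

lemma lattice_energy_axis_min:
  fixes b :: real
  assumes "b \<ge> 0"
  obtains y0 where "y0 \<ge> 1"
    "\<And>y. y \<ge> 1 \<Longrightarrow> lattice_sum 6 0 y0 - b * lattice_sum 3 0 y0 \<le> lattice_sum 6 0 y - b * lattice_sum 3 0 y"
proof -
  define f where "f y = lattice_sum 6 0 y - b * lattice_sum 3 0 y" for y
  define S where "S = lattice_sum 3 0 1"
  have S0: "S \<ge> 0"
    unfolding S_def lattice_sum_def by (intro infsum_nonneg) (simp add: lattice_term_nonneg)
  \<comment> \<open>For y \<ge> Y this gives 2 y^3 - b S \<ge> |f 1|, because y^3 \<ge> y;
    multiplication by y^3 \<ge> 1 yields f y \<ge> f 1.\<close>
  define Y where "Y = 1 + b * S + \<bar>f 1\<bar>"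
  have Y1: "Y \<ge> 1" using S0 assms by (simp add: Y_def)
  have "continuous_on {1..Y} f"
    unfolding f_def[abs_def] by (intro continuous_intros continuous_on_lattice_sum_axis) auto
  then obtain y0 where y0: "y0 \<in> {1..Y}" "\<And>y. y \<in> {1..Y} \<Longrightarrow> f y0 \<le> f y"
    using continuous_attains_inf[of "{1..Y}" f] Y1 by auto
  have big: "f 1 \<le> f y" if y: "y \<ge> Y" for y
  proof -
    have y1: "y \<ge> 1" using y Y1 by simp
    have l6: "2 * y ^ 6 \<le> lattice_sum 6 0 y"
    proof -
      have "(\<Sum>p\<in>{(0, 1), (0, - 1)}. lattice_term 0 y p ^ 6) \<le> lattice_sum 6 0 y"
        unfolding lattice_sum_def using y1
        by (intro finite_sum_le_infsum summable_lattice_term zero_le_power lattice_term_nonneg) (auto simp: lattice_def)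
      thus ?thesis by (simp add: lattice_term_def)
    qed
    have l3: "lattice_sum 3 0 y \<le> y ^ 3 * S"
    proof -
      have "lattice_sum 3 0 y \<le> (y ^ 3 + (1 / y) ^ 3) / 2 * S"
        unfolding S_def using y1 by (intro lattice_sum_3_axis_le) auto
      also have "\<dots> \<le> y ^ 3 * S"
      proof (intro mult_right_mono S0)
        have "(1 / y) ^ 3 \<le> y ^ 3" using y1 by (intro power_mono) (auto simp: field_simps intro: order_trans[OF y1])
        thus "(y ^ 3 + (1 / y) ^ 3) / 2 \<le> y ^ 3" by simp
      qed
      finally show ?thesis .
    qed
    have y3: "y \<le> y ^ 3" using y1 power_increasing[of 1 3 y] by simp
    have "f 1 \<le> 1 * \<bar>f 1\<bar>" by simp
    also have "\<dots> \<le> y ^ 3 * (2 * y ^ 3 - b * S)"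
    proof (intro mult_mono)
      show "\<bar>f 1\<bar> \<le> 2 * y ^ 3 - b * S" using y3 y y1 by (simp add: Y_def)
    qed (use y1 in auto)
    also have "\<dots> = 2 * y ^ 6 - b * (y ^ 3 * S)" by algebra
    also have "\<dots> \<le> f y" unfolding f_def using l6 l3 assms by (intro diff_mono mult_left_mono) auto
    finally show ?thesis .
  qed
  have "f y0 \<le> f y" if "y \<ge> 1" for y
  proof (cases "y \<le> Y")
    case True
    thus ?thesis using y0 that by auto
  next
    case False
    thus ?thesis using y0(2)[of 1] Y1 big[of y] by auto
  qed
  thus thesis using that[of y0] y0(1) by (auto simp: f_def)
qed

section \<open>The axis and the closed fundamental domain\<close>

lemma Gamma_a_subset_closure_D_G: "Gamma_a \<subseteq> closure D_G"
proof
  fix z assume z: "z \<in> Gamma_a"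
  \<comment> \<open>The shift by 3 keeps the real part below 1/2; its positivity puts w n strictly
    outside the unit circle even when Im z = 1.\<close>
  define w where "w n = Complex (1 / real (n + 3)) (Im z)" for n :: nat
  have "w n \<in> D_G" for n
  proof -
    have "1 < (1 / real (n + 3))\<^sup>2 + (Im z)\<^sup>2"
      using z by (intro add_pos_nonneg[of _ "_ - 1", simplified] less_le_trans[OF _ add_left_mono[OF one_le_power]])
        (auto simp: Gamma_a_def)
    hence "1 < cmod (w n)" by (simp add: w_def cmod_def)
    thus ?thesis using z by (auto simp: D_G_def w_def Gamma_a_def field_simps)
  qed
  moreover have "w \<longlonglongrightarrow> z"
  proof -
    have "(\<lambda>n. 1 / real (n + 3)) \<longlonglongrightarrow> 0"
      using LIMSEQ_ignore_initial_segment[OF lim_1_over_n, of 3] by simp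
    hence "w \<longlonglongrightarrow> Complex 0 (Im z)" unfolding w_def[abs_def] by (intro tendsto_intros)
    moreover have "Complex 0 (Im z) = z" using z by (simp add: Gamma_a_def complex_eq_iff)
    ultimately show ?thesis by simp
  qed
  ultimately show "z \<in> closure D_G" unfolding closure_sequential by blast
qed

lemma closure_D_G_subset_upper_half_plane: "closure D_G \<subseteq> upper_half_plane"
proof -
  let ?T = "{z. 0 \<le> Re z} \<inter> {z. Re z \<le> 1 / 2} \<inter> {z. 0 \<le> Im z} \<inter> {z. 1 \<le> cmod z}"
  have "closed ?T"
    by (intro closed_Int closed_Collect_le continuous_intros)
  hence "closure D_G \<subseteq> ?T" by (intro closure_minimal) (auto simp: D_G_def)
  \<comment> \<open>A real point of the closure would have modulus at most 1/2.\<close>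
  moreover have "Im z > 0" if "z \<in> ?T" for z
  proof (rule ccontr)
    assume "\<not> Im z > 0"
    hence "Im z = 0" using that by simp
    hence "cmod z = \<bar>Re z\<bar>" by (simp add: cmod_def)
    thus False using that by auto
  qed
  ultimately show ?thesis unfolding upper_half_plane_def by blast
qed

theorem theorem3p2:
  shows "(\<forall>b::real. b \<ge> 3062 / 1000 \<longrightarrow>
            (\<exists>m. is_min_on (\<lambda>z. epstein_zeta 6 z - b * epstein_zeta 3 z) upper_half_plane m
               \<and> is_min_on (\<lambda>z. epstein_zeta 6 z - b * epstein_zeta 3 z) (closure D_G) m
               \<and> is_min_on (\<lambda>z. epstein_zeta 6 z - b * epstein_zeta 3 z) Gamma_path m))
       \<and> (\<forall>b::real. b \<ge> 3 \<longrightarrow>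
            (\<exists>m. is_min_on (\<lambda>z. epstein_zeta 6 z - b * epstein_zeta 3 z)
                     (closure D_G \<inter> {z. Im z \<ge> 1}) m
               \<and> is_min_on (\<lambda>z. epstein_zeta 6 z - b * epstein_zeta 3 z) Gamma_a m))"
proof -
  define W where "W b x y = lattice_sum 6 x y - b * lattice_sum 3 x y" for b x y
  have zeta: "epstein_zeta 6 z - b * epstein_zeta 3 z = W b (Re z) (Im z)" if "Im z > 0" for z b
    unfolding W_def using epstein_zeta_numeral[OF that] by simp
  have axis: "\<exists>y0\<ge>1. (\<forall>y\<ge>1. W b 0 y0 \<le> W b 0 y) \<and> (\<forall>x y. y \<ge> 1 \<longrightarrow> W b 0 y0 \<le> W b x y)" if b: "b \<ge> 3" for b
  proof -
    obtain y0 where y0: "y0 \<ge> 1" "\<And>y. y \<ge> 1 \<Longrightarrow> W b 0 y0 \<le> W b 0 y"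
      using lattice_energy_axis_min[of b] b unfolding W_def by auto
    moreover have "W b 0 y \<le> W b x y" if "y \<ge> 1" for x y
      unfolding W_def by (rule lattice_energy_ge_axis[OF that b])
    ultimately show ?thesis by (meson order_trans)
  qed
  show ?thesis
  proof (intro conjI allI impI)
    fix b :: real assume b: "b \<ge> 3062 / 1000"
    then obtain y0 where y0: "y0 \<ge> 1" "\<And>y. y \<ge> 1 \<Longrightarrow> W b 0 y0 \<le> W b 0 y" "\<And>x y. y \<ge> 1 \<Longrightarrow> W b 0 y0 \<le> W b x y"
      using axis[of b] by auto
    define z0 where "z0 = Complex 0 y0"
    have z0: "z0 \<in> Gamma_a" using y0(1) by (simp add: z0_def Gamma_a_def)
    have W0: "epstein_zeta 6 z0 - b * epstein_zeta 3 z0 = W b 0 y0"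
      using zeta[of z0 b] y0(1) by (simp add: z0_def)
    have lower: "W b 0 y0 \<le> epstein_zeta 6 z - b * epstein_zeta 3 z" if z: "z \<in> upper_half_plane" for z
    proof -
      have Im: "Im z > 0" using z by (simp add: upper_half_plane_def)
      obtain x' y' where r: "y' > 0" "lattice_equiv (Re z) (Im z) x' y'" "0 \<le> x'" "x' \<le> 1 / 2" "1 \<le> x'\<^sup>2 + y'\<^sup>2"
        using lattice_reduction[OF Im] by blast
      have "W b 0 y0 \<le> W b x' y'"
      proof (cases "y' \<ge> 1")
        \<comment> \<open>Here x' \<le> 1/2 forces y' \<ge> 0.866, and the comparison point i is
          itself on the half line.\<close>
        case False
        have "x'\<^sup>2 \<le> (1 / 2)\<^sup>2" using r by (intro power_mono) auto
        hence "(866 / 1000)\<^sup>2 \<le> y'\<^sup>2" using r(5) by (simp add: power_divide)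
        hence "866 / 1000 \<le> y'" using r(1) by (meson less_imp_le power2_le_imp_le)
        hence "W b 0 1 \<le> W b x' y'"
          unfolding W_def using False r b by (intro lattice_energy_ge_square) auto
        thus ?thesis using y0(2)[of 1] by simp
      qed (use y0 in auto)
      also have "W b x' y' = W b (Re z) (Im z)"
        unfolding W_def using lattice_equiv_sum[OF r(2)] by simp
      finally show ?thesis using zeta[OF Im] by simp
    qed
    \<comment> \<open>One point z0 lies in all three sets and the lower bound holds on the half
      plane containing them, so the three minima coincide.\<close>
    have sub: "closure D_G \<subseteq> upper_half_plane" "Gamma_path \<subseteq> upper_half_plane" "z0 \<in> closure D_G"
      "z0 \<in> Gamma_path" "z0 \<in> upper_half_plane"
      using closure_D_G_subset_upper_half_plane Gamma_a_subset_closure_D_G z0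
      by (auto simp: Gamma_path_def Gamma_a_def Gamma_b_def upper_half_plane_def)
    show "\<exists>m. is_min_on (\<lambda>z. epstein_zeta 6 z - b * epstein_zeta 3 z) upper_half_plane m
               \<and> is_min_on (\<lambda>z. epstein_zeta 6 z - b * epstein_zeta 3 z) (closure D_G) m
               \<and> is_min_on (\<lambda>z. epstein_zeta 6 z - b * epstein_zeta 3 z) Gamma_path m"
      unfolding is_min_on_def using sub lower W0 by (intro exI[of _ "W b 0 y0"]) blast
  next
    fix b :: real assume b: "b \<ge> 3"
    then obtain y0 where y0: "y0 \<ge> 1" "\<And>x y. y \<ge> 1 \<Longrightarrow> W b 0 y0 \<le> W b x y"
      using axis[of b] by auto
    define z0 where "z0 = Complex 0 y0"
    have z0: "z0 \<in> Gamma_a" using y0(1) by (simp add: z0_def Gamma_a_def)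
    have W0: "epstein_zeta 6 z0 - b * epstein_zeta 3 z0 = W b 0 y0"
      using zeta[of z0 b] y0(1) by (simp add: z0_def)
    have lower: "W b 0 y0 \<le> epstein_zeta 6 z - b * epstein_zeta 3 z" if "Im z \<ge> 1" for z
      using zeta[of z b] y0(2)[OF that] that by simp
    have "z0 \<in> closure D_G \<inter> {z. Im z \<ge> 1}"
      using Gamma_a_subset_closure_D_G z0 by (auto simp: Gamma_a_def)
    moreover have "\<forall>z\<in>Gamma_a. W b 0 y0 \<le> epstein_zeta 6 z - b * epstein_zeta 3 z"
      using lower by (auto simp: Gamma_a_def)
    ultimately show "\<exists>m. is_min_on (\<lambda>z. epstein_zeta 6 z - b * epstein_zeta 3 z) (closure D_G \<inter> {z. Im z \<ge> 1}) m
               \<and> is_min_on (\<lambda>z. epstein_zeta 6 z - b * epstein_zeta 3 z) Gamma_a m"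
      unfolding is_min_on_def using lower W0 z0 by (intro exI[of _ "W b 0 y0"]) blast
  qed
qed

end
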